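(* The Choquet simplex $\mathcal S_{\mathbb P_{\mathbb N}}(\mathrm{CAR}(\mathbb N))$ of symmetric states has a $*$-weakly closed boundary (i.e. its set of extreme points is $*$-weakly closed) and is affinely isomorphic to the set of probability measures on a closed interval.
   Context: $\mathrm{CAR}(\mathbb N)$ is the unital $C^*$-algebra generated by $\{a_j,a_j^\dagger : j\in\mathbb N\}$ with $(a_j)^*=a_j^\dagger$, $\{a_j^\dagger,a_k\}=\delta_{jk}1$, $\{a_j,a_k\}=\{a_j^\dagger,a_k^\dagger\}=0$, where $\{a,b\}=ab+ba$. $\mathbb P_{\mathbb N}$ is the group of permutations of $\mathbb N$ moving only finitely many elements, acting on $\mathrm{CAR}(\mathbb N)$ by the automorphisms $\alpha_g$ with $\alpha_g(a_j)=a_{gj}$. A state $\varphi$ is symmetric if $\varphi\circ\alpha_g=\varphi$ for all $g\in\mathbb P_{\mathbb N}$; $\mathcal S_{\mathbb P_{\mathbb N}}(\mathrm{CAR}(\mathbb N))$ is the convex, $*$-weakly compact set of symmetric states. Affine isomorphism is meant in the category of compact convex sets (affine homeomorphism for the $*$-weak topologies). *)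

theory Defs
  imports "HOL-Probability.Probability" "HOL-Library.Function_Algebras"
begin

section \<open>Functions as a real vector space\<close>

text \<open>Pointwise scalar multiplication; this makes \<open>convex\<close> and \<open>extreme_point_of\<close> available for
  sets of functionals.\<close>

instantiation "fun" :: (type, real_vector) real_vector
begin

definition scaleR_fun :: "real \<Rightarrow> ('a \<Rightarrow> 'b) \<Rightarrow> 'a \<Rightarrow> 'b" where
  "scaleR_fun r f = (\<lambda>x. r *\<^sub>R f x)"

instance
  by standard (simp_all add: scaleR_fun_def fun_eq_iff scaleR_add_right scaleR_add_left)

end

lemma scaleR_fun_apply [simp]: "(r *\<^sub>R f) x = r *\<^sub>R f x"
  by (simp add: scaleR_fun_def)


section \<open>Unital C*-algebras\<close>

class cstar_algebra = real_normed_algebra_1 + banach +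
  fixes scaleC :: "complex \<Rightarrow> 'a \<Rightarrow> 'a"  (infixr \<open>*\<^sub>C\<close> 75)
    and star :: "'a \<Rightarrow> 'a"
  assumes scaleC_of_real: "of_real r *\<^sub>C x = r *\<^sub>R x"
    and scaleC_add_right: "c *\<^sub>C (x + y) = c *\<^sub>C x + c *\<^sub>C y"
    and scaleC_add_left: "(c + d) *\<^sub>C x = c *\<^sub>C x + d *\<^sub>C x"
    and scaleC_scaleC: "c *\<^sub>C d *\<^sub>C x = (c * d) *\<^sub>C x"
    and mult_scaleC_left: "(c *\<^sub>C x) * y = c *\<^sub>C (x * y)"
    and mult_scaleC_right: "x * (c *\<^sub>C y) = c *\<^sub>C (x * y)"
    and norm_scaleC: "norm (c *\<^sub>C x) = cmod c * norm x"
    and star_add: "star (x + y) = star x + star y"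
    and star_scaleC: "star (c *\<^sub>C x) = cnj c *\<^sub>C star x"
    and star_mult: "star (x * y) = star y * star x"
    and star_star: "star (star x) = x"
    and cstar_identity: "norm (star x * x) = (norm x)\<^sup>2"

definition cstar_subalgebra :: "'a::cstar_algebra set \<Rightarrow> bool" where
  "cstar_subalgebra B \<longleftrightarrow> closed B \<and> 1 \<in> B \<and>
     (\<forall>x\<in>B. \<forall>y\<in>B. x + y \<in> B \<and> x * y \<in> B) \<and>
     (\<forall>c. \<forall>x\<in>B. c *\<^sub>C x \<in> B) \<and> (\<forall>x\<in>B. star x \<in> B)"

text \<open>Norm preservation is automatic for bijective \<open>*\<close>-homomorphisms of C*-algebras; it is listed
  because the norm is part of the structure.\<close>

definition cstar_automorphism :: "('a::cstar_algebra \<Rightarrow> 'a) \<Rightarrow> bool" where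
  "cstar_automorphism \<alpha> \<longleftrightarrow> bij \<alpha> \<and> \<alpha> 1 = 1 \<and>
     (\<forall>x y. \<alpha> (x + y) = \<alpha> x + \<alpha> y) \<and> (\<forall>x y. \<alpha> (x * y) = \<alpha> x * \<alpha> y) \<and>
     (\<forall>c x. \<alpha> (c *\<^sub>C x) = c *\<^sub>C \<alpha> x) \<and> (\<forall>x. \<alpha> (star x) = star (\<alpha> x)) \<and>
     (\<forall>x. norm (\<alpha> x) = norm x)"

definition cstar_dual :: "('a::cstar_algebra \<Rightarrow> complex) set" where
  "cstar_dual = {\<phi>. (\<forall>x y. \<phi> (x + y) = \<phi> x + \<phi> y) \<and> (\<forall>c x. \<phi> (c *\<^sub>C x) = c * \<phi> x) \<and>
     (\<exists>K. \<forall>x. cmod (\<phi> x) \<le> K * norm x)}"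

definition weak_star :: "('a::cstar_algebra \<Rightarrow> complex) topology" where
  "weak_star = subtopology (product_topology (\<lambda>_. euclidean) UNIV) cstar_dual"

definition states :: "('a::cstar_algebra \<Rightarrow> complex) set" where
  "states = {\<phi> \<in> cstar_dual. (\<forall>x. \<phi> (star x * x) \<in> \<real> \<and> 0 \<le> Re (\<phi> (star x * x))) \<and> \<phi> 1 = 1}"


section \<open>The CAR algebra and its symmetric states\<close>

text \<open>The type \<open>'a\<close> together with \<open>a\<close> is a model of \<open>CAR(\<nat>)\<close>: a unital C*-algebra generated by
  annihilators \<open>a j\<close> with creators \<open>star (a j)\<close>. Any two models are isomorphic by a unique
  isomorphism matching the generators.\<close>

locale car_algebra =
  fixes a :: "nat \<Rightarrow> 'a::cstar_algebra"
  assumes creation_annihilation: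
      "star (a j) * a k + a k * star (a j) = (if j = k then 1 else 0)"
    and annihilation_annihilation: "a j * a k + a k * a j = 0"
    and creation_creation: "star (a j) * star (a k) + star (a k) * star (a j) = 0"
    and generated: "cstar_subalgebra hull range a = UNIV"

definition finitary_perms :: "(nat \<Rightarrow> nat) set" where
  "finitary_perms = {g. bij g \<and> finite {j. g j \<noteq> j}}"

text \<open>By the uniqueness of \<open>CAR(\<nat>)\<close>, exactly one such \<open>\<alpha>\<close> exists for every permutation \<open>g\<close>.\<close>

definition car_action :: "(nat \<Rightarrow> 'a::cstar_algebra) \<Rightarrow> (nat \<Rightarrow> nat) \<Rightarrow> 'a \<Rightarrow> 'a" where
  "car_action a g = (THE \<alpha>. cstar_automorphism \<alpha> \<and> (\<forall>j. \<alpha> (a j) = a (g j)))"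

definition symmetric_states :: "(nat \<Rightarrow> 'a::cstar_algebra) \<Rightarrow> ('a \<Rightarrow> complex) set" where
  "symmetric_states a = {\<phi> \<in> states. \<forall>g\<in>finitary_perms. \<phi> \<circ> car_action a g = \<phi>}"


section \<open>Choquet simplices\<close>

text \<open>\<open>C\<close> is a lattice in its own order, in which \<open>p\<close> is below \<open>q\<close> iff \<open>q - p \<in> C\<close>.\<close>

definition lattice_cone :: "'v::real_vector set \<Rightarrow> bool" where
  "lattice_cone C \<longleftrightarrow> (\<forall>p\<in>C. \<forall>q\<in>C.
     (\<exists>s\<in>C. s - p \<in> C \<and> s - q \<in> C \<and> (\<forall>u\<in>C. u - p \<in> C \<and> u - q \<in> C \<longrightarrow> u - s \<in> C)) \<and>
     (\<exists>i\<in>C. p - i \<in> C \<and> q - i \<in> C \<and> (\<forall>u\<in>C. p - u \<in> C \<and> q - u \<in> C \<longrightarrow> i - u \<in> C)))"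

text \<open>Placing \<open>K\<close> at height 1 makes it a base of the cone it generates, wherever \<open>K\<close> lies.\<close>

definition choquet_simplex :: "'v::real_vector topology \<Rightarrow> 'v set \<Rightarrow> bool" where
  "choquet_simplex T K \<longleftrightarrow> compactin T K \<and> convex K \<and> lattice_cone (cone hull ({1::real} \<times> K))"


section \<open>Probability measures on a closed interval\<close>

definition interval_probs :: "real \<Rightarrow> real \<Rightarrow> real measure set" where
  "interval_probs l u = {M. prob_space M \<and> sets M = sets (restrict_space borel {l..u})}"

text \<open>The \<open>*\<close>-weak topology as functionals on \<open>C[l,u]\<close>.\<close>

definition interval_probs_topology :: "real \<Rightarrow> real \<Rightarrow> real measure topology" where
  "interval_probs_topology l u = topology_generated_by
     {{M \<in> interval_probs l u. (\<integral>x. f x \<partial>M) \<in> U} | f U.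
        continuous_on {l..u} (f :: real \<Rightarrow> real) \<and> open U}"

text \<open>The type of measures carries no vector space structure, so \<open>L = t M + (1 - t) N\<close> is
  expressed setwise.\<close>

definition affine_on_interval_probs ::
  "real \<Rightarrow> real \<Rightarrow> (real measure \<Rightarrow> 'v::real_vector) \<Rightarrow> bool" where
  "affine_on_interval_probs l u F \<longleftrightarrow>
     (\<forall>M\<in>interval_probs l u. \<forall>N\<in>interval_probs l u. \<forall>L\<in>interval_probs l u. \<forall>t\<in>{0..1}.
        (\<forall>A\<in>sets (restrict_space borel {l..u}).
           measure L A = t * measure M A + (1 - t) * measure N A)
        \<longrightarrow> F L = t *\<^sub>R F M + (1 - t) *\<^sub>R F N)"

end

theory Submission
  imports Defs "HOL-Combinatorics.Permutations"
begin

text \<open>Transpositions of modes are implemented by self-adjoint unitaries of the algebra, so the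
  permutation action exists. Averaging \<open>a\<^sub>k\<close> over \<open>L\<close> modes gives an operator of norm at most
  \<open>1 / sqrt L\<close>; hence a symmetric state kills every monomial in which some mode occurs through an
  unpaired \<open>a\<^sub>j\<close> or \<open>a\<^sub>j\<^sup>*\<close>, and it is determined by the moments
  \<open>\<phi> (n\<^sub>1 \<cdots> n\<^sub>k)\<close> of the occupation numbers \<open>n\<^sub>j = a\<^sub>j\<^sup>* a\<^sub>j\<close>. By positivity on the spectral
  projections of \<open>n\<^sub>1, \<dots>, n\<^sub>N\<close> these moments are those of a unique probability measure on
  \<open>[0, 1]\<close>. Conversely the product states \<open>\<phi>\<^sub>\<mu>\<close> with \<open>k\<close>-th moment \<open>\<mu>\<^sup>k\<close> exist, and
  \<open>M \<mapsto> \<integral> \<phi>\<^sub>\<mu> dM(\<mu>)\<close> is the affine homeomorphism. The lattice structure of the cone is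
  that of the finite measures on \<open>[0, 1]\<close>, and a state is extreme iff its measure has variance
  zero, a condition that is closed in the first two moments.\<close>

section \<open>C*-algebras\<close>

text \<open>The algebra is given only through the relations and the density of the polynomials in
  the generators; no representation is chosen. Functionals are therefore built on polynomials in
  finitely many modes, bounded there by the norm, and extended by uniform continuity. The building
  block is the projection \<open>config s N\<close> onto a definite occupation pattern of the first
  \<open>N\<close> modes: compression by it is scalar on these modes and gives a pure state.
  Averaging the pure states with independent Bernoulli weights gives the product states, whose
  positivity is then inherited. Conversely, the values of a symmetric state at these projections
  form an exchangeable law of occupation numbers, and the mixing measure arises as a weak limit of
  the laws of the fraction of occupied modes, as in de Finetti's theorem: sampling without
  replacement approaches sampling with replacement. Finite measures of arbitrary mass are carried
  along because the simplex property concerns the cone over the states.\<close>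

lemma scaleC_zero_left [simp]: "0 *\<^sub>C (x::'a::cstar_algebra) = 0"
  using scaleC_of_real[of 0 x] by simp

lemma scaleC_one [simp]: "1 *\<^sub>C (x::'a::cstar_algebra) = x"
  using scaleC_of_real[of 1 x] by simp

lemma scaleC_minus_one: "(- 1) *\<^sub>C (x::'a::cstar_algebra) = - x"
  using scaleC_of_real[of "- 1" x] by simp

lemma scaleC_zero_right [simp]: "c *\<^sub>C (0::'a::cstar_algebra) = 0"
  using scaleC_add_right[of c "0::'a" 0] by simp

lemma scaleC_diff_left: "(c - d) *\<^sub>C (x::'a::cstar_algebra) = c *\<^sub>C x - d *\<^sub>C x"
  using scaleC_add_left[of "c - d" d x] by (simp add: algebra_simps)

lemma scaleC_cancel_right:
  "c *\<^sub>C (x::'a::cstar_algebra) = d *\<^sub>C x \<Longrightarrow> x \<noteq> 0 \<Longrightarrow> c = d"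
  by (metis norm_scaleC scaleC_diff_left eq_iff_diff_eq_0 mult_eq_0_iff norm_eq_zero)

lemma star_zero [simp]: "star (0::'a::cstar_algebra) = 0"
  using star_add[of "0::'a" 0] by simp

lemma star_one [simp]: "star (1::'a::cstar_algebra) = 1"
  by (metis mult_1 mult_1_right star_mult star_star)

lemma star_minus: "star (- x::'a::cstar_algebra) = - star x"
  using star_add[of x "- x"] by (simp add: eq_neg_iff_add_eq_0 add.commute)

lemma star_diff: "star (x - y::'a::cstar_algebra) = star x - star y"
  using star_add[of x "- y"] by (simp add: star_minus)

lemma star_scaleR: "star (r *\<^sub>R x::'a::cstar_algebra) = r *\<^sub>R star x"
  using star_scaleC[of "of_real r" x] by (simp add: scaleC_of_real)

lemma norm_star [simp]: "norm (star x::'a::cstar_algebra) = norm x"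
proof -
  have le: "norm y \<le> norm (star y)" for y :: 'a
  proof (cases "norm y = 0")
    case False
    have "norm y * norm y \<le> norm (star y) * norm y"
      using norm_mult_ineq[of "star y" y] by (simp add: cstar_identity power2_eq_square)
    then show ?thesis using False by simp
  qed simp
  show ?thesis using le[of x] le[of "star x"] by (simp add: star_star)
qed

lemma bounded_linear_star: "bounded_linear (star :: 'a::cstar_algebra \<Rightarrow> 'a)"
  by (rule bounded_linear_intro[of _ 1]) (simp_all add: star_add star_scaleR)

lemma bounded_linear_scaleC: "bounded_linear (\<lambda>x::'a::cstar_algebra. c *\<^sub>C x)"
proof (rule bounded_linear_intro[of _ "cmod c"])
  show "c *\<^sub>C (r *\<^sub>R x) = r *\<^sub>R (c *\<^sub>C x)" for r and x :: 'a
    by (simp flip: scaleC_of_real add: scaleC_scaleC mult.commute)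
qed (simp_all add: scaleC_add_right norm_scaleC)

lemma norm_projection:
  fixes p :: "'a::cstar_algebra"
  assumes "star p = p" "p * p = p" "p \<noteq> 0"
  shows "norm p = 1"
  using cstar_identity[of p] assms by (simp add: power2_eq_square)

lemma cstar_automorphism_scaleR:
  "cstar_automorphism \<alpha> \<Longrightarrow> \<alpha> (r *\<^sub>R x) = r *\<^sub>R \<alpha> x"
  unfolding cstar_automorphism_def by (metis scaleC_of_real)

lemma cstar_automorphism_bounded_linear:
  "cstar_automorphism \<alpha> \<Longrightarrow> bounded_linear \<alpha>"
  by (rule bounded_linear_intro[of _ 1])
     (simp_all add: cstar_automorphism_scaleR, simp_all add: cstar_automorphism_def)

lemma cstar_automorphism_comp:
  "cstar_automorphism \<alpha> \<Longrightarrow> cstar_automorphism \<beta> \<Longrightarrow> cstar_automorphism (\<alpha> \<circ> \<beta>)"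
  unfolding cstar_automorphism_def by (auto intro: bij_comp)

text \<open>Left multiplication by \<open>u\<close> is isometric by the C*-identity, since
  \<open>star (u * x) * (u * x) = star x * x\<close>; right multiplication follows by adjoints.
  Conjugation is its own inverse.\<close>

lemma cstar_automorphism_conjugation:
  fixes u :: "'a::cstar_algebra"
  assumes u: "star u = u" "u * u = 1"
  shows "cstar_automorphism (\<lambda>x. u * x * u)"
proof -
  have uu: "u * (u * x) = x" "x * u * u = x" for x
    using u(2) by (simp_all add: mult.assoc flip: mult.assoc[of u u])
  have nu: "norm (u * x) = norm x" for x
  proof -
    have "(norm (u * x))\<^sup>2 = (norm x)\<^sup>2"
      using cstar_identity[of "u * x"] cstar_identity[of x]
      by (simp add: star_mult u mult.assoc uu)
    then show ?thesis by (simp add: power2_eq_iff_nonneg)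
  qed
  have nu': "norm (x * u) = norm x" for x
    using nu[of "star x"] norm_star[of "x * u"] by (simp add: star_mult u)
  have "bij (\<lambda>x. u * x * u)"
    by (rule o_bij[of "\<lambda>x. u * x * u"]) (auto simp: fun_eq_iff mult.assoc uu u(2))
  then show ?thesis
    unfolding cstar_automorphism_def
    by (simp add: u nu nu' distrib_left distrib_right mult_scaleC_left mult_scaleC_right star_mult
        mult.assoc uu)
qed

text \<open>Reduces an equality of automorphisms to the generators, through minimality of the
  hull.\<close>

lemma cstar_subalgebra_equalizer:
  assumes "cstar_automorphism \<alpha>" "cstar_automorphism \<beta>"
  shows "cstar_subalgebra {x. \<alpha> x = \<beta> x}"
proof -
  have "closed {x. \<alpha> x = \<beta> x}"
    using assms[THEN cstar_automorphism_bounded_linear]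
    by (intro closed_Collect_eq linear_continuous_on)
  then show ?thesis
    using assms unfolding cstar_subalgebra_def cstar_automorphism_def by auto
qed

section \<open>Anticommutation relations\<close>

context car_algebra
begin

abbreviation num :: "nat \<Rightarrow> 'a" where
  "num j \<equiv> star (a j) * a j"

abbreviation letters :: "nat \<Rightarrow> 'a set" where
  "letters j \<equiv> {a j, star (a j)}"

lemma a_sq: "a j * a j = 0"
proof -
  have "2 *\<^sub>R (a j * a j) = 0"
    using annihilation_annihilation[of j j] by (simp add: scaleR_2)
  then show ?thesis by simp
qed

lemma star_a_sq: "star (a j) * star (a j) = 0"
  using a_sq[of j] by (metis star_mult star_zero)

lemma a_star_a: "a j * star (a j) = 1 - num j"
  using creation_annihilation[of j j] by (simp add: algebra_simps)

lemma letters_anticommute: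
  assumes "j \<noteq> k" "x \<in> letters j" "y \<in> letters k"
  shows "x * y = - (y * x)"
  using assms creation_annihilation[of j k] creation_annihilation[of k j]
    annihilation_annihilation[of j k] creation_creation[of j k]
  by (auto simp: eq_neg_iff_add_eq_0 add.commute)

lemma num_commute_letters:
  assumes "j \<noteq> k" "y \<in> letters k"
  shows "num j * y = y * num j"
proof -
  have "num j * y = star (a j) * (a j * y)"
    by (simp add: mult.assoc)
  also have "\<dots> = - (star (a j) * y * a j)"
    using letters_anticommute[OF assms(1) _ assms(2), of "a j"] by (simp add: mult.assoc)
  also have "\<dots> = y * num j"
    using letters_anticommute[OF assms(1) _ assms(2), of "star (a j)"] by (simp add: mult.assoc)
  finally show ?thesis .
qed

lemma num_a: "num j * a j = 0"
  by (simp add: mult.assoc a_sq)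

lemma star_a_num: "star (a j) * num j = 0"
  by (simp add: star_a_sq flip: mult.assoc)

lemma a_num: "a j * num j = a j"
  by (simp add: a_star_a num_a left_diff_distrib flip: mult.assoc)

lemma num_star_a: "num j * star (a j) = star (a j)"
  by (simp add: mult.assoc a_star_a star_a_num right_diff_distrib)

lemma num_idem: "num j * num j = num j"
  by (simp add: mult.assoc a_num)

lemma star_num: "star (num j) = num j"
  by (simp add: star_mult star_star)

lemmas mode_simps = a_sq star_a_sq a_star_a num_a star_a_num a_num num_star_a num_idem star_num

subsection \<open>The permutation action\<close>

text \<open>Since \<open>d * d = 0\<close> and \<open>d * star d + star d * d = 2\<close>, half of
  \<open>star d * d\<close> is a projection and \<open>u = 1 - star d * d\<close> is the
  corresponding reflection. Conjugation by \<open>u\<close> sends \<open>d = a j - a k\<close> to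
  \<open>- d\<close> and fixes whatever anticommutes with both \<open>d\<close> and
  \<open>star d\<close>, in particular \<open>a j + a k\<close> and the remaining generators.
  Together this exchanges the two modes.\<close>

lemma transpose_automorphism:
  assumes "j \<noteq> k"
  shows "\<exists>\<alpha>. cstar_automorphism \<alpha> \<and> (\<forall>i. \<alpha> (a i) = a (Transposition.transpose j k i))"
proof -
  define d where "d = a j - a k"
  define u where "u = 1 - star d * d"
  have d_sq: "d * d = 0"
    using letters_anticommute[OF assms, of "a j" "a k"] by (simp add: d_def algebra_simps a_sq)
  have d_sd: "d * star d = 2 - star d * d"
    using letters_anticommute[OF assms, of "a j" "star (a k)"]
      letters_anticommute[OF assms, of "star (a j)" "a k"]
    by (simp add: d_def star_diff algebra_simps a_star_a)
  have dsd: "d * (star d * d) = 2 * d"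
  proof -
    have "d * (star d * d) = (2 - star d * d) * d"
      by (simp add: d_sd flip: mult.assoc)
    then show ?thesis by (simp add: left_diff_distrib mult.assoc d_sq)
  qed
  have ud: "u * d = d"
    by (simp add: u_def left_diff_distrib mult.assoc d_sq)
  have du: "d * u = - d"
    by (simp add: u_def right_diff_distrib dsd mult_2)
  have su: "star u = u"
    by (simp add: u_def star_diff star_mult star_star)
  have uu: "u * u = 1"
  proof -
    have "(1 - star d * d) * u = u - star d * (d * u)"
      by (simp add: left_diff_distrib mult.assoc)
    also have "\<dots> = 1"
      by (simp add: du) (simp add: u_def)
    finally show ?thesis by (simp add: u_def)
  qed
  have udu: "u * d * u = - d"
    by (simp add: ud du)
  have anti: "u * e * u = e" if e: "d * e = - (e * d)" "star d * e = - (e * star d)" for e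
  proof -
    have "star d * d * e = e * (star d * d)"
    proof -
      have "star d * d * e = - (star d * e * d)"
        by (simp add: mult.assoc e(1))
      also have "\<dots> = e * (star d * d)"
        by (simp add: e(2) mult.assoc)
      finally show ?thesis .
    qed
    then have "u * e = e * u" by (simp add: u_def left_diff_distrib right_diff_distrib)
    then show ?thesis by (simp add: mult.assoc uu)
  qed
  have other: "u * a i * u = a i" if "i \<noteq> j" "i \<noteq> k" for i
    using that letters_anticommute[of j i "a j" "a i"] letters_anticommute[of k i "a k" "a i"]
      letters_anticommute[of j i "star (a j)" "a i"] letters_anticommute[of k i "star (a k)" "a i"]
    by (intro anti) (auto simp: d_def star_diff algebra_simps)
  have sum: "u * (a j + a k) * u = a j + a k"
    using letters_anticommute[OF assms, of "a j" "a k"]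
      letters_anticommute[OF assms, of "a j" "star (a k)"]
      letters_anticommute[OF assms, of "star (a j)" "a k"]
    by (intro anti) (auto simp: d_def star_diff algebra_simps mode_simps)
  have "2 *\<^sub>R (u * a j * u) = u * (a j + a k) * u + u * d * u"
    by (simp add: d_def algebra_simps scaleR_2)
  also have "\<dots> = 2 *\<^sub>R a k"
    unfolding sum udu by (simp add: d_def scaleR_2)
  finally have "2 *\<^sub>R (u * a j * u) = 2 *\<^sub>R a k" .
  then have jk: "u * a j * u = a k" by simp
  have kj: "u * a k * u = a j"
    using sum jk by (simp add: algebra_simps)
  have "\<forall>i. u * a i * u = a (Transposition.transpose j k i)"
    using jk kj other by (auto simp: Transposition.transpose_def)
  with cstar_automorphism_conjugation[OF su uu] show ?thesis by blast
qed

lemma automorphism_unique: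
  assumes "cstar_automorphism \<alpha>" "cstar_automorphism \<beta>" "\<And>j. \<alpha> (a j) = \<beta> (a j)"
  shows "\<alpha> = \<beta>"
proof -
  have "cstar_subalgebra hull range a \<subseteq> {x. \<alpha> x = \<beta> x}"
    using assms by (intro hull_minimal cstar_subalgebra_equalizer) auto
  then show ?thesis using generated by auto
qed

text \<open>A permutation of finite support is a product of transpositions, and composing
  automorphisms matches composing permutations.\<close>

lemma finitary_automorphism:
  assumes "g \<in> finitary_perms"
  shows "\<exists>\<alpha>. cstar_automorphism \<alpha> \<and> (\<forall>j. \<alpha> (a j) = a (g j))"
proof -
  have "permutation g"
    using assms by (simp add: finitary_perms_def permutation)
  then obtain n where "swapidseq n g"
    by (auto simp: permutation_def)
  then show ?thesis
  proof induction
    case id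
    have "cstar_automorphism (id :: 'a \<Rightarrow> 'a)"
      by (simp add: cstar_automorphism_def)
    then show ?case by (metis id_apply)
  next
    case (comp_Suc n p j k)
    then show ?case
      using transpose_automorphism[of j k] cstar_automorphism_comp by (metis comp_apply)
  qed
qed

lemma
  assumes "g \<in> finitary_perms"
  shows car_action_automorphism: "cstar_automorphism (car_action a g)"
    and car_action_generator: "car_action a g (a j) = a (g j)"
proof -
  have "\<exists>!\<alpha>. cstar_automorphism \<alpha> \<and> (\<forall>j. \<alpha> (a j) = a (g j))"
    using finitary_automorphism[OF assms] automorphism_unique by metis
  from theI'[OF this] show "cstar_automorphism (car_action a g)" "car_action a g (a j) = a (g j)"
    unfolding car_action_def by auto
qed


subsection \<open>Local subalgebras\<close>

text \<open>The polynomials in the modes of \<open>S\<close>, without norm closure, so that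
  identities can be proved by rule induction. Adjoints are covered because \<open>letters j\<close>
  contains \<open>a j\<close> together with its adjoint.\<close>

inductive_set modes :: "nat set \<Rightarrow> 'a set" for S where
  modes_one: "1 \<in> modes S"
| modes_letter: "j \<in> S \<Longrightarrow> x \<in> letters j \<Longrightarrow> x \<in> modes S"
| modes_add: "x \<in> modes S \<Longrightarrow> y \<in> modes S \<Longrightarrow> x + y \<in> modes S"
| modes_mult: "x \<in> modes S \<Longrightarrow> y \<in> modes S \<Longrightarrow> x * y \<in> modes S"
| modes_scaleC: "x \<in> modes S \<Longrightarrow> c *\<^sub>C x \<in> modes S"

lemma modes_diff:
  assumes "x \<in> modes S" "y \<in> modes S"
  shows "x - y \<in> modes S"
  using modes_add[OF assms(1) modes_scaleC[OF assms(2), of "- 1"]] by (simp add: scaleC_minus_one)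

lemma modes_num: "j \<in> S \<Longrightarrow> num j \<in> modes S"
  by (intro modes_mult modes_letter[of j]) auto

lemma modes_mono: "S \<subseteq> T \<Longrightarrow> modes S \<subseteq> modes T"
proof
  fix x assume "S \<subseteq> T" "x \<in> modes S"
  from this(2) show "x \<in> modes T"
    by induction (use \<open>S \<subseteq> T\<close> in \<open>blast intro: modes.intros\<close>)+
qed

lemma modes_star: "x \<in> modes S \<Longrightarrow> star x \<in> modes S"
proof (induction rule: modes.induct)
  case (modes_letter j x)
  then show ?case by (auto simp: star_star intro: modes.modes_letter)
qed (auto simp: star_add star_mult star_scaleC intro: modes.intros)

lemma num_commute_modes:
  assumes "j \<notin> S" "x \<in> modes S"
  shows "num j * x = x * num j"
  using assms(2)
proof induction
  case (modes_letter k x)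
  with assms(1) show ?case by (intro num_commute_letters) auto
next
  case (modes_mult x y)
  then show ?case by (metis mult.assoc)
qed (simp_all add: distrib_left distrib_right mult_scaleC_left mult_scaleC_right)

text \<open>Linear combinations of products \<open>b\<^sub>0 b\<^sub>1 \<cdots> b\<close> with each \<open>b\<^sub>j\<close> one of \<open>1\<close>, \<open>a\<^sub>j\<close>,
  \<open>a\<^sub>j\<^sup>*\<close>, \<open>a\<^sub>j\<^sup>* a\<^sub>j\<close>, in this order of the modes.\<close>

primrec normal :: "nat \<Rightarrow> 'a set" where
  "normal 0 = range (\<lambda>c. c *\<^sub>C 1)"
| "normal (Suc N) = {x0 + x1 * a N + x2 * star (a N) + x3 * num N | x0 x1 x2 x3.
     x0 \<in> normal N \<and> x1 \<in> normal N \<and> x2 \<in> normal N \<and> x3 \<in> normal N}"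

lemma normal_SucI:
  assumes "x = x0 + x1 * a N + x2 * star (a N) + x3 * num N"
    "x0 \<in> normal N" "x1 \<in> normal N" "x2 \<in> normal N" "x3 \<in> normal N"
  shows "x \<in> normal (Suc N)"
  using assms by auto

lemma normal_scaleC: "x \<in> normal N \<Longrightarrow> c *\<^sub>C x \<in> normal N"
proof (induction N arbitrary: x)
  case 0
  then show ?case by (auto simp: scaleC_scaleC)
next
  case (Suc N)
  from Suc.prems obtain x0 x1 x2 x3 where
    x: "x = x0 + x1 * a N + x2 * star (a N) + x3 * num N"
      "x0 \<in> normal N" "x1 \<in> normal N" "x2 \<in> normal N" "x3 \<in> normal N" by auto
  show ?case
    by (rule normal_SucI[of _ "c *\<^sub>C x0" "c *\<^sub>C x1" _ "c *\<^sub>C x2" "c *\<^sub>C x3"])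
       (simp_all add: x Suc.IH scaleC_add_right mult_scaleC_left)
qed

lemma normal_add: "x \<in> normal N \<Longrightarrow> y \<in> normal N \<Longrightarrow> x + y \<in> normal N"
proof (induction N arbitrary: x y)
  case 0
  then show ?case by (auto simp flip: scaleC_add_left)
next
  case (Suc N)
  from Suc.prems(1) obtain x0 x1 x2 x3 where
    x: "x = x0 + x1 * a N + x2 * star (a N) + x3 * num N"
      "x0 \<in> normal N" "x1 \<in> normal N" "x2 \<in> normal N" "x3 \<in> normal N" by auto
  from Suc.prems(2) obtain y0 y1 y2 y3 where
    y: "y = y0 + y1 * a N + y2 * star (a N) + y3 * num N"
      "y0 \<in> normal N" "y1 \<in> normal N" "y2 \<in> normal N" "y3 \<in> normal N" by auto
  show ?case
    by (rule normal_SucI[of _ "x0 + y0" "x1 + y1" _ "x2 + y2" "x3 + y3"])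
       (simp_all add: x y Suc.IH distrib_right)
qed

lemma normal_zero: "0 \<in> normal N"
proof (induction N)
  case 0
  show ?case by (auto intro: image_eqI[of _ _ 0])
next
  case (Suc N)
  then show ?case by (intro normal_SucI[of _ 0 0 _ 0 0]) simp_all
qed

lemma normal_uminus: "x \<in> normal N \<Longrightarrow> - x \<in> normal N"
  using normal_scaleC[of x N "- 1"] by (simp add: scaleC_minus_one)

lemma normal_Suc: "x \<in> normal N \<Longrightarrow> x \<in> normal (Suc N)"
  by (rule normal_SucI[of _ x 0 _ 0 0]) (simp_all add: normal_zero)

lemma normal_one: "1 \<in> normal N"
proof (induction N)
  case 0
  show ?case by (auto intro: image_eqI[of _ _ 1])
qed (rule normal_Suc)

text \<open>A letter of the last mode is absorbed by the multiplication table of that mode. A letter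
  of an earlier mode moves left past the factor of mode \<open>N\<close>, with a sign for
  \<open>a N\<close> and \<open>star (a N)\<close> and none for \<open>num N\<close>, and meets the
  coefficients, where the induction hypothesis applies.\<close>

lemma normal_mult_letter:
  assumes "x \<in> normal N" "j < N" "y \<in> letters j"
  shows "x * y \<in> normal N"
  using assms
proof (induction N arbitrary: x)
  case (Suc N)
  from Suc.prems(1) obtain x0 x1 x2 x3 where
    x: "x = x0 + x1 * a N + x2 * star (a N) + x3 * num N"
      "x0 \<in> normal N" "x1 \<in> normal N" "x2 \<in> normal N" "x3 \<in> normal N" by auto
  show ?case
  proof (cases "j = N")
    case True
    with Suc.prems(3) consider "y = a N" | "y = star (a N)" by auto
    then show ?thesis
    proof cases
      case 1
      have "x * y = 0 + x0 * a N + 0 * star (a N) + x2 * num N"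
        by (simp add: x 1 distrib_right mult.assoc a_sq)
      then show ?thesis
        by (rule normal_SucI) (simp_all add: x normal_zero)
    next
      case 2
      have "x * y = x1 + 0 * a N + (x0 + x3) * star (a N) + (- x1) * num N"
        by (simp add: x 2 distrib_right mult.assoc star_a_sq a_star_a right_diff_distrib
            num_star_a[unfolded mult.assoc] star_a_num algebra_simps)
      then show ?thesis
        by (rule normal_SucI) (simp_all add: x normal_zero normal_add normal_uminus)
    qed
  next
    case False
    with Suc.prems have j: "j < N" by simp
    have comm: "a N * y = - (y * a N)" "star (a N) * y = - (y * star (a N))"
        "num N * y = y * num N"
      using False Suc.prems(3) letters_anticommute[of N j _ y] num_commute_letters[of N j y]
      by auto
    have "x * y = x0 * y + (- (x1 * y)) * a N + (- (x2 * y)) * star (a N) + (x3 * y) * num N"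
    proof -
      have "x1 * a N * y = - (x1 * y) * a N" "x2 * star (a N) * y = - (x2 * y) * star (a N)"
        by (simp_all add: mult.assoc comm(1,2))
      moreover have "x3 * num N * y = x3 * y * num N"
        by (metis comm(3) mult.assoc)
      ultimately show ?thesis
        by (simp add: x distrib_right)
    qed
    then show ?thesis
      by (rule normal_SucI) (auto intro!: normal_uminus Suc.IH[OF _ j Suc.prems(3)] x)
  qed
qed simp

text \<open>The forward inclusion is proved in the stronger form that right multiplication by an
  element of \<open>modes {..<N}\<close> preserves \<open>normal N\<close>. This form survives the
  product rule, and multiplying 1 gives the claim.\<close>

lemma modes_lessThan: "modes {..<N} = normal N"
proof
  have "\<forall>x\<in>normal N. x * y \<in> normal N" if "y \<in> modes {..<N}" for y
    using that
  proof induction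
    case (modes_letter j y)
    then show ?case by (auto intro: normal_mult_letter)
  next
    case (modes_mult y z)
    then show ?case by (simp flip: mult.assoc)
  qed (auto simp: distrib_left mult_scaleC_right normal_add normal_scaleC)
  from this[THEN bspec, OF _ normal_one] show "modes {..<N} \<subseteq> normal N" by auto
next
  show "normal N \<subseteq> modes {..<N}"
  proof (induction N)
    case 0
    show ?case by (auto intro: modes.intros)
  next
    case (Suc N)
    have "modes {..<N} \<subseteq> modes {..<Suc N}"
      by (rule modes_mono) auto
    with Suc.IH have N: "normal N \<subseteq> modes {..<Suc N}" by blast
    have l: "x \<in> modes {..<Suc N}" if "x \<in> letters N" for x
      using that by (intro modes_letter[of N]) auto
    show ?case
    proof
      fix x assume "x \<in> normal (Suc N)"
      then obtain x0 x1 x2 x3 where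
        x: "x = x0 + x1 * a N + x2 * star (a N) + x3 * num N"
          "x0 \<in> normal N" "x1 \<in> normal N" "x2 \<in> normal N" "x3 \<in> normal N" by auto
      show "x \<in> modes {..<Suc N}"
        unfolding x(1) by (intro modes_add modes_mult) (use x N l in auto)
    qed
  qed
qed

section \<open>The dense algebra of polynomials in finitely many modes\<close>

lemma finite_subset_lessThan:
  assumes "finite (S::nat set)"
  obtains N where "S \<subseteq> {..<N}"
  using finite_nat_set_iff_bounded[of S] assms by auto

definition local_algebra :: "'a set" where
  "local_algebra = (\<Union>N. modes {..<N})"

lemma local_algebra_common:
  assumes "x \<in> local_algebra" "y \<in> local_algebra"
  obtains N where "x \<in> modes {..<N}" "y \<in> modes {..<N}"
proof -
  from assms obtain M N where "x \<in> modes {..<M}" "y \<in> modes {..<N}"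
    by (auto simp: local_algebra_def)
  moreover have "modes {..<M} \<subseteq> modes {..<max M N}" "modes {..<N} \<subseteq> modes {..<max M N}"
    by (auto intro!: modes_mono)
  ultimately show ?thesis using that by blast
qed

lemma
  shows local_algebra_one: "1 \<in> local_algebra"
    and local_algebra_add: "x \<in> local_algebra \<Longrightarrow> y \<in> local_algebra \<Longrightarrow> x + y \<in> local_algebra"
    and local_algebra_mult: "x \<in> local_algebra \<Longrightarrow> y \<in> local_algebra \<Longrightarrow> x * y \<in> local_algebra"
    and local_algebra_scaleC: "x \<in> local_algebra \<Longrightarrow> c *\<^sub>C x \<in> local_algebra"
    and local_algebra_star: "x \<in> local_algebra \<Longrightarrow> star x \<in> local_algebra"
    and local_algebra_generator: "a j \<in> local_algebra"
proof -
  have "a j \<in> modes {..<Suc j}"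
    by (rule modes_letter[of j]) auto
  then show "a j \<in> local_algebra"
    unfolding local_algebra_def by blast
  show "x + y \<in> local_algebra" if xy: "x \<in> local_algebra" "y \<in> local_algebra"
  proof -
    obtain N where "x \<in> modes {..<N}" "y \<in> modes {..<N}"
      using local_algebra_common[OF xy] .
    then have "x + y \<in> modes {..<N}" by (rule modes_add)
    then show ?thesis by (auto simp: local_algebra_def)
  qed
  show "x * y \<in> local_algebra" if xy: "x \<in> local_algebra" "y \<in> local_algebra"
  proof -
    obtain N where "x \<in> modes {..<N}" "y \<in> modes {..<N}"
      using local_algebra_common[OF xy] .
    then have "x * y \<in> modes {..<N}" by (rule modes_mult)
    then show ?thesis by (auto simp: local_algebra_def)
  qed
qed (auto simp: local_algebra_def intro: modes_one modes_scaleC modes_star)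

lemma local_algebra_dense: "closure local_algebra = UNIV"
proof -
  have "cstar_subalgebra (closure local_algebra)"
    unfolding cstar_subalgebra_def
  proof (intro conjI ballI allI)
    show "1 \<in> closure local_algebra"
      using local_algebra_one closure_subset by blast
    fix x assume x: "x \<in> closure local_algebra"
    then obtain f where f: "\<And>n. f n \<in> local_algebra" "f \<longlonglongrightarrow> x"
      unfolding closure_sequential by blast
    show "c *\<^sub>C x \<in> closure local_algebra" for c
      unfolding closure_sequential
      by (intro exI[of _ "\<lambda>n. c *\<^sub>C f n"] conjI allI local_algebra_scaleC f
          bounded_linear.tendsto[OF bounded_linear_scaleC])
    show "star x \<in> closure local_algebra"
      unfolding closure_sequential
      by (intro exI[of _ "\<lambda>n. star (f n)"] conjI allI local_algebra_star f
          bounded_linear.tendsto[OF bounded_linear_star])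
    fix y assume y: "y \<in> closure local_algebra"
    then obtain g where g: "\<And>n. g n \<in> local_algebra" "g \<longlonglongrightarrow> y"
      unfolding closure_sequential by blast
    show "x + y \<in> closure local_algebra"
      unfolding closure_sequential
      by (intro exI[of _ "\<lambda>n. f n + g n"] conjI allI local_algebra_add f g tendsto_add)
    show "x * y \<in> closure local_algebra"
      unfolding closure_sequential
      by (intro exI[of _ "\<lambda>n. f n * g n"] conjI allI local_algebra_mult f g tendsto_mult)
  qed simp
  moreover have "range a \<subseteq> closure local_algebra"
    using local_algebra_generator closure_subset by blast
  ultimately have "cstar_subalgebra hull range a \<subseteq> closure local_algebra"
    by (intro hull_minimal)
  then show ?thesis using generated by auto
qed

subsection \<open>Functionals determined by moments\<close>

definition diag :: "nat list \<Rightarrow> 'a" where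
  "diag js = prod_list (map num js)"

lemma diag_Nil [simp]: "diag [] = 1"
  and diag_Cons: "diag (j # js) = num j * diag js"
  and diag_append: "diag (js @ ks) = diag js * diag ks"
  by (simp_all add: diag_def)

lemma diag_modes: "set js \<subseteq> S \<Longrightarrow> diag js \<in> modes S"
  by (induction js) (auto simp: diag_Cons intro: modes_one modes_mult modes_num)

text \<open>The algebraic data common to symmetric states, product states and barycentres. They are
  easy to transport along relabellings and integrals, yet fix every value on the local
  algebra.\<close>

definition has_moments :: "(nat \<Rightarrow> complex) \<Rightarrow> ('a \<Rightarrow> complex) \<Rightarrow> bool" where
  "has_moments m \<phi> \<longleftrightarrow>
     (\<forall>x y. \<phi> (x + y) = \<phi> x + \<phi> y) \<and> (\<forall>c x. \<phi> (c *\<^sub>C x) = c * \<phi> x) \<and>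
     (\<forall>S j x y z. finite S \<and> j \<notin> S \<and> x \<in> letters j \<and> y \<in> modes S \<and> z \<in> modes S \<longrightarrow>
        \<phi> (y * x * z) = 0) \<and>
     (\<forall>js. distinct js \<longrightarrow> \<phi> (diag js) = m (length js))"

text \<open>Expanding in the last mode \<open>N\<close> leaves four terms: the two with an unpaired
  letter vanish, and the \<open>num N\<close> of the last one moves into the list, which is why
  \<open>js\<close> ranges over lists of modes outside \<open>{..<N}\<close>. The coefficients are
  chosen before \<open>m\<close> and \<phi>, so one formula serves all functionals; both uniqueness
  and continuity in the density rest on this.\<close>

lemma has_moments_normal:
  assumes "x \<in> normal N" "distinct js" "set js \<inter> {..<N} = {}"
  shows "\<exists>c. \<forall>m \<phi>. has_moments m \<phi> \<longrightarrow> \<phi> (x * diag js) = (\<Sum>k\<le>N + length js. c k * m k)"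
  using assms
proof (induction N arbitrary: x js)
  case 0
  then obtain d where d: "x = d *\<^sub>C 1" by auto
  have "\<phi> (x * diag js) = (\<Sum>k\<le>0 + length js. (if k = length js then d else 0) * m k)"
    if "has_moments m \<phi>" for m \<phi>
  proof -
    have "\<phi> (x * diag js) = d * m (length js)"
      using that 0(2) unfolding has_moments_def by (metis d mult_1 mult_scaleC_left)
    then show ?thesis
      by (simp add: if_distrib[of "\<lambda>t. t * _"] cong: if_cong)
  qed
  then show ?case
    by (intro exI[of _ "\<lambda>k. if k = length js then d else 0"]) metis
next
  case (Suc N)
  from Suc.prems(1) obtain x0 x1 x2 x3 where
    x: "x = x0 + x1 * a N + x2 * star (a N) + x3 * num N"
      "x0 \<in> normal N" "x1 \<in> normal N" "x2 \<in> normal N" "x3 \<in> normal N" by auto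
  obtain c where c: "\<And>m \<phi>. has_moments m \<phi> \<Longrightarrow>
      \<phi> (x0 * diag js) = (\<Sum>k\<le>N + length js. c k * m k)"
    using Suc.IH[of x0 js] Suc.prems x by fastforce
  obtain d where d: "\<And>m \<phi>. has_moments m \<phi> \<Longrightarrow>
      \<phi> (x3 * diag (N # js)) = (\<Sum>k\<le>N + length (N # js). d k * m k)"
    using Suc.IH[of x3 "N # js"] Suc.prems x by fastforce
  \<comment> \<open>The two sums have different lengths. \<open>c\<close> is cut off because its
    values beyond \<open>N + length js\<close> are arbitrary.\<close>
  have step: "\<phi> (x * diag js) = (\<Sum>k\<le>Suc N + length js. ((if k \<le> N + length js then c k else 0) + d k) * m k)"
    if \<phi>: "has_moments m \<phi>" for m \<phi>
  proof -
    define S where "S = {..<N} \<union> set js"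
    have S: "finite S" "N \<notin> S"
      using Suc.prems by (auto simp: S_def)
    have "x1 \<in> modes S" "x2 \<in> modes S"
      using x modes_mono[of "{..<N}" S] unfolding modes_lessThan[symmetric] by (auto simp: S_def)
    moreover have "diag js \<in> modes S"
      by (rule diag_modes) (auto simp: S_def)
    ultimately have "\<phi> (x1 * a N * diag js) = 0" "\<phi> (x2 * star (a N) * diag js) = 0"
      using \<phi> S unfolding has_moments_def by (meson insertI1 insertI2)+
    moreover have "\<phi> (y + z) = \<phi> y + \<phi> z" for y z
      using \<phi> by (simp add: has_moments_def)
    ultimately have "\<phi> (x * diag js) = \<phi> (x0 * diag js) + \<phi> (x3 * diag (N # js))"
      by (simp add: x distrib_right diag_Cons mult.assoc)
    also have "\<dots> = (\<Sum>k\<le>Suc N + length js. (if k \<le> N + length js then c k else 0) * m k)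
        + (\<Sum>k\<le>Suc N + length js. d k * m k)"
      using c[OF \<phi>] d[OF \<phi>] by simp
    finally show ?thesis
      by (simp only: distrib_right sum.distrib)
  qed
  show ?case
  proof (intro exI allI impI)
    fix m \<phi> assume \<phi>: "has_moments m \<phi>"
    from step[OF \<phi>] show "\<phi> (x * diag js) =
        (\<Sum>k\<le>Suc N + length js. ((if k \<le> N + length js then c k else 0) + d k) * m k)" .
  qed
qed

lemma has_moments_local:
  assumes "x \<in> local_algebra"
  shows "\<exists>c K. \<forall>m \<phi>. has_moments m \<phi> \<longrightarrow> \<phi> x = (\<Sum>k\<le>K. c k * m k)"
proof -
  from assms obtain N where "x \<in> normal N"
    by (auto simp: local_algebra_def modes_lessThan)
  from has_moments_normal[OF this, of "[]"] show ?thesis by auto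
qed

lemma dual_bounded_linear:
  assumes "\<phi> \<in> cstar_dual"
  shows "bounded_linear (\<phi> :: 'a \<Rightarrow> complex)"
proof -
  from assms obtain K where K: "\<And>x. cmod (\<phi> x) \<le> K * norm x"
    by (auto simp: cstar_dual_def)
  show ?thesis
  proof (rule bounded_linear_intro[of _ K])
    show "\<phi> (r *\<^sub>R x) = r *\<^sub>R \<phi> x" for r x
      using assms scaleC_of_real[of r x, symmetric] by (simp add: cstar_dual_def scaleR_conv_of_real)
  qed (use assms K in \<open>simp_all add: cstar_dual_def mult.commute\<close>)
qed

lemma functional_eq_if_eq_local:
  assumes "\<phi> \<in> cstar_dual" "\<psi> \<in> cstar_dual" "\<And>x. x \<in> local_algebra \<Longrightarrow> \<phi> x = \<psi> x"
  shows "(\<phi> :: 'a \<Rightarrow> complex) = \<psi>"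
proof
  fix x
  have "closed {x. \<phi> x = \<psi> x}"
    using assms(1,2)[THEN dual_bounded_linear] by (intro closed_Collect_eq linear_continuous_on)
  then have "closure local_algebra \<subseteq> {x. \<phi> x = \<psi> x}"
    using assms(3) by (intro closure_minimal) auto
  then show "\<phi> x = \<psi> x" by (auto simp: local_algebra_dense)
qed

lemma functional_eq_if_same_moments:
  assumes "\<phi> \<in> cstar_dual" "\<psi> \<in> cstar_dual" "has_moments m \<phi>" "has_moments m \<psi>"
  shows "\<phi> = \<psi>"
proof (rule functional_eq_if_eq_local[OF assms(1,2)])
  fix x assume "x \<in> local_algebra"
  from has_moments_local[OF this] obtain c K where
    cK: "\<And>m \<phi>. has_moments m \<phi> \<Longrightarrow> \<phi> x = (\<Sum>k\<le>K. c k * m k)" by blast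
  show "\<phi> x = \<psi> x"
    using cK[OF assms(3)] cK[OF assms(4)] by simp
qed

end

lemma commute_prod_list:
  fixes y :: "'b::monoid_mult"
  shows "(\<And>x. x \<in> set xs \<Longrightarrow> y * x = x * y) \<Longrightarrow> y * prod_list xs = prod_list xs * y"
proof (induction xs)
  case (Cons x xs)
  have "y * (x * prod_list xs) = x * (y * prod_list xs)"
    using Cons.prems[of x] by (simp flip: mult.assoc)
  with Cons show ?case by (simp add: mult.assoc)
qed simp

context car_algebra
begin

subsection \<open>Symmetric states\<close>

lemma automorphism_letters:
  assumes "cstar_automorphism \<alpha>" "\<alpha> (a j) = a (g j)" "x \<in> letters j"
  shows "\<alpha> x \<in> letters (g j)"
  using assms by (auto simp: cstar_automorphism_def)

lemma automorphism_modes: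
  assumes "cstar_automorphism \<alpha>" "\<And>j. \<alpha> (a j) = a (g j)" "x \<in> modes S"
  shows "\<alpha> x \<in> modes (g ` S)"
  using assms(3)
proof induction
  case (modes_letter j x)
  then show ?case
    using automorphism_letters[of \<alpha> j g x] assms(1,2) by (intro modes.modes_letter[of "g j"]) auto
qed (use assms(1) in \<open>auto simp: cstar_automorphism_def intro: modes.intros\<close>)

lemma automorphism_fixes_modes:
  assumes "cstar_automorphism \<alpha>" "\<And>j. j \<in> S \<Longrightarrow> \<alpha> (a j) = a j" "x \<in> modes S"
  shows "\<alpha> x = x"
  using assms(3)
proof induction
  case (modes_letter j x)
  then show ?case using assms(1,2) by (auto simp: cstar_automorphism_def)
qed (use assms(1) in \<open>auto simp: cstar_automorphism_def\<close>)

lemma automorphism_diag: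
  assumes "cstar_automorphism \<alpha>" "\<And>j. \<alpha> (a j) = a (g j)"
  shows "\<alpha> (diag js) = diag (map g js)"
  using assms by (induction js) (auto simp: diag_Cons cstar_automorphism_def)

section \<open>Consequences of invariance under transpositions\<close>

lemma transpose_finitary: "Transposition.transpose j k \<in> finitary_perms"
proof -
  have "{i. Transposition.transpose j k i \<noteq> i} \<subseteq> {j, k}"
    by (auto simp: Transposition.transpose_def split: if_splits)
  then show ?thesis
    by (auto simp: finitary_perms_def intro: finite_subset)
qed

text \<open>The sum \<open>b\<close> behaves like \<open>sqrt (card T)\<close> times one
  annihilator: \<open>b * b = 0\<close> and \<open>star b * b + b * star b = card T\<close>. Hence
  the square of \<open>star b * b\<close> is \<open>card T\<close> times \<open>star b * b\<close>,
  and the C*-identity bounds its norm. The triangle inequality would give only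
  \<open>card T\<close>, too weak for averages to tend to 0.\<close>

lemma norm_sum_annihilators:
  assumes "finite T"
  shows "norm (\<Sum>k\<in>T. a k) \<le> sqrt (card T)"
proof -
  define b where "b = (\<Sum>k\<in>T. a k)"
  have sb: "star b = (\<Sum>k\<in>T. star (a k))"
    unfolding b_def using linear_sum[OF bounded_linear.linear[OF bounded_linear_star]] by blast
  have "b * b + b * b = (\<Sum>j\<in>T. \<Sum>k\<in>T. a j * a k) + (\<Sum>j\<in>T. \<Sum>k\<in>T. a k * a j)"
    unfolding b_def sum_product by (subst (3) sum.swap) simp
  also have "\<dots> = 0"
    by (simp add: annihilation_annihilation flip: sum.distrib)
  finally have "2 *\<^sub>R (b * b) = 0" by (simp add: scaleR_2)
  then have bb: "b * b = 0" by simp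
  have "star b * b + b * star b
      = (\<Sum>j\<in>T. \<Sum>k\<in>T. star (a j) * a k) + (\<Sum>j\<in>T. \<Sum>k\<in>T. a k * star (a j))"
    unfolding sb unfolding b_def sum_product by (subst (3) sum.swap) simp
  also have "\<dots> = (\<Sum>j\<in>T. 1)"
    using assms by (simp add: creation_annihilation sum.delta flip: sum.distrib)
  finally have car: "star b * b + b * star b = of_nat (card T)" by simp
  have "(star b * b) * (star b * b) = star b * (b * star b + star b * b) * b"
    by (simp add: distrib_left distrib_right mult.assoc bb)
  also have "\<dots> = of_nat (card T) * (star b * b)"
    using car by (metis add.commute mult.assoc mult_of_nat_commute)
  finally have sq: "star (star b * b) * (star b * b) = of_nat (card T) * (star b * b)"
    by (simp add: star_mult star_star)
  have "of_nat (card T) * (star b * b) = real (card T) *\<^sub>R (star b * b)"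
    by (simp add: scaleR_conv_of_real)
  then have "(norm (star b * b))\<^sup>2 = card T * norm (star b * b)"
    using cstar_identity[of "star b * b"] sq by simp
  then have "norm (star b * b) \<le> card T"
    by (cases "norm (star b * b) = 0") (simp_all add: power2_eq_square)
  then have "(norm b)\<^sup>2 \<le> card T" by (simp add: cstar_identity)
  then show ?thesis unfolding b_def by (rule real_le_rsqrt)
qed

text \<open>Symmetry lets the odd letter be averaged over \<open>L\<close> fresh modes; the averaged operator has
  norm at most \<open>1 / sqrt L\<close>.\<close>

lemma symmetric_state_odd_letter:
  assumes \<phi>: "\<phi> \<in> symmetric_states a" and S: "finite S" "j \<notin> S" and x: "x \<in> letters j"
    and yz: "y \<in> modes S" "z \<in> modes S"
  shows "\<phi> (y * x * z) = 0"
proof -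
  have dual: "\<phi> \<in> cstar_dual"
    using \<phi> by (simp add: symmetric_states_def states_def)
  interpret \<phi>: bounded_linear \<phi> by (rule dual_bounded_linear[OF dual])
  obtain B where B: "B > 0" "\<And>x. cmod (\<phi> x) \<le> norm x * B"
    using \<phi>.pos_bounded by blast
  define e where "e k = (if x = a j then a k else star (a k))" for k
  have e: "e j = x" using x by (auto simp: e_def)
  have norm_e: "norm (\<Sum>k\<in>T. e k) \<le> sqrt (card T)" if "finite T" for T
  proof (cases "x = a j")
    case False
    then have "(\<Sum>k\<in>T. e k) = star (\<Sum>k\<in>T. a k)"
      using linear_sum[OF bounded_linear.linear[OF bounded_linear_star], of a T]
      by (simp add: e_def)
    then show ?thesis using norm_sum_annihilators[OF that] by simp
  qed (simp add: e_def norm_sum_annihilators that)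
  obtain K where K: "S \<union> {j} \<subseteq> {..<K}"
    using finite_subset_lessThan[of "S \<union> {j}"] S by auto
  \<comment> \<open>Modes from \<open>K\<close> on occur neither in \<open>y\<close> nor in
    \<open>z\<close>, so exchanging \<open>j\<close> with such a \<open>k\<close> changes the middle
    letter alone.\<close>
  have move: "\<phi> (y * e k * z) = \<phi> (y * x * z)" if "k \<ge> K" for k
  proof -
    define g where "g = Transposition.transpose j k"
    have g: "g \<in> finitary_perms" unfolding g_def by (rule transpose_finitary)
    note \<alpha> = car_action_automorphism[OF g] car_action_generator[OF g]
    have "g i = i" if "i \<in> S" for i
      using that K \<open>k \<ge> K\<close> S(2) by (auto simp: g_def Transposition.transpose_def)
    then have "car_action a g (a i) = a i" if "i \<in> S" for i
      using that by (simp add: \<alpha>(2))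
    then have "car_action a g w = w" if "w \<in> modes S" for w
      using automorphism_fixes_modes[OF \<alpha>(1) _ that] by blast
    moreover have "car_action a g x = e k"
    proof -
      have "star (car_action a g (a j)) = car_action a g (star (a j))"
        using \<alpha>(1) by (simp add: cstar_automorphism_def)
      then show ?thesis
        using x \<alpha>(2)[of j] by (auto simp: e_def g_def)
    qed
    ultimately have "car_action a g (y * x * z) = y * e k * z"
      using \<alpha>(1) yz by (simp add: cstar_automorphism_def)
    moreover have "\<phi> \<circ> car_action a g = \<phi>"
      using \<phi> g by (simp add: symmetric_states_def)
    ultimately show ?thesis by (metis comp_apply)
  qed
  define c where "c = cmod (\<phi> (y * x * z))"
  define D where "D = norm y * norm z * B"
  have bound: "sqrt L * c \<le> D" if "L > 0" for L :: nat
  proof -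
    have "of_nat L * \<phi> (y * x * z) = (\<Sum>k\<in>{K..<K + L}. \<phi> (y * e k * z))"
      by (simp add: move)
    also have "\<dots> = \<phi> (y * (\<Sum>k\<in>{K..<K + L}. e k) * z)"
      by (simp add: \<phi>.sum sum_distrib_left sum_distrib_right)
    finally have "L * c = cmod (\<phi> (y * (\<Sum>k\<in>{K..<K + L}. e k) * z))"
      by (metis c_def norm_mult norm_of_nat)
    also have "\<dots> \<le> norm (y * (\<Sum>k\<in>{K..<K + L}. e k) * z) * B"
      by (rule B)
    also have "\<dots> \<le> (norm y * sqrt L * norm z) * B"
      using norm_e[of "{K..<K + L}"] B(1)
      by (intro mult_right_mono order_trans[OF norm_mult_ineq] order_trans[OF norm_mult_ineq] mult_left_mono) simp_all
    finally have "L * c \<le> sqrt L * D"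
      by (simp add: D_def mult_ac)
    moreover have "sqrt L * (sqrt L * c) = L * c"
      by (simp flip: mult.assoc)
    ultimately have "sqrt L * (sqrt L * c) \<le> sqrt L * D" by linarith
    then show ?thesis using that by simp
  qed
  have "c = 0"
  proof (rule ccontr)
    assume "c \<noteq> 0"
    then have c: "c > 0" by (simp add: c_def)
    obtain L :: nat where L: "real L > (D / c)\<^sup>2"
      using reals_Archimedean2 by blast
    then have "sqrt L > D / c" by (rule real_less_rsqrt)
    then have "sqrt L * c > D" using c by (simp add: field_simps)
    moreover have "L > 0" using L by (cases L) auto
    ultimately show False using bound[of L] by simp
  qed
  then show ?thesis by (simp add: c_def)
qed

lemma diag_commute: "diag js * diag ks = diag ks * diag js"
proof -
  have num: "num j * num k = num k * num j" for j k
  proof (cases "j = k")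
    case False
    then show ?thesis by (intro num_commute_modes[of j "{k}"] modes_num) auto
  qed simp
  have "num j * diag ks = diag ks * num j" for j
    unfolding diag_def by (rule commute_prod_list) (use num in auto)
  then show ?thesis
    unfolding diag_def[of js] by (intro commute_prod_list[symmetric]) auto
qed

text \<open>A transposition replaces one entry, but only by an index absent from the rest of the
  list. Lists that may overlap are therefore compared through a third one, disjoint from
  both.\<close>

lemma symmetric_state_diag:
  assumes \<phi>: "\<phi> \<in> symmetric_states a" and js: "distinct js"
  shows "\<phi> (diag js) = \<phi> (diag [0..<length js])"
proof -
  have swap: "\<phi> (diag (i # ys)) = \<phi> (diag (k # ys))" if "i \<notin> set ys" "k \<notin> set ys" for i k ys
  proof -
    define g where "g = Transposition.transpose i k"
    have g: "g \<in> finitary_perms" unfolding g_def by (rule transpose_finitary)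
    have "map g ys = ys"
      using that by (intro map_idI) (auto simp: g_def Transposition.transpose_def)
    then have "car_action a g (diag (i # ys)) = diag (k # ys)"
      using automorphism_diag[OF car_action_automorphism[OF g] car_action_generator[OF g], of "i # ys"]
      by (simp add: g_def)
    moreover have "\<phi> \<circ> car_action a g = \<phi>"
      using \<phi> g by (simp add: symmetric_states_def)
    ultimately show ?thesis by (metis comp_apply)
  qed
  have disjoint: "\<phi> (diag (js @ ys)) = \<phi> (diag (ks @ ys))"
    if "length js = length ks" "distinct (js @ ks @ ys)" for js ks ys
    using that
  proof (induction js ks arbitrary: ys rule: list_induct2)
    case (Cons j js k ks)
    have "\<phi> (diag (j # js @ ys)) = \<phi> (diag (k # js @ ys))"
      using Cons.prems by (intro swap) auto
    also have "diag (k # js @ ys) = diag (js @ k # ys)"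
      using diag_commute[of "[k]" js] by (simp add: diag_append diag_Cons flip: mult.assoc)
    also have "\<phi> \<dots> = \<phi> (diag (ks @ k # ys))"
      using Cons.prems by (intro Cons.IH) auto
    also have "diag (ks @ k # ys) = diag (k # ks @ ys)"
      using diag_commute[of "[k]" ks] by (simp add: diag_append diag_Cons flip: mult.assoc)
    finally show ?case by simp
  qed simp
  obtain K where K: "set js \<union> {0..<length js} \<subseteq> {..<K}"
    using finite_subset_lessThan[of "set js \<union> {0..<length js}"] by auto
  let ?ks = "[K..<K + length js]"
  have "\<phi> (diag js) = \<phi> (diag ?ks)"
    using disjoint[of js ?ks "[]"] js K by fastforce
  also have "\<dots> = \<phi> (diag [0..<length js])"
    using disjoint[of "[0..<length js]" ?ks "[]"] K by fastforce
  finally show ?thesis .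
qed

lemma symmetric_state_has_moments:
  assumes "\<phi> \<in> symmetric_states a"
  shows "has_moments (\<lambda>k. \<phi> (diag [0..<k])) \<phi>"
  unfolding has_moments_def
proof (intro conjI allI impI)
  show "\<phi> (y * x * z) = 0"
    if "finite S \<and> j \<notin> S \<and> x \<in> letters j \<and> y \<in> modes S \<and> z \<in> modes S" for S j x y z
    using symmetric_state_odd_letter[OF assms] that by blast
  show "\<phi> (diag js) = \<phi> (diag [0..<length js])" if "distinct js" for js
    by (rule symmetric_state_diag[OF assms that])
qed (use assms in \<open>auto simp: symmetric_states_def states_def cstar_dual_def\<close>)


subsection \<open>Configurations\<close>

definition site :: "nat set \<Rightarrow> nat \<Rightarrow> 'a" where
  "site s j = (if j \<in> s then num j else 1 - num j)"

text \<open>The joint spectral projection of the first \<open>N\<close> occupation numbers for the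
  pattern \<open>s \<inter> {..<N}\<close>, written directly as a product of commuting
  projections.\<close>

primrec config :: "nat set \<Rightarrow> nat \<Rightarrow> 'a" where
  "config s 0 = 1"
| "config s (Suc N) = config s N * site s N"

lemma site_idem: "site s j * site s j = site s j"
  by (simp add: site_def num_idem left_diff_distrib right_diff_distrib)

lemma star_site: "star (site s j) = site s j"
  by (simp add: site_def star_num star_diff)

lemma site_modes: "site s j \<in> modes {j}"
  by (auto simp: site_def intro: modes_num modes_diff modes_one)

lemma site_commute_modes: "j \<notin> S \<Longrightarrow> x \<in> modes S \<Longrightarrow> site s j * x = x * site s j"
  using num_commute_modes[of j S x] by (simp add: site_def algebra_simps)

lemma site_letter_site: "x \<in> letters j \<Longrightarrow> site s j * x * site s j = 0"
  by (auto simp: site_def left_diff_distrib right_diff_distrib num_a a_num star_a_num num_star_a)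

lemma site_num: "site s j * num j = (if j \<in> s then site s j else 0)"
  by (simp add: site_def num_idem left_diff_distrib)

lemma config_modes: "config s N \<in> modes {..<N}"
proof (induction N)
  case (Suc N)
  have "config s N \<in> modes {..<Suc N}" "site s N \<in> modes {..<Suc N}"
    using Suc.IH site_modes[of s N] modes_mono[of "{..<N}" "{..<Suc N}"]
      modes_mono[of "{N}" "{..<Suc N}"] by auto
  then show ?case by (auto intro: modes_mult)
qed (simp add: modes_one)

lemma config_site: "config s N * site s N = site s N * config s N"
  using site_commute_modes[OF _ config_modes, of N N s s] by simp

lemma config_idem: "config s N * config s N = config s N"
proof (induction N)
  case (Suc N)
  have "config s (Suc N) * config s (Suc N) = config s N * (site s N * config s N) * site s N"
    by (simp add: mult.assoc)
  also have "\<dots> = (config s N * config s N) * (site s N * site s N)"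
    by (simp add: mult.assoc flip: config_site)
  finally show ?case by (simp add: Suc.IH site_idem)
qed simp

lemma star_config: "star (config s N) = config s N"
  by (induction N) (simp_all add: star_mult star_site config_site)

lemma config_absorb:
  assumes "j < N"
  shows "site s j * config s N = config s N" "config s N * site s j = config s N"
proof -
  show *: "site s j * config s N = config s N"
    using assms
  proof (induction N)
    case (Suc N)
    show ?case
    proof (cases "j = N")
      case True
      have "site s N * config s (Suc N) = (site s N * config s N) * site s N"
        by (simp add: mult.assoc)
      also have "\<dots> = config s N * (site s N * site s N)"
        unfolding config_site[symmetric] by (rule mult.assoc)
      finally show ?thesis by (simp add: True site_idem)
    next
      case False
      with Suc show ?thesis by (simp flip: mult.assoc)
    qed
  qed simp
  from arg_cong[OF this, of star] show "config s N * site s j = config s N"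
    by (simp add: star_mult star_site star_config)
qed

lemma config_restrict: "(\<And>j. j < N \<Longrightarrow> j \<in> s \<longleftrightarrow> j \<in> t) \<Longrightarrow> config s N = config t N"
  by (induction N) (auto simp: site_def)

text \<open>The particle-hole exchange of mode \<open>j\<close>: a self-adjoint unitary that
  conjugates \<open>num j\<close> into \<open>1 - num j\<close>.\<close>

definition flip :: "nat \<Rightarrow> 'a" where
  "flip j = a j + star (a j)"

lemma flip_modes: "flip j \<in> modes {j}"
  unfolding flip_def by (intro modes_add modes_letter[of j]) auto

lemma star_flip: "star (flip j) = flip j"
  by (simp add: flip_def star_add star_star add.commute)

lemma flip_flip: "flip j * flip j = 1"
  by (simp add: flip_def distrib_left distrib_right mode_simps)

lemma site_flip: "site s j + flip j * site s j * flip j = 1"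
proof -
  have "flip j * num j = a j"
    by (simp add: flip_def distrib_right a_num star_a_num)
  then have "flip j * num j * flip j = 1 - num j"
    by (simp add: flip_def distrib_left a_sq a_star_a)
  then show ?thesis
    by (simp add: site_def flip_flip left_diff_distrib right_diff_distrib)
qed

lemma config_commute_modes:
  assumes "y \<in> modes T" "T \<inter> {..<N} = {}"
  shows "y * config s N = config s N * y"
  using assms(2)
proof (induction N)
  case (Suc N)
  have "site s N * y = y * site s N"
    using Suc.prems by (intro site_commute_modes[OF _ assms(1)]) auto
  moreover have "y * config s N = config s N * y"
    using Suc.prems by (intro Suc.IH) auto
  ultimately show ?case by (metis config.simps(2) mult.assoc)
qed simp

text \<open>If the projection for \<open>N + 1\<close> modes were 0, its conjugate by
  \<open>flip N\<close>, which belongs to the opposite value of mode \<open>N\<close>, would be 0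
  too; but the two add up to the projection for \<open>N\<close> modes. This nonvanishing makes the
  scalar in \<open>occ\<close> unique.\<close>

lemma config_nonzero: "config s N \<noteq> 0"
proof (induction N)
  case (Suc N)
  show ?case
  proof
    assume 0: "config s (Suc N) = 0"
    have "config s N = config s N * (site s N + flip N * site s N * flip N)"
      by (simp add: site_flip)
    also have "\<dots> = config s N * site s N + flip N * (config s N * site s N) * flip N"
      using config_commute_modes[OF flip_modes[of N], of N s] by (simp add: distrib_left flip: mult.assoc)
    also have "\<dots> = 0" using 0 by simp
    finally show False using Suc.IH by simp
  qed
qed simp

lemma norm_config: "norm (config s N) = 1"
  by (intro norm_projection star_config config_idem config_nonzero)

text \<open>Minimality of the projection in the algebra of the first \<open>N\<close> modes. In the
  inductive step the compression factorises: \<open>?P\<close> acts on the coefficient,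
  \<open>?q\<close> on the factor of mode \<open>N\<close>. The latter factor is 1, a letter, which
  compresses to 0, or \<open>num N\<close>, which compresses to \<open>?q\<close> or 0.\<close>

lemma config_compress_normal:
  "x \<in> normal N \<Longrightarrow> \<exists>c. config s N * x * config s N = c *\<^sub>C config s N"
proof (induction N arbitrary: x)
  case 0
  then show ?case by auto
next
  case (Suc N)
  let ?P = "config s N" and ?q = "site s N"
  have summand: "\<exists>c. ?P * ?q * (y * b) * (?P * ?q) = c *\<^sub>C (?P * ?q)"
    if y: "y \<in> normal N" and b: "\<exists>d. ?q * b * ?q = d *\<^sub>C ?q" "b * ?P = ?P * b" for y b
  proof -
    have "y \<in> modes {..<N}" using y by (simp add: modes_lessThan)
    then have qy: "?q * y = y * ?q" by (intro site_commute_modes) auto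
    obtain c where c: "?P * y * ?P = c *\<^sub>C ?P" using Suc.IH[OF y] by blast
    obtain d where d: "?q * b * ?q = d *\<^sub>C ?q" using b(1) by blast
    have "?P * ?q * (y * b) * (?P * ?q) = ?P * (?q * y) * (b * ?P) * ?q"
      by (simp add: mult.assoc)
    also have "\<dots> = ?P * y * (?q * ?P) * b * ?q"
      by (simp add: qy b(2) mult.assoc)
    also have "\<dots> = (?P * y * ?P) * (?q * b * ?q)"
      by (simp add: mult.assoc flip: config_site)
    also have "\<dots> = (c * d) *\<^sub>C (?P * ?q)"
      by (simp add: c d mult_scaleC_left mult_scaleC_right scaleC_scaleC mult.commute[of d c])
    finally show ?thesis by blast
  qed
  have comm: "b * ?P = ?P * b" if "b \<in> modes {N}" for b
    using that by (rule config_commute_modes) auto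
  from Suc.prems obtain x0 x1 x2 x3 where
    x: "x = x0 + x1 * a N + x2 * star (a N) + x3 * num N"
      "x0 \<in> normal N" "x1 \<in> normal N" "x2 \<in> normal N" "x3 \<in> normal N" by auto
  have "\<exists>d. ?q * 1 * ?q = d *\<^sub>C ?q"
    by (intro exI[of _ 1]) (simp add: site_idem)
  from summand[OF x(2) this] obtain c0 where
    c0: "?P * ?q * x0 * (?P * ?q) = c0 *\<^sub>C (?P * ?q)" by auto
  have letter: "\<exists>d. ?q * b * ?q = d *\<^sub>C ?q" "b * ?P = ?P * b" if "b \<in> letters N" for b
    using site_letter_site[OF that, of s] that
    by (auto intro!: exI[of _ 0] comm modes_letter[of N])
  obtain c1 where c1: "?P * ?q * (x1 * a N) * (?P * ?q) = c1 *\<^sub>C (?P * ?q)"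
    using summand[OF x(3) letter, of "a N"] by auto
  obtain c2 where c2: "?P * ?q * (x2 * star (a N)) * (?P * ?q) = c2 *\<^sub>C (?P * ?q)"
    using summand[OF x(4) letter, of "star (a N)"] by auto
  have "\<exists>d. ?q * num N * ?q = d *\<^sub>C ?q"
    by (intro exI[of _ "if N \<in> s then 1 else 0"]) (simp add: site_num site_idem)
  from summand[OF x(5) this comm[OF modes_num]] obtain c3 where
    c3: "?P * ?q * (x3 * num N) * (?P * ?q) = c3 *\<^sub>C (?P * ?q)" by auto
  have "?P * ?q * x * (?P * ?q) = ?P * ?q * x0 * (?P * ?q) + ?P * ?q * (x1 * a N) * (?P * ?q)
      + ?P * ?q * (x2 * star (a N)) * (?P * ?q) + ?P * ?q * (x3 * num N) * (?P * ?q)"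
    unfolding x(1) by (simp only: distrib_left distrib_right)
  then have "?P * ?q * x * (?P * ?q) = (c0 + c1 + c2 + c3) *\<^sub>C (?P * ?q)"
    unfolding c0 c1 c2 c3 by (simp only: scaleC_add_left)
  then show ?case by (auto simp del: normal.simps)
qed

text \<open>The pure state with occupied modes \<open>s\<close>. The choice is unique only on \<open>modes {..<N}\<close>;
  elsewhere the value is junk.\<close>

definition occ :: "nat set \<Rightarrow> nat \<Rightarrow> 'a \<Rightarrow> complex" where
  "occ s N x = (THE c. config s N * x * config s N = c *\<^sub>C config s N)"

lemma occ_eqI: "config s N * x * config s N = c *\<^sub>C config s N \<Longrightarrow> occ s N x = c"
  unfolding occ_def by (rule the_equality) (metis scaleC_cancel_right config_nonzero)+

lemma occ_compress:
  assumes "x \<in> modes {..<N}"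
  shows "config s N * x * config s N = occ s N x *\<^sub>C config s N"
  using config_compress_normal[of x N s] occ_eqI[of s N x] assms by (auto simp: modes_lessThan)

lemma occ_add: "x \<in> modes {..<N} \<Longrightarrow> y \<in> modes {..<N} \<Longrightarrow> occ s N (x + y) = occ s N x + occ s N y"
  by (intro occ_eqI) (simp add: distrib_left distrib_right occ_compress scaleC_add_left)

lemma occ_scaleC: "x \<in> modes {..<N} \<Longrightarrow> occ s N (c *\<^sub>C x) = c * occ s N x"
  by (intro occ_eqI) (simp add: mult_scaleC_left mult_scaleC_right occ_compress scaleC_scaleC)

lemma norm_occ_le:
  assumes "x \<in> modes {..<N}"
  shows "cmod (occ s N x) \<le> norm x"
proof -
  have "cmod (occ s N x) = norm (config s N * x * config s N)"
    using assms by (simp add: occ_compress norm_scaleC norm_config)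
  also have "\<dots> \<le> norm (config s N) * norm x * norm (config s N)"
    by (intro order_trans[OF norm_mult_ineq] mult_right_mono norm_mult_ineq norm_ge_zero)
  finally show ?thesis by (simp add: norm_config)
qed

text \<open>Inserting this resolution of the identity between \<open>star x\<close> and \<open>x\<close> turns the compression of
  \<open>star x * x\<close> into a sum of squares, which avoids any spectral theory.\<close>

lemma config_resolution:
  "\<exists>us. set us \<subseteq> modes {..<N} \<and> (\<Sum>u\<leftarrow>us. u * config s N * star u) = 1"
proof (induction N)
  case 0
  show ?case by (intro exI[of _ "[1]"]) (simp add: modes_one)
next
  case (Suc N)
  then obtain us where us: "set us \<subseteq> modes {..<N}" "(\<Sum>u\<leftarrow>us. u * config s N * star u) = 1"
    by blast
  let ?f = "flip N" and ?q = "site s N"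
  have mono: "modes {..<N} \<subseteq> modes {..<Suc N}" "modes {N} \<subseteq> modes {..<Suc N}"
    by (auto intro!: modes_mono)
  have q: "u * config s (Suc N) * star u = u * config s N * star u * ?q" if "u \<in> set us" for u
  proof -
    have "?q * star u = star u * ?q"
      using us(1) that by (intro site_commute_modes[of N "{..<N}"] modes_star) auto
    then show ?thesis by (simp add: mult.assoc)
  qed
  \<comment> \<open>With mode \<open>N\<close> added, the old list resolves only the chosen value of
    that mode. The copies multiplied by \<open>flip N\<close> supply the other value, so the list
    doubles.\<close>
  have sum: "(\<Sum>u\<leftarrow>us. u * config s (Suc N) * star u) = ?q"
  proof -
    have "(\<Sum>u\<leftarrow>us. u * config s (Suc N) * star u) = (\<Sum>u\<leftarrow>us. u * config s N * star u * ?q)"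
      using q by (intro arg_cong[of _ _ sum_list] map_cong) auto
    also have "\<dots> = (\<Sum>u\<leftarrow>us. u * config s N * star u) * ?q"
      by (rule sum_list_mult_const)
    finally show ?thesis by (simp add: us(2))
  qed
  have "(\<Sum>u\<leftarrow>us. (?f * u) * config s (Suc N) * star (?f * u))
      = (\<Sum>u\<leftarrow>us. ?f * (u * config s (Suc N) * star u) * ?f)"
    by (simp add: star_mult star_flip mult.assoc)
  also have "\<dots> = ?f * (\<Sum>u\<leftarrow>us. u * config s (Suc N) * star u) * ?f"
    by (simp only: sum_list_const_mult sum_list_mult_const)
  finally have "(\<Sum>u\<leftarrow>us @ map ((*) ?f) us. u * config s (Suc N) * star u) = 1"
    using sum site_flip[of s N] by (simp add: comp_def del: config.simps)
  moreover have "set (us @ map ((*) ?f) us) \<subseteq> modes {..<Suc N}"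
    using us(1) mono flip_modes[of N] by (auto intro!: modes_mult)
  ultimately show ?case by blast
qed

lemma occ_positive:
  assumes "x \<in> modes {..<N}"
  shows "\<exists>r\<ge>0. occ s N (star x * x) = complex_of_real r"
proof -
  let ?P = "config s N"
  obtain us where us: "set us \<subseteq> modes {..<N}" "(\<Sum>u\<leftarrow>us. u * ?P * star u) = 1"
    using config_resolution by blast
  have summand: "?P * star x * (u * ?P * star u) * x * ?P
      = complex_of_real ((cmod (occ s N (star u * x)))\<^sup>2) *\<^sub>C ?P" if "u \<in> set us" for u
  proof -
    have "star u * x \<in> modes {..<N}"
      using that us(1) assms by (auto intro: modes_mult modes_star)
    then have c: "?P * (star u * x) * ?P = occ s N (star u * x) *\<^sub>C ?P"
      by (rule occ_compress)
    have "?P * star x * (u * ?P * star u) * x * ?P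
        = (?P * star x * u) * (?P * ?P) * (star u * x * ?P)"
      by (simp add: config_idem) (simp add: mult.assoc)
    also have "\<dots> = star (?P * (star u * x) * ?P) * (?P * (star u * x) * ?P)"
      by (simp add: star_mult star_star star_config mult.assoc)
    also have "\<dots> = (cnj (occ s N (star u * x)) * occ s N (star u * x)) *\<^sub>C ?P"
      by (simp add: c star_scaleC star_config mult_scaleC_left mult_scaleC_right scaleC_scaleC
          config_idem mult.commute[of _ "cnj _"])
    finally show ?thesis
      by (simp add: complex_norm_square mult.commute del: of_real_power)
  qed
  have "?P * (star x * x) * ?P = ?P * star x * (\<Sum>u\<leftarrow>us. u * ?P * star u) * x * ?P"
    unfolding us(2) by (simp add: mult.assoc)
  also have "\<dots> = (\<Sum>u\<leftarrow>us. ?P * star x * (u * ?P * star u) * x * ?P)"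
    by (simp only: sum_list_const_mult sum_list_mult_const)
  also have "\<dots> = (\<Sum>u\<leftarrow>us. complex_of_real ((cmod (occ s N (star u * x)))\<^sup>2) *\<^sub>C ?P)"
    using summand by (intro arg_cong[of _ _ sum_list] map_cong) auto
  also have "\<dots> = complex_of_real (\<Sum>u\<leftarrow>us. (cmod (occ s N (star u * x)))\<^sup>2) *\<^sub>C ?P"
    by (induction us) (simp_all add: scaleC_add_left)
  finally have "occ s N (star x * x) = complex_of_real (\<Sum>u\<leftarrow>us. (cmod (occ s N (star u * x)))\<^sup>2)"
    by (rule occ_eqI)
  moreover have "0 \<le> (\<Sum>u\<leftarrow>us. (cmod (occ s N (star u * x)))\<^sup>2)"
    by (rule sum_list_nonneg) auto
  ultimately show ?thesis by blast
qed

text \<open>\<open>config s N\<close> absorbs \<open>site s j\<close> on both sides, this factor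
  commutes with \<open>y\<close> and \<open>z\<close>, and it compresses a single letter of mode
  \<open>j\<close> to 0.\<close>

lemma occ_odd_letter:
  assumes "j < N" "j \<notin> S" "x \<in> letters j" "y \<in> modes S" "z \<in> modes S"
  shows "occ s N (y * x * z) = 0"
proof (rule occ_eqI)
  let ?P = "config s N" and ?q = "site s j"
  have q: "?q * w = w * ?q" if "w \<in> modes S" for w
    using assms(2) that by (rule site_commute_modes)
  have "?P * (y * x * z) * ?P = (?P * ?q) * (y * x * z) * (?q * ?P)"
    using assms(1) by (simp add: config_absorb)
  also have "\<dots> = ?P * (?q * y) * x * (z * ?q) * ?P"
    by (simp add: mult.assoc)
  also have "\<dots> = ?P * y * (?q * x * ?q) * z * ?P"
    using q[OF assms(4)] q[OF assms(5)] by (simp add: mult.assoc)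
  also have "\<dots> = 0"
    using assms(3) by (simp add: site_letter_site)
  finally show "?P * (y * x * z) * ?P = 0 *\<^sub>C ?P" by simp
qed

lemma config_diag:
  assumes "set js \<subseteq> {..<N}"
  shows "config s N * diag js = (if set js \<subseteq> s then config s N else 0)"
  using assms
proof (induction js)
  case (Cons j js)
  have "config s N * num j = (config s N * site s j) * num j"
    using Cons.prems by (simp add: config_absorb)
  also have "\<dots> = (if j \<in> s then config s N * site s j else 0)"
    unfolding mult.assoc[of _ "site s j"] site_num by simp
  also have "\<dots> = (if j \<in> s then config s N else 0)"
    using Cons.prems by (simp add: config_absorb)
  finally have j: "config s N * num j = (if j \<in> s then config s N else 0)" .
  have "config s N * diag (j # js) = config s N * num j * diag js"
    by (simp add: diag_Cons mult.assoc)
  then show ?case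
    using Cons unfolding j by simp
qed simp

lemma occ_diag: "set js \<subseteq> {..<N} \<Longrightarrow> occ s N (diag js) = (if set js \<subseteq> s then 1 else 0)"
  by (intro occ_eqI) (simp add: config_diag config_idem)

text \<open>Compatibility of the pure states when a mode is added, on which the definition of a
  single functional on the whole local algebra rests.\<close>

lemma occ_Suc:
  assumes "x \<in> modes {..<N}"
  shows "occ s (Suc N) x = occ s N x"
proof (rule occ_eqI)
  let ?P = "config s N" and ?q = "site s N"
  have "config s (Suc N) * x * config s (Suc N) = ?q * ?P * x * (?P * ?q)"
    by (simp add: config_site)
  also have "\<dots> = ?q * (?P * x * ?P) * ?q"
    by (simp only: mult.assoc)
  also have "\<dots> = occ s N x *\<^sub>C (?q * ?P * ?q)"
    using assms by (simp add: occ_compress mult_scaleC_left mult_scaleC_right)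
  also have "?q * ?P * ?q = config s (Suc N)"
    by (simp only: config_site[symmetric] mult.assoc[of ?P] site_idem config.simps)
  finally show "config s (Suc N) * x * config s (Suc N) = occ s N x *\<^sub>C config s (Suc N)" .
qed

lemma occ_restrict: "(\<And>j. j < N \<Longrightarrow> j \<in> s \<longleftrightarrow> j \<in> t) \<Longrightarrow> occ s N x = occ t N x"
  unfolding occ_def using config_restrict[of N s t] by simp

end

text \<open>For independent choices with probability \<open>\<mu>\<close>, the left-hand side is the
  probability that all of \<open>J\<close> is chosen. It is the expansion of the product over
  \<open>A\<close> of \<open>\<mu> + (1 - \<mu>)\<close>, with the second summand replaced by 0 on
  \<open>J\<close>. The case \<open>J = {}\<close> gives total weight 1.\<close>

lemma bernoulli_superset_sum:
  fixes \<mu> :: real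
  assumes "finite A" "J \<subseteq> A"
  shows "(\<Sum>s\<in>Pow A. \<mu> ^ card s * (1 - \<mu>) ^ (card A - card s) * (if J \<subseteq> s then 1 else 0)) = \<mu> ^ card J"
proof -
  have "(\<Sum>s\<in>Pow A. \<mu> ^ card s * (1 - \<mu>) ^ (card A - card s) * (if J \<subseteq> s then 1 else 0))
      = (\<Sum>s\<in>Pow A. (\<Prod>i\<in>s. \<mu>) * (\<Prod>i\<in>A - s. if i \<in> J then 0 else 1 - \<mu>))"
  proof (rule sum.cong)
    fix s assume s: "s \<in> Pow A"
    then have "finite s" "s \<subseteq> A" using assms(1) finite_subset by auto
    have "(\<Prod>i\<in>A - s. if i \<in> J then 0 else 1 - \<mu>) = (1 - \<mu>) ^ (card A - card s) * (if J \<subseteq> s then 1 else 0)"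
    proof (cases "J \<subseteq> s")
      case True
      then have "(\<Prod>i\<in>A - s. if i \<in> J then 0 else 1 - \<mu>) = (\<Prod>i\<in>A - s. 1 - \<mu>)"
        by (intro prod.cong) auto
      then show ?thesis
        using True \<open>finite s\<close> \<open>s \<subseteq> A\<close> by (simp add: card_Diff_subset)
    next
      case False
      then obtain i where "i \<in> J" "i \<in> A - s" using assms(2) by auto
      then have "(\<Prod>i\<in>A - s. if i \<in> J then 0 else 1 - \<mu>) = 0"
        using assms(1) by (intro prod_zero) auto
      then show ?thesis using False by simp
    qed
    then show "\<mu> ^ card s * (1 - \<mu>) ^ (card A - card s) * (if J \<subseteq> s then 1 else 0)
        = (\<Prod>i\<in>s. \<mu>) * (\<Prod>i\<in>A - s. if i \<in> J then 0 else 1 - \<mu>)"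
      by simp
  qed simp
  also have "\<dots> = (\<Prod>i\<in>A. \<mu> + (if i \<in> J then 0 else 1 - \<mu>))"
    by (rule prod_add[OF assms(1), symmetric])
  also have "\<dots> = (\<Prod>i\<in>A. if i \<in> J then \<mu> else 1)"
    by (intro prod.cong) auto
  also have "\<dots> = (\<Prod>i\<in>A \<inter> J. \<mu>)"
    by (rule prod.inter_restrict[OF assms(1), symmetric])
  also have "A \<inter> J = J" using assms(2) by auto
  finally show ?thesis by simp
qed

context car_algebra
begin

subsection \<open>Product states\<close>

text \<open>The product state of density \<open>\<mu>\<close> on the first \<open>N\<close> modes,
  as an average of pure states over independent occupations. In this form positivity and the norm
  bound are inherited from \<open>occ\<close>, which prescribed values on monomials would not
  show.\<close>

definition mixture :: "real \<Rightarrow> nat \<Rightarrow> 'a \<Rightarrow> complex" where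
  "mixture \<mu> N x =
     (\<Sum>s\<in>Pow {..<N}. complex_of_real (\<mu> ^ card s * (1 - \<mu>) ^ (N - card s)) * occ s N x)"

text \<open>Patterns on \<open>N + 1\<close> modes come in pairs that differ at mode
  \<open>N\<close>. Both members have the same value at \<open>x\<close>, and their weights add up
  to the old weight because \<open>\<mu> + (1 - \<mu>) = 1\<close>.\<close>

lemma mixture_Suc:
  assumes "x \<in> modes {..<N}"
  shows "mixture \<mu> (Suc N) x = mixture \<mu> N x"
proof -
  let ?w = "\<lambda>N s. complex_of_real (\<mu> ^ card s * (1 - \<mu>) ^ (N - card s))"
  have inj: "inj_on (insert N) (Pow {..<N})"
    by (auto simp: inj_on_def dest: insert_ident[THEN iffD1, rotated 2])
  have disj: "Pow {..<N} \<inter> insert N ` Pow {..<N} = {}" by auto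
  have "mixture \<mu> (Suc N) x = (\<Sum>s\<in>Pow {..<N} \<union> insert N ` Pow {..<N}. ?w (Suc N) s * occ s (Suc N) x)"
    by (simp only: mixture_def lessThan_Suc Pow_insert)
  also have "\<dots> = (\<Sum>s\<in>Pow {..<N}. ?w (Suc N) s * occ s (Suc N) x)
      + (\<Sum>s\<in>Pow {..<N}. ?w (Suc N) (insert N s) * occ (insert N s) (Suc N) x)"
    using disj inj by (simp add: sum.union_disjoint sum.reindex)
  also have "\<dots> = (\<Sum>s\<in>Pow {..<N}. (?w (Suc N) s + ?w (Suc N) (insert N s)) * occ s N x)"
  proof -
    have "occ s (Suc N) x = occ s N x" for s
      by (rule occ_Suc[OF assms])
    moreover have "occ (insert N s) N x = occ s N x" for s
      by (rule occ_restrict) auto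
    ultimately show ?thesis by (simp add: distrib_right flip: sum.distrib)
  qed
  also have "\<dots> = mixture \<mu> N x"
    unfolding mixture_def
  proof (rule sum.cong)
    fix s assume s: "s \<in> Pow {..<N}"
    then have "finite s" "N \<notin> s" by (auto intro: finite_subset)
    \<comment> \<open>Needed for the truncated exponent: \<open>Suc N - card s\<close> then equals
      \<open>Suc (N - card s)\<close>.\<close>
    moreover have "card s \<le> N"
      using card_mono[of "{..<N}" s] s by auto
    ultimately have "?w (Suc N) s + ?w (Suc N) (insert N s) = ?w N s"
      by (simp add: Suc_diff_le algebra_simps)
    then show "(?w (Suc N) s + ?w (Suc N) (insert N s)) * occ s N x = ?w N s * occ s N x"
      by simp
  qed simp
  finally show ?thesis .
qed

lemma mixture_mono:
  assumes "x \<in> modes {..<N}" "N \<le> M"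
  shows "mixture \<mu> M x = mixture \<mu> N x"
  using assms(2)
proof (induction M rule: dec_induct)
  case (step M)
  have "x \<in> modes {..<M}"
    using assms(1) modes_mono[of "{..<N}" "{..<M}"] step.hyps by auto
  then show ?case using step.IH by (simp add: mixture_Suc)
qed simp

text \<open>\<open>LEAST\<close> only selects a level; by \<open>mixture_mono\<close> every level
  that contains \<open>x\<close> gives the same value.\<close>

definition local_product :: "real \<Rightarrow> 'a \<Rightarrow> complex" where
  "local_product \<mu> x = mixture \<mu> (LEAST N. x \<in> modes {..<N}) x"

lemma local_product_eq:
  assumes "x \<in> modes {..<N}"
  shows "local_product \<mu> x = mixture \<mu> N x"
  unfolding local_product_def
  by (rule mixture_mono[symmetric, OF LeastI[of "\<lambda>N. x \<in> modes {..<N}", OF assms]])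
     (rule Least_le[of "\<lambda>N. x \<in> modes {..<N}", OF assms])

lemma local_product_add:
  assumes "x \<in> local_algebra" "y \<in> local_algebra"
  shows "local_product \<mu> (x + y) = local_product \<mu> x + local_product \<mu> y"
proof -
  obtain N where N: "x \<in> modes {..<N}" "y \<in> modes {..<N}"
    using local_algebra_common[OF assms] .
  then show ?thesis
    by (simp add: local_product_eq[of _ N] modes_add mixture_def occ_add distrib_left sum.distrib)
qed

lemma local_product_scaleC:
  assumes "x \<in> local_algebra"
  shows "local_product \<mu> (c *\<^sub>C x) = c * local_product \<mu> x"
proof -
  obtain N where N: "x \<in> modes {..<N}"
    using assms by (auto simp: local_algebra_def)
  then show ?thesis
    by (simp add: local_product_eq[of _ N] modes_scaleC mixture_def occ_scaleC sum_distrib_left mult_ac)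
qed

context
  fixes \<mu> :: real
  assumes \<mu>: "\<mu> \<in> {0..1}"
begin

lemma norm_local_product_le:
  assumes "x \<in> local_algebra"
  shows "cmod (local_product \<mu> x) \<le> norm x"
proof -
  obtain N where N: "x \<in> modes {..<N}"
    using assms by (auto simp: local_algebra_def)
  let ?w = "\<lambda>s. \<mu> ^ card s * (1 - \<mu>) ^ (N - card s)"
  have "cmod (mixture \<mu> N x) \<le> (\<Sum>s\<in>Pow {..<N}. ?w s * norm x)"
    unfolding mixture_def
  proof (intro order_trans[OF norm_sum] sum_mono)
    show "cmod (complex_of_real (?w s) * occ s N x) \<le> ?w s * norm x" for s
      using \<mu> norm_occ_le[OF N, of s]
      by (simp add: norm_mult abs_mult norm_power mult_left_mono del: of_real_mult of_real_power)
  qed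
  also have "\<dots> = norm x"
    using bernoulli_superset_sum[of "{..<N}" "{}" \<mu>] by (simp flip: sum_distrib_right)
  finally show ?thesis by (simp add: local_product_eq[OF N])
qed

lemma local_product_positive:
  assumes "x \<in> local_algebra"
  shows "local_product \<mu> (star x * x) \<in> \<real>\<^sub>\<ge>\<^sub>0"
proof -
  obtain N where N: "x \<in> modes {..<N}"
    using assms by (auto simp: local_algebra_def)
  obtain r where r: "\<And>s. 0 \<le> r s" "\<And>s. occ s N (star x * x) = complex_of_real (r s)"
    using occ_positive[OF N] by metis
  have "mixture \<mu> N (star x * x)
      = complex_of_real (\<Sum>s\<in>Pow {..<N}. \<mu> ^ card s * (1 - \<mu>) ^ (N - card s) * r s)"
    by (simp add: mixture_def r)
  moreover have "0 \<le> (\<Sum>s\<in>Pow {..<N}. \<mu> ^ card s * (1 - \<mu>) ^ (N - card s) * r s)"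
    using \<mu> r(1) by (intro sum_nonneg mult_nonneg_nonneg) auto
  ultimately have "mixture \<mu> N (star x * x) \<in> \<real>\<^sub>\<ge>\<^sub>0"
    by (simp only: nonneg_Reals_of_real_iff)
  then show ?thesis
    using N by (simp add: local_product_eq[of _ N] modes_mult modes_star)
qed

lemma local_product_odd_letter:
  assumes "finite S" "j \<notin> S" "x \<in> letters j" "y \<in> modes S" "z \<in> modes S"
  shows "local_product \<mu> (y * x * z) = 0"
proof -
  obtain N where N: "insert j S \<subseteq> {..<N}"
    using finite_subset_lessThan[of "insert j S"] assms(1) by auto
  have "y \<in> modes {..<N}" "z \<in> modes {..<N}" "x \<in> modes {..<N}"
    using modes_mono[of S "{..<N}"] modes_letter[of j "{..<N}" x] assms N by auto
  then have "local_product \<mu> (y * x * z) = mixture \<mu> N (y * x * z)"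
    by (intro local_product_eq modes_mult)
  also have "\<dots> = 0"
  proof -
    have "occ s N (y * x * z) = 0" for s
      using assms N by (intro occ_odd_letter[of j N S]) auto
    then show ?thesis by (simp add: mixture_def)
  qed
  finally show ?thesis .
qed

lemma local_product_diag:
  assumes "distinct js"
  shows "local_product \<mu> (diag js) = complex_of_real \<mu> ^ length js"
proof -
  obtain N where N: "set js \<subseteq> {..<N}"
    using finite_subset_lessThan[of "set js"] by auto
  have "local_product \<mu> (diag js) = mixture \<mu> N (diag js)"
    using N by (intro local_product_eq diag_modes)
  also have "\<dots> = complex_of_real (\<Sum>s\<in>Pow {..<N}. \<mu> ^ card s * (1 - \<mu>) ^ (card {..<N} - card s) * (if set js \<subseteq> s then 1 else 0))"
    unfolding mixture_def of_real_sum using N by (intro sum.cong) (simp_all add: occ_diag)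
  also have "\<dots> = complex_of_real (\<mu> ^ card (set js))"
    using N by (subst bernoulli_superset_sum) simp_all
  finally show ?thesis using assms by (simp add: distinct_card)
qed

end

lemma local_sequence:
  obtains f where "\<And>n. f n \<in> local_algebra" "f \<longlonglongrightarrow> x"
proof -
  have "x \<in> closure local_algebra" by (simp add: local_algebra_dense)
  then show ?thesis using that unfolding closure_sequential by blast
qed

text \<open>Linearity and the bound pass to limits along local sequences. The constant 1 in the
  bound is kept, so the product states are bounded uniformly in the density; this later turns
  approximation of \<open>x\<close> into uniform convergence in \<open>\<mu>\<close>.\<close>

lemma extend_local_functional:
  fixes f :: "'a \<Rightarrow> complex"
  assumes add: "\<And>x y. x \<in> local_algebra \<Longrightarrow> y \<in> local_algebra \<Longrightarrow> f (x + y) = f x + f y"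
    and scale: "\<And>c x. x \<in> local_algebra \<Longrightarrow> f (c *\<^sub>C x) = c * f x"
    and bound: "\<And>x. x \<in> local_algebra \<Longrightarrow> cmod (f x) \<le> norm x"
  obtains \<phi> where "\<phi> \<in> cstar_dual" "\<And>x. x \<in> local_algebra \<Longrightarrow> \<phi> x = f x"
    "\<And>x. cmod (\<phi> x) \<le> norm x"
proof -
  have "uniformly_continuous_on local_algebra f"
    unfolding uniformly_continuous_on_def
  proof (intro allI impI)
    fix e :: real assume "e > 0"
    have "dist (f y) (f x) \<le> dist y x" if xy: "x \<in> local_algebra" "y \<in> local_algebra" for x y
    proof -
      have "f y = f (y + (- 1) *\<^sub>C x) + f x"
        using xy by (simp add: add scale local_algebra_scaleC)
      then show ?thesis
        using bound[of "y + (- 1) *\<^sub>C x"] xy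
        by (simp add: dist_norm local_algebra_add local_algebra_scaleC)
           (simp add: scaleC_minus_one)
    qed
    then show "\<exists>d>0. \<forall>x\<in>local_algebra. \<forall>x'\<in>local_algebra. dist x' x < d \<longrightarrow> dist (f x') (f x) < e"
      using \<open>e > 0\<close> by (metis order_le_less_trans)
  qed
  then obtain \<phi> where "uniformly_continuous_on (closure local_algebra) \<phi>"
      and eq: "\<And>x. x \<in> local_algebra \<Longrightarrow> f x = \<phi> x"
    by (rule uniformly_continuous_on_extension_on_closure) blast
  then have "continuous_on UNIV \<phi>"
    by (simp add: local_algebra_dense uniformly_continuous_imp_continuous)
  then have lim: "(\<lambda>n. \<phi> (g n)) \<longlonglongrightarrow> \<phi> x" if "g \<longlonglongrightarrow> x" for g x
    using that by (auto intro: continuous_on_tendsto_compose)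
  have bound': "cmod (\<phi> x) \<le> norm x" for x
  proof -
    obtain g where g: "\<And>n. g n \<in> local_algebra" "g \<longlonglongrightarrow> x"
      using local_sequence[of x] by blast
    show ?thesis
      using g by (intro LIMSEQ_le[OF tendsto_norm[OF lim[OF g(2)]] tendsto_norm[OF g(2)]])
        (auto simp: bound simp flip: eq)
  qed
  have "\<phi> (x + y) = \<phi> x + \<phi> y" for x y
  proof -
    obtain g where g: "\<And>n. g n \<in> local_algebra" "g \<longlonglongrightarrow> x"
      using local_sequence[of x] by blast
    obtain h where h: "\<And>n. h n \<in> local_algebra" "h \<longlonglongrightarrow> y"
      using local_sequence[of y] by blast
    have "(\<lambda>n. \<phi> (g n + h n)) \<longlonglongrightarrow> \<phi> (x + y)"
      by (intro lim tendsto_add g h)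
    moreover have "(\<lambda>n. \<phi> (g n + h n)) = (\<lambda>n. \<phi> (g n) + \<phi> (h n))"
      using g h by (simp add: add local_algebra_add flip: eq)
    moreover have "(\<lambda>n. \<phi> (g n) + \<phi> (h n)) \<longlonglongrightarrow> \<phi> x + \<phi> y"
      by (intro tendsto_add lim g h)
    ultimately show ?thesis using LIMSEQ_unique by metis
  qed
  moreover have "\<phi> (c *\<^sub>C x) = c * \<phi> x" for c x
  proof -
    obtain g where g: "\<And>n. g n \<in> local_algebra" "g \<longlonglongrightarrow> x"
      using local_sequence[of x] by blast
    have "(\<lambda>n. \<phi> (c *\<^sub>C g n)) \<longlonglongrightarrow> \<phi> (c *\<^sub>C x)"
      by (intro lim bounded_linear.tendsto[OF bounded_linear_scaleC] g)
    moreover have "(\<lambda>n. \<phi> (c *\<^sub>C g n)) = (\<lambda>n. c * \<phi> (g n))"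
      using g by (simp add: scale local_algebra_scaleC flip: eq)
    moreover have "(\<lambda>n. c * \<phi> (g n)) \<longlonglongrightarrow> c * \<phi> x"
      by (intro tendsto_mult tendsto_const lim g)
    ultimately show ?thesis using LIMSEQ_unique by metis
  qed
  moreover have "\<exists>K. \<forall>x. cmod (\<phi> x) \<le> K * norm x"
    using bound' by (intro exI[of _ 1]) simp
  ultimately have "\<phi> \<in> cstar_dual" by (simp add: cstar_dual_def)
  then show ?thesis using eq bound' by (intro that) auto
qed

lemma positive_if_positive_on_local:
  assumes "\<phi> \<in> cstar_dual" "\<And>x. x \<in> local_algebra \<Longrightarrow> \<phi> (star x * x) \<in> \<real>\<^sub>\<ge>\<^sub>0"
  shows "\<phi> (star x * x) \<in> \<real>\<^sub>\<ge>\<^sub>0"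
proof -
  obtain g where g: "\<And>n. g n \<in> local_algebra" "g \<longlonglongrightarrow> x"
    using local_sequence[of x] by blast
  have "(\<lambda>n. \<phi> (star (g n) * g n)) \<longlonglongrightarrow> \<phi> (star x * x)"
    by (intro bounded_linear.tendsto[OF dual_bounded_linear[OF assms(1)]] tendsto_mult
        bounded_linear.tendsto[OF bounded_linear_star] g)
  with assms(2)[OF g(1)] show ?thesis
    by (rule closed_sequentially[OF closed_nonneg_Reals_complex])
qed

lemma product_state_exists:
  assumes "\<mu> \<in> {0..1}"
  shows "\<exists>\<phi>. \<phi> \<in> states \<and> (\<forall>x. cmod (\<phi> x) \<le> norm x) \<and> has_moments (\<lambda>k. complex_of_real \<mu> ^ k) \<phi>"
proof -
  obtain \<phi> where \<phi>: "\<phi> \<in> cstar_dual" "\<And>x. x \<in> local_algebra \<Longrightarrow> \<phi> x = local_product \<mu> x"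
    "\<And>x. cmod (\<phi> x) \<le> norm x"
    using extend_local_functional[of "local_product \<mu>"]
      local_product_add local_product_scaleC norm_local_product_le[OF assms] by blast
  have modes_local: "x \<in> local_algebra" if x: "finite S" "x \<in> modes S" for x S
  proof -
    obtain N where "S \<subseteq> {..<N}" using finite_subset_lessThan x(1) by blast
    then show ?thesis using modes_mono[of S "{..<N}"] x(2) by (auto simp: local_algebra_def)
  qed
  have "has_moments (\<lambda>k. complex_of_real \<mu> ^ k) \<phi>"
    unfolding has_moments_def
  proof (intro conjI allI impI)
    show "\<phi> (y * x * z) = 0"
      if *: "finite S \<and> j \<notin> S \<and> x \<in> letters j \<and> y \<in> modes S \<and> z \<in> modes S" for S j x y z
    proof -
      have "x \<in> local_algebra" "y \<in> local_algebra" "z \<in> local_algebra"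
        using * modes_local[of S] modes_local[of "{j}" x] modes_letter[of j "{j}" x] by auto
      then have "\<phi> (y * x * z) = local_product \<mu> (y * x * z)"
        by (intro \<phi>(2) local_algebra_mult)
      also have "\<dots> = 0"
        using * local_product_odd_letter[OF assms] by blast
      finally show ?thesis .
    qed
    show "\<phi> (diag js) = complex_of_real \<mu> ^ length js" if "distinct js" for js
      using modes_local[OF _ diag_modes[of js "set js"]]
      by (simp add: \<phi>(2) local_product_diag[OF assms that])
  qed (use \<phi>(1) in \<open>auto simp: cstar_dual_def\<close>)
  moreover have "\<phi> (star x * x) \<in> \<real>\<^sub>\<ge>\<^sub>0" for x
    using \<phi>(1)
  proof (rule positive_if_positive_on_local)
    show "\<phi> (star x * x) \<in> \<real>\<^sub>\<ge>\<^sub>0" if "x \<in> local_algebra" for x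
      using local_product_positive[OF assms that] that
      by (simp add: \<phi>(2) local_algebra_mult local_algebra_star)
  qed
  moreover have "\<phi> 1 = 1"
    using calculation(1) unfolding has_moments_def by (metis diag_Nil distinct.simps(1) list.size(3) power_0)
  ultimately show ?thesis
    using \<phi>(1,3) by (intro exI[of _ \<phi>]) (auto simp: states_def complex_nonneg_Reals_iff complex_is_Real_iff)
qed

text \<open>For \<open>\<mu>\<close> in \<open>[0, 1]\<close> the choice is unique by
  \<open>functional_eq_if_same_moments\<close>; for other \<open>\<mu>\<close> the value is
  arbitrary.\<close>

definition product_state :: "real \<Rightarrow> 'a \<Rightarrow> complex" where
  "product_state \<mu> = (SOME \<phi>. \<phi> \<in> states \<and> (\<forall>x. cmod (\<phi> x) \<le> norm x) \<and>
     has_moments (\<lambda>k. complex_of_real \<mu> ^ k) \<phi>)"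

lemma
  assumes "\<mu> \<in> {0..1}"
  shows product_state_states: "product_state \<mu> \<in> states"
    and norm_product_state_le: "cmod (product_state \<mu> x) \<le> norm x"
    and product_state_has_moments: "has_moments (\<lambda>k. complex_of_real \<mu> ^ k) (product_state \<mu>)"
  using someI_ex[OF product_state_exists[OF assms], folded product_state_def] by auto

lemma product_state_dual: "\<mu> \<in> {0..1} \<Longrightarrow> product_state \<mu> \<in> cstar_dual"
  using product_state_states by (auto simp: states_def)

text \<open>On the local algebra the value is a polynomial in \<open>\<mu>\<close>.\<close>

lemma continuous_product_state: "continuous_on {0..1} (\<lambda>\<mu>. product_state \<mu> x)"
proof -
  obtain g where g: "\<And>n. g n \<in> local_algebra" "g \<longlonglongrightarrow> x"
    using local_sequence[of x] by blast
  show ?thesis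
  proof (rule uniform_limit_theorem)
    show "\<forall>\<^sub>F n in sequentially. continuous_on {0..1} (\<lambda>\<mu>. product_state \<mu> (g n))"
    proof (rule always_eventually, rule allI)
      fix n
      obtain c K where cK: "\<And>m \<phi>. has_moments m \<phi> \<Longrightarrow> \<phi> (g n) = (\<Sum>k\<le>K. c k * m k)"
        using has_moments_local[OF g(1)] by blast
      have "continuous_on {0..1} (\<lambda>\<mu>. \<Sum>k\<le>K. c k * complex_of_real \<mu> ^ k)"
        by (intro continuous_intros)
      then show "continuous_on {0..1} (\<lambda>\<mu>. product_state \<mu> (g n))"
        by (rule continuous_on_cong[THEN iffD1, rotated 2])
           (simp_all add: cK[OF product_state_has_moments])
    qed
    show "uniform_limit {0..1} (\<lambda>n \<mu>. product_state \<mu> (g n)) (\<lambda>\<mu>. product_state \<mu> x) sequentially"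
    proof (rule uniform_limitI)
      fix e :: real assume "e > 0"
      then have "\<forall>\<^sub>F n in sequentially. dist (g n) x < e"
        using g(2) by (rule tendstoD[rotated])
      then show "\<forall>\<^sub>F n in sequentially. \<forall>\<mu>\<in>{0..1}. dist (product_state \<mu> (g n)) (product_state \<mu> x) < e"
      proof eventually_elim
        case (elim n)
        show ?case
        proof
          fix \<mu> :: real assume \<mu>: "\<mu> \<in> {0..1}"
          interpret bounded_linear "product_state \<mu>"
            by (rule dual_bounded_linear[OF product_state_dual[OF \<mu>]])
          show "dist (product_state \<mu> (g n)) (product_state \<mu> x) < e"
            using norm_product_state_le[OF \<mu>, of "g n - x"] elim by (simp add: dist_norm diff)
        qed
      qed
    qed
  qed simp
qed

end

section \<open>Finite measures on the unit interval\<close>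

definition unit_measures :: "real measure set" where
  "unit_measures = {M. finite_measure M \<and> sets M = sets (restrict_space borel {0..1})}"

abbreviation "unit_borel \<equiv> sets (restrict_space borel {0..1::real})"

lemma unit_interval_borel: "{0..1} \<in> unit_borel"
  using sets.top[of "restrict_space borel {0..1::real}"] by (simp add: space_restrict_space)

lemma interval_probs_unit_measures: "M \<in> interval_probs 0 1 \<Longrightarrow> M \<in> unit_measures"
  by (auto simp: interval_probs_def unit_measures_def prob_space.finite_measure)

context
  fixes M :: "real measure"
  assumes M: "M \<in> unit_measures"
begin

lemma unit_measures_sets: "sets M = unit_borel"
  using M by (simp add: unit_measures_def)

lemma unit_measures_space: "space M = {0..1}"
  using sets_eq_imp_space_eq[OF unit_measures_sets] by (simp add: space_restrict_space)

lemma unit_measures_finite: "finite_measure M"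
  using M by (simp add: unit_measures_def)

lemma unit_measures_emeasure: "emeasure M A = ennreal (measure M A)"
  using unit_measures_finite by (rule finite_measure.emeasure_eq_measure)

lemma unit_measures_measurable:
  assumes "continuous_on {0..1} f"
  shows "f \<in> borel_measurable M"
  using borel_measurable_continuous_on_restrict[OF assms] measurable_cong_sets[OF unit_measures_sets refl]
  by blast

lemma unit_measures_integrable:
  fixes f :: "real \<Rightarrow> 'b::{banach, second_countable_topology}"
  assumes f: "continuous_on {0..1} f"
  shows "integrable M f"
proof -
  have "compact (f ` {0..1})"
    using f by (intro compact_continuous_image) auto
  then obtain B where "\<forall>x\<in>{0..1}. norm (f x) \<le> B"
    by (metis bounded_iff compact_imp_bounded imageI)
  then show ?thesis
    by (intro finite_measure.integrable_const_bound[OF unit_measures_finite, of _ B] AE_I2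
        unit_measures_measurable f) (simp add: unit_measures_space)
qed

lemma unit_measures_integral_bound:
  fixes f :: "real \<Rightarrow> 'b::{banach, second_countable_topology}"
  assumes f: "continuous_on {0..1} f" and B: "\<And>x. x \<in> {0..1} \<Longrightarrow> norm (f x) \<le> B"
  shows "norm (\<integral>x. f x \<partial>M) \<le> B * measure M {0..1}"
proof -
  have "norm (\<integral>x. f x \<partial>M) \<le> (\<integral>x. norm (f x) \<partial>M)"
    by (rule integral_norm_bound)
  also have "\<dots> \<le> (\<integral>x. B \<partial>M)"
    by (intro integral_mono unit_measures_integrable continuous_on_norm f continuous_on_const)
       (simp add: unit_measures_space B)
  also have "\<dots> = B * measure M {0..1}"
    by (simp add: unit_measures_space)
  finally show ?thesis .
qed

end

section \<open>Arithmetic of finite measures and of their integrals\<close>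

lemma unit_measures_eqI:
  assumes "M \<in> unit_measures" "N \<in> unit_measures" "\<And>A. A \<in> unit_borel \<Longrightarrow> measure M A = measure N A"
  shows "M = N"
  using assms by (intro measure_eqI) (simp_all add: unit_measures_emeasure unit_measures_sets)

text \<open>The restriction of \<open>M\<close> to \<open>Y\<close> plus the restriction of
  \<open>N\<close> to \<open>Z\<close>. One construction serves for sums
  (\<open>Y = Z = {0..1}\<close>), for suprema and infima (\<open>Z\<close> the complement of a Hahn
  set \<open>Y\<close>) and for plain restrictions (\<open>Z = {}\<close>).\<close>

lemma unit_measures_construct:
  assumes MN: "M \<in> unit_measures" "N \<in> unit_measures" and YZ: "Y \<in> unit_borel" "Z \<in> unit_borel"
  obtains L where "L \<in> unit_measures"
    "\<And>A. A \<in> unit_borel \<Longrightarrow> measure L A = measure M (A \<inter> Y) + measure N (A \<inter> Z)"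
proof -
  define \<nu> where "\<nu> A = emeasure M (A \<inter> Y) + emeasure N (A \<inter> Z)" for A
  define L where "L = measure_of {0..1} unit_borel \<nu>"
  have sp: "space (restrict_space borel {0..1::real}) = {0..1}"
    by (simp add: space_restrict_space)
  have sets: "sets L = unit_borel"
    unfolding L_def using sets.sigma_sets_eq[of "restrict_space borel {0..1::real}"]
      sets.space_closed[of "restrict_space borel {0..1::real}"] by (simp add: sp)
  have "emeasure L A = \<nu> A" if A: "A \<in> unit_borel" for A
    unfolding L_def
  proof (rule emeasure_measure_of_sigma)
    show "sigma_algebra {0..1} unit_borel"
      using sets.sigma_algebra_axioms[of "restrict_space borel {0..1::real}"] by (simp add: sp)
    show "positive unit_borel \<nu>"
      by (simp add: positive_def \<nu>_def)
    show "countably_additive unit_borel \<nu>"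
    proof (rule countably_additiveI)
      fix A :: "nat \<Rightarrow> real set"
      assume A: "range A \<subseteq> unit_borel" "disjoint_family A"
      have *: "(\<Sum>i. emeasure K (A i \<inter> V)) = emeasure K (\<Union> (range A) \<inter> V)"
        if "K \<in> unit_measures" "V \<in> unit_borel" for K V
      proof -
        have "(\<Sum>i. emeasure K (A i \<inter> V)) = emeasure K (\<Union>i. A i \<inter> V)"
          using A that by (intro suminf_emeasure) (auto simp: disjoint_family_on_def unit_measures_sets)
        then show ?thesis by simp
      qed
      show "(\<Sum>i. \<nu> (A i)) = \<nu> (\<Union> (range A))"
        unfolding \<nu>_def using *[OF MN(1) YZ(1)] *[OF MN(2) YZ(2)]
        by (subst suminf_add[symmetric]) auto
    qed
  qed (rule A)
  then have L: "emeasure L A = ennreal (measure M (A \<inter> Y) + measure N (A \<inter> Z))"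
    if "A \<in> unit_borel" for A
    using that by (simp add: \<nu>_def unit_measures_emeasure MN ennreal_plus)
  have "space L = {0..1}"
    using sets_eq_imp_space_eq[OF sets] by (simp add: sp)
  then have "finite_measure L"
    by (intro finite_measureI) (simp add: L unit_interval_borel)
  then have "L \<in> unit_measures"
    by (simp add: unit_measures_def sets)
  moreover have "measure L A = measure M (A \<inter> Y) + measure N (A \<inter> Z)" if "A \<in> unit_borel" for A
    by (rule measure_eq_emeasure_eq_ennreal[OF _ L[OF that]]) simp
  ultimately show ?thesis by (rule that)
qed

lemma unit_measures_add:
  assumes "M \<in> unit_measures" "N \<in> unit_measures"
  obtains L where "L \<in> unit_measures" "\<And>A. A \<in> unit_borel \<Longrightarrow> measure L A = measure M A + measure N A"
proof -
  obtain L where L: "L \<in> unit_measures"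
      "\<And>A. A \<in> unit_borel \<Longrightarrow> measure L A = measure M (A \<inter> {0..1}) + measure N (A \<inter> {0..1})"
    using unit_measures_construct[OF assms unit_interval_borel unit_interval_borel] by blast
  have "A \<inter> {0..1} = A" if "A \<in> unit_borel" for A
    using sets.sets_into_space[OF that] by (auto simp: space_restrict_space)
  with L show ?thesis by (intro that[of L]) auto
qed

lemma unit_measures_scale:
  assumes "M \<in> unit_measures" "c \<ge> 0"
  obtains L where "L \<in> unit_measures" "\<And>A. A \<in> unit_borel \<Longrightarrow> measure L A = c * measure M A"
proof
  have "finite_measure (scale_measure (ennreal c) M)"
    using assms by (intro finite_measureI)
      (simp add: unit_measures_emeasure ennreal_mult[symmetric] space_scale_measure)
  then show "scale_measure (ennreal c) M \<in> unit_measures"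
    using assms(1) by (simp add: unit_measures_def)
  show "measure (scale_measure (ennreal c) M) A = c * measure M A" for A
    using assms(2) by (simp add: measure_scale_measure)
qed

lemma unit_measures_diff:
  assumes MN: "M \<in> unit_measures" "N \<in> unit_measures"
    and le: "\<And>A. A \<in> unit_borel \<Longrightarrow> measure M A \<le> measure N A"
  obtains L where "L \<in> unit_measures" "\<And>A. A \<in> unit_borel \<Longrightarrow> measure N A = measure M A + measure L A"
proof
  let ?L = "diff_measure N M"
  have e: "emeasure ?L A = ennreal (measure N A - measure M A)" if "A \<in> unit_borel" for A
    using that MN le
    by (subst emeasure_diff_measure)
       (simp_all add: unit_measures_finite unit_measures_emeasure unit_measures_sets ennreal_minus)
  have "finite_measure ?L"
  proof (rule finite_measureI)
    show "emeasure ?L (space ?L) \<noteq> \<infinity>"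
      using e[of "{0..1}"] sets.top[of N] MN by (simp add: unit_measures_space unit_measures_sets)
  qed
  then show "?L \<in> unit_measures"
    using MN by (simp add: unit_measures_def)
  show "measure N A = measure M A + measure ?L A" if "A \<in> unit_borel" for A
    using measure_eq_emeasure_eq_ennreal[OF _ e[OF that]] le[OF that] by simp
qed

text \<open>The three measures are related only through their values on sets, so the identity is
  carried from indicators to nonnegative measurable functions by monotone approximation.\<close>

lemma nn_integral_lincomb:
  assumes MNL: "M \<in> unit_measures" "N \<in> unit_measures" "L \<in> unit_measures" and st: "s \<ge> 0" "t \<ge> 0"
    and eq: "\<And>A. A \<in> unit_borel \<Longrightarrow> measure L A = s * measure M A + t * measure N A"
    and u: "u \<in> borel_measurable (restrict_space borel {0..1})"
  shows "(\<integral>\<^sup>+x. u x \<partial>L) = ennreal s * (\<integral>\<^sup>+x. u x \<partial>M) + ennreal t * (\<integral>\<^sup>+x. u x \<partial>N)"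
proof -
  have meas: "borel_measurable K = borel_measurable (restrict_space borel {0..1})"
    if "K \<in> unit_measures" for K :: "real measure"
    using that by (intro measurable_cong_sets) (simp_all add: unit_measures_sets)
  note m = meas[OF MNL(1)] meas[OF MNL(2)] meas[OF MNL(3)]
  from u show ?thesis
  proof (induction rule: borel_measurable_induct)
    case (cong f g)
    have "(\<integral>\<^sup>+x. f x \<partial>K) = (\<integral>\<^sup>+x. g x \<partial>K)" if "K \<in> unit_measures" for K
      using cong(3) that by (intro nn_integral_cong) (simp add: unit_measures_space space_restrict_space)
    then show ?case using cong.IH MNL by simp
  next
    case (set A)
    have "(\<integral>\<^sup>+x. indicator A x \<partial>K) = ennreal (measure K A)" if "K \<in> unit_measures" for K
      using nn_integral_indicator[of A K] set that
      by (simp add: unit_measures_sets unit_measures_emeasure)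
    then show ?case
      using MNL st set by (simp add: eq ennreal_plus ennreal_mult)
  next
    case (mult f c)
    then show ?case
      by (simp add: nn_integral_cmult m distrib_left mult_ac)
  next
    case (add f g)
    then show ?case
      by (simp add: nn_integral_add m distrib_left add_ac)
  next
    case (seq U)
    have SUP: "(\<integral>\<^sup>+x. (SUP i. U i) x \<partial>K) = (SUP i. \<integral>\<^sup>+x. U i x \<partial>K)"
      if "K \<in> unit_measures" for K
    proof -
      have "(\<integral>\<^sup>+x. (SUP i. U i) x \<partial>K) = (\<integral>\<^sup>+x. (SUP i. U i x) \<partial>K)"
        by (subst SUP_apply) simp
      also have "\<dots> = (SUP i. \<integral>\<^sup>+x. U i x \<partial>K)"
        using seq(3) by (rule nn_integral_monotone_convergence_SUP) (simp add: meas[OF that] seq(1))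
      finally show ?thesis .
    qed
    have inc: "incseq (\<lambda>i. ennreal c * (\<integral>\<^sup>+x. U i x \<partial>K))" for K c
      using seq(3) by (auto simp: incseq_def le_fun_def intro!: nn_integral_mono mult_left_mono)
    have "(\<integral>\<^sup>+x. (SUP i. U i) x \<partial>L)
        = (SUP i. ennreal s * (\<integral>\<^sup>+x. U i x \<partial>M) + ennreal t * (\<integral>\<^sup>+x. U i x \<partial>N))"
      by (simp only: SUP[OF MNL(3)] seq.IH)
    also have "\<dots> = (SUP i. ennreal s * (\<integral>\<^sup>+x. U i x \<partial>M)) + (SUP i. ennreal t * (\<integral>\<^sup>+x. U i x \<partial>N))"
      by (rule ennreal_SUP_add[OF inc inc])
    also have "\<dots> = ennreal s * (\<integral>\<^sup>+x. (SUP i. U i) x \<partial>M) + ennreal t * (\<integral>\<^sup>+x. (SUP i. U i) x \<partial>N)"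
      by (simp only: SUP[OF MNL(1)] SUP[OF MNL(2)] SUP_mult_left_ennreal)
    finally show ?case using seq.hyps by simp
  qed
qed

lemma integral_lincomb:
  fixes f :: "real \<Rightarrow> real"
  assumes MNL: "M \<in> unit_measures" "N \<in> unit_measures" "L \<in> unit_measures" and st: "s \<ge> 0" "t \<ge> 0"
    and eq: "\<And>A. A \<in> unit_borel \<Longrightarrow> measure L A = s * measure M A + t * measure N A"
    and f: "continuous_on {0..1} f"
  shows "(\<integral>x. f x \<partial>L) = s * (\<integral>x. f x \<partial>M) + t * (\<integral>x. f x \<partial>N)"
proof -
  have part: "enn2real (\<integral>\<^sup>+x. ennreal (g x) \<partial>L)
      = s * enn2real (\<integral>\<^sup>+x. ennreal (g x) \<partial>M) + t * enn2real (\<integral>\<^sup>+x. ennreal (g x) \<partial>N)"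
    if g: "continuous_on {0..1} g" for g :: "real \<Rightarrow> real"
  proof -
    have fin: "(\<integral>\<^sup>+x. ennreal (g x) \<partial>K) < \<infinity>" if K: "K \<in> unit_measures" for K
    proof -
      have "(\<integral>\<^sup>+x. ennreal (g x) \<partial>K) \<le> (\<integral>\<^sup>+x. ennreal (norm (g x)) \<partial>K)"
        by (intro nn_integral_mono ennreal_leI) simp
      also have "\<dots> < \<infinity>"
        using unit_measures_integrable[OF K g] by (simp add: integrable_iff_bounded)
      finally show ?thesis .
    qed
    have "(\<lambda>x. ennreal (g x)) \<in> borel_measurable (restrict_space borel {0..1})"
      using borel_measurable_continuous_on_restrict[OF g] by measurable
    from nn_integral_lincomb[OF MNL st eq this]
    have "(\<integral>\<^sup>+x. ennreal (g x) \<partial>L)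
        = ennreal s * (\<integral>\<^sup>+x. ennreal (g x) \<partial>M) + ennreal t * (\<integral>\<^sup>+x. ennreal (g x) \<partial>N)" .
    then show ?thesis
      using fin[OF MNL(1)] fin[OF MNL(2)] st
      by (simp add: enn2real_plus enn2real_mult ennreal_mult_less_top)
  qed
  have parts: "(\<integral>x. f x \<partial>K) = enn2real (\<integral>\<^sup>+x. ennreal (f x) \<partial>K) - enn2real (\<integral>\<^sup>+x. ennreal (- f x) \<partial>K)"
    if "K \<in> unit_measures" for K
    by (rule real_lebesgue_integral_def[OF unit_measures_integrable[OF that f]])
  show ?thesis
    unfolding parts[OF MNL(1)] parts[OF MNL(2)] parts[OF MNL(3)]
    using part[OF f] part[OF continuous_on_minus[OF f]] by (simp add: algebra_simps)
qed

section \<open>Determination of a measure by its moments\<close>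

lemma measure_space_eq_moment_0:
  "M \<in> unit_measures \<Longrightarrow> measure M {0..1} = (\<integral>x. x ^ 0 \<partial>M)"
  by (simp add: unit_measures_space)

lemma unit_integral_eq_if_same_moments:
  fixes f :: "real \<Rightarrow> real"
  assumes MN: "M \<in> unit_measures" "N \<in> unit_measures"
    and eq: "\<And>k. (\<integral>x. x ^ k \<partial>M) = (\<integral>x. x ^ k \<partial>N)"
    and f: "continuous_on {0..1} f"
  shows "(\<integral>x. f x \<partial>M) = (\<integral>x. f x \<partial>N)"
proof -
  define m where "m = measure M {0..1} + measure N {0..1}"
  have "\<bar>(\<integral>x. f x \<partial>M) - (\<integral>x. f x \<partial>N)\<bar> \<le> e * m" if e: "e > 0" for e
  proof -
    obtain g where g: "real_polynomial_function g" "\<And>x. x \<in> {0..1} \<Longrightarrow> \<bar>f x - g x\<bar> < e"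
      using Stone_Weierstrass_real_polynomial_function[of "{0..1}" f e] f e by auto
    then obtain c n where c: "g = (\<lambda>x. \<Sum>i\<le>n. c i * x ^ i)"
      using real_polynomial_function_iff_sum by auto
    have g_cont: "continuous_on {0..1} g"
      unfolding c by (intro continuous_intros)
    have int: "(\<integral>x. g x \<partial>K) = (\<Sum>i\<le>n. c i * (\<integral>x. x ^ i \<partial>K))" if "K \<in> unit_measures" for K
    proof -
      have "integrable K (\<lambda>x. c i * x ^ i)" for i
        by (intro unit_measures_integrable[OF that] continuous_intros)
      then show ?thesis
        unfolding c by (subst Bochner_Integration.integral_sum) auto
    qed
    have close: "\<bar>(\<integral>x. f x \<partial>K) - (\<integral>x. g x \<partial>K)\<bar> \<le> e * measure K {0..1}" if "K \<in> unit_measures" for K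
    proof -
      have "(\<integral>x. f x \<partial>K) - (\<integral>x. g x \<partial>K) = (\<integral>x. f x - g x \<partial>K)"
        by (intro Bochner_Integration.integral_diff[symmetric] unit_measures_integrable that f g_cont)
      then show ?thesis
        using unit_measures_integral_bound[OF that, of "\<lambda>x. f x - g x" e] f g_cont g(2)
        by (simp add: continuous_on_diff less_imp_le)
    qed
    have "(\<integral>x. g x \<partial>M) = (\<integral>x. g x \<partial>N)"
      by (simp add: int MN eq)
    then show ?thesis
      using close[OF MN(1)] close[OF MN(2)] by (simp add: m_def algebra_simps)
  qed
  moreover have "m \<ge> 0" by (simp add: m_def)
  \<comment> \<open>The bound is used with \<open>e / (m + 1)\<close>; the added 1 keeps the
    denominator positive when \<open>m = 0\<close>.\<close>
  ultimately have "\<bar>(\<integral>x. f x \<partial>M) - (\<integral>x. f x \<partial>N)\<bar> \<le> 0 + e" if "e > 0" for e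
    using that[THEN divide_pos_pos, of "m + 1"]
    by (smt (verit, best) mult.commute mult_left_mono nonzero_mult_div_cancel_left pos_divide_le_eq
        divide_pos_pos times_divide_eq_right)
  then show ?thesis
    using field_le_epsilon[of "\<bar>(\<integral>x. f x \<partial>M) - (\<integral>x. f x \<partial>N)\<bar>" 0] by simp
qed

text \<open>Moments determine the integrals of \<open>cos (t * x)\<close> and
  \<open>sin (t * x)\<close>, hence the characteristic function. The measures are pushed forward to
  the line, where uniqueness for characteristic functions applies, and their values are read off
  from the push-forwards.\<close>

lemma unit_measures_eq_if_same_moments_prob:
  assumes MN: "M \<in> unit_measures" "N \<in> unit_measures" and one: "measure M {0..1} = 1" "measure N {0..1} = 1"
    and eq: "\<And>k. (\<integral>x. x ^ k \<partial>M) = (\<integral>x. x ^ k \<partial>N)"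
  shows "M = N"
proof -
  define E where "E K = distr K borel (\<lambda>x. x)" for K :: "real measure"
  have id: "(\<lambda>x. x) \<in> measurable K borel" if "K \<in> unit_measures" for K :: "real measure"
    by (intro unit_measures_measurable[OF that] continuous_intros)
  have E_emeasure: "emeasure (E K) A = ennreal (measure K (A \<inter> {0..1}))"
    if "K \<in> unit_measures" "A \<in> sets borel" for K A
    using that id[OF that(1)]
    by (simp add: E_def emeasure_distr unit_measures_space unit_measures_emeasure)
  have E_char: "char (E K) t = (\<integral>x. iexp (t * x) \<partial>K)" if "K \<in> unit_measures" for K t
    using id[OF that] unfolding char_def E_def by (subst integral_distr) auto
  have E_real: "real_distribution (E K)" if K: "K \<in> unit_measures" "measure K {0..1} = 1" for K
  proof -
    have "prob_space (E K)"
      by (rule prob_spaceI) (use E_emeasure[OF K(1), of UNIV] K(2) in \<open>simp add: E_def\<close>)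
    then show ?thesis
      by (simp add: real_distribution_def real_distribution_axioms_def E_def)
  qed
  have "(\<integral>x. iexp (t * x) \<partial>M) = (\<integral>x. iexp (t * x) \<partial>N)" for t
  proof -
    have i: "(\<integral>x. iexp (t * x) \<partial>K) = Complex (\<integral>x. cos (t * x) \<partial>K) (\<integral>x. sin (t * x) \<partial>K)"
      if "K \<in> unit_measures" for K
    proof -
      have int: "integrable K (\<lambda>x. iexp (t * x))"
        by (intro unit_measures_integrable[OF that] continuous_intros)
      show ?thesis
        using integral_Re[OF int] integral_Im[OF int]
        by (simp add: complex_eq_iff Re_exp Im_exp)
    qed
    have "(\<integral>x. cos (t * x) \<partial>M) = (\<integral>x. cos (t * x) \<partial>N)" "(\<integral>x. sin (t * x) \<partial>M) = (\<integral>x. sin (t * x) \<partial>N)"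
      by (intro unit_integral_eq_if_same_moments[OF MN eq] continuous_intros)+
    then show ?thesis by (simp only: i[OF MN(1)] i[OF MN(2)])
  qed
  then have "char (E M) = char (E N)"
    by (simp add: fun_eq_iff E_char[OF MN(1)] E_char[OF MN(2)])
  then have EE: "E M = E N"
    using one MN by (intro Levy_uniqueness E_real) auto
  show ?thesis
  proof (rule unit_measures_eqI[OF MN])
    fix A assume A: "A \<in> unit_borel"
    then have "A \<in> sets borel" "A \<inter> {0..1} = A"
      by (auto simp: sets_restrict_space)
    then have "ennreal (measure M A) = ennreal (measure N A)"
      using E_emeasure[of M A] E_emeasure[of N A] MN EE by simp
    then show "measure M A = measure N A" by simp
  qed
qed

text \<open>Reduction to mass 1: the zeroth moment is the common mass \<open>c\<close>, by which
  both measures are divided; for \<open>c = 0\<close> both vanish.\<close>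

lemma unit_measures_eq_if_same_moments:
  assumes MN: "M \<in> unit_measures" "N \<in> unit_measures"
    and eq: "\<And>k. (\<integral>x. x ^ k \<partial>M) = (\<integral>x. x ^ k \<partial>N)"
  shows "M = N"
proof -
  define c where "c = measure M {0..1}"
  have c: "measure M {0..1} = c" "measure N {0..1} = c"
    using eq[of 0] MN by (simp_all only: c_def measure_space_eq_moment_0)
  show ?thesis
  proof (cases "c = 0")
    case True
    have "measure K A = 0" if "K \<in> unit_measures" "measure K {0..1} = c" for K A
      using finite_measure.bounded_measure[OF unit_measures_finite[OF that(1)], of A] that True
      by (simp add: unit_measures_space order_antisym)
    then show ?thesis using c by (intro unit_measures_eqI MN) (simp add: MN)
  next
    case False
    then have c0: "1 / c \<ge> 0" by (simp add: c_def)
    obtain M' where M': "M' \<in> unit_measures"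
        "\<And>A. A \<in> unit_borel \<Longrightarrow> measure M' A = 1 / c * measure M A"
      using unit_measures_scale[OF MN(1) c0] by blast
    obtain N' where N': "N' \<in> unit_measures"
        "\<And>A. A \<in> unit_borel \<Longrightarrow> measure N' A = 1 / c * measure N A"
      using unit_measures_scale[OF MN(2) c0] by blast
    have "M' = N'"
    proof (rule unit_measures_eq_if_same_moments_prob[OF M'(1) N'(1)])
      show "measure M' {0..1} = 1" "measure N' {0..1} = 1"
        using M'(2)[OF unit_interval_borel] N'(2)[OF unit_interval_borel] False c by simp_all
      show "(\<integral>x. x ^ k \<partial>M') = (\<integral>x. x ^ k \<partial>N')" for k
        using integral_lincomb[OF MN(1) MN(1) M'(1) c0 order_refl, of "\<lambda>x. x ^ k"]
          integral_lincomb[OF MN(2) MN(2) N'(1) c0 order_refl, of "\<lambda>x. x ^ k"]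
        by (simp add: M'(2) N'(2) eq continuous_intros)
    qed
    then show ?thesis
      using M'(2) N'(2) False by (intro unit_measures_eqI[OF MN]) (metis divide_eq_0_iff mult_left_cancel zero_neq_one)
  qed
qed

subsection \<open>The Hausdorff moment problem for exchangeable weights\<close>

text \<open>Truncated subtraction makes the formula valid for \<open>k > K\<close> as well: the
  factor with \<open>i = K\<close> is then 0.\<close>

lemma binomial_prod_nat_diff:
  "real (K choose k) = (\<Prod>i\<in>{0..<k}. real (K - i) / real (k - i))"
proof (cases "k \<le> K")
  case False
  then have "(\<Prod>i\<in>{0..<k}. real (K - i) / real (k - i)) = 0"
    by (intro prod_zero bexI[of _ K]) auto
  then show ?thesis using False by (simp add: binomial_eq_0)
qed (rule binomial_altdef_of_nat)

lemma binomial_ratio: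
  assumes "k \<le> N"
  shows "real (K choose k) / real (N choose k) = (\<Prod>i\<in>{0..<k}. real (K - i) / real (N - i))"
proof -
  have "real (K choose k) / real (N choose k)
      = (\<Prod>i\<in>{0..<k}. (real (K - i) / real (k - i)) / (real (N - i) / real (k - i)))"
    unfolding binomial_prod_nat_diff by (rule prod_dividef[symmetric])
  also have "\<dots> = (\<Prod>i\<in>{0..<k}. real (K - i) / real (N - i))"
    by (intro prod.cong) auto
  finally show ?thesis .
qed

text \<open>Draw \<open>k\<close> of \<open>N\<close> elements, \<open>K\<close> of them marked. All
  are marked with probability equal to the binomial ratio without replacement, and
  \<open>(K / N) ^ k\<close> with replacement. Both are products of \<open>k\<close> numbers in
  \<open>[0, 1]\<close>, so they differ at most by the sum of the differences of the factors, each
  at most \<open>k / (N - k)\<close>.\<close>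

lemma binomial_ratio_approx:
  assumes "K \<le> N" "k < N"
  shows "\<bar>real (K choose k) / real (N choose k) - (real K / real N) ^ k\<bar> \<le> real k * (real k / real (N - k))"
proof -
  have le1: "real (K - i) / real (N - i) \<le> 1" for i
    using assms by (cases "N - i = 0") (auto simp: divide_le_eq_1)
  have le1': "real K / real N \<le> 1"
    using assms by simp
  have diff: "\<bar>real (K - i) / real (N - i) - real K / real N\<bar> \<le> real k / real (N - k)" if "i < k" for i
  proof (cases "i \<le> K")
    case True
    have pos: "real (N - i) > 0" "real N > 0" "real (N - k) > 0" using that assms by auto
    have "real (K - i) = real K - real i" "real (N - i) = real N - real i"
      using True assms that by (auto simp: of_nat_diff)
    then have eq: "real K / real N - real (K - i) / real (N - i)
        = real i * (real N - real K) / (real N * real (N - i))"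
      using pos by (simp add: field_simps)
    have "0 \<le> real i * (real N - real K) / (real N * real (N - i))"
      using assms by simp
    then have nonneg: "0 \<le> real K / real N - real (K - i) / real (N - i)"
      by (simp only: eq)
    have "real K / real N - real (K - i) / real (N - i) \<le> real i * real N / (real N * real (N - i))"
      unfolding eq by (intro divide_right_mono mult_left_mono) auto
    also have "\<dots> = real i / real (N - i)"
      using pos by simp
    also have "\<dots> \<le> real k / real (N - k)"
      using that assms pos by (intro frac_le) auto
    finally show ?thesis
      unfolding abs_minus_commute[of "real (K - i) / real (N - i)"] abs_of_nonneg[OF nonneg] .
  next
    case False
    \<comment> \<open>Here the truncated factor is 0, and \<open>K < i < k\<close> bounds the other
      one.\<close>
    have "real K / real N \<le> real k / real (N - k)"
      using that assms False by (intro frac_le) auto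
    then show ?thesis using False by simp
  qed
  have "\<bar>(\<Prod>i\<in>{0..<k}. real (K - i) / real (N - i)) - (\<Prod>i\<in>{0..<k}. real K / real N)\<bar>
      \<le> (\<Sum>i\<in>{0..<k}. \<bar>real (K - i) / real (N - i) - real K / real N\<bar>)"
    using norm_prod_diff[of "{0..<k}" "\<lambda>i. real (K - i) / real (N - i)" "\<lambda>i. real K / real N"] le1 le1'
    by simp
  also have "\<dots> \<le> (\<Sum>i\<in>{0..<k}. real k / real (N - k))"
    using diff by (intro sum_mono) auto
  finally show ?thesis
    using assms by (simp add: binomial_ratio)
qed

context
  fixes m :: "nat \<Rightarrow> real" and p :: "nat \<Rightarrow> nat set \<Rightarrow> real"
  assumes nonneg: "\<And>N s. 0 \<le> p N s"
    and marginal: "\<And>N J. J \<subseteq> {..<N} \<Longrightarrow> (\<Sum>s\<in>Pow {..<N}. p N s * (if J \<subseteq> s then 1 else 0)) = m (card J)"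
    and m0: "m 0 = 1"
begin

lemma total_weight: "(\<Sum>s\<in>Pow {..<N}. p N s) = 1"
  using marginal[of "{}" N] m0 by simp

text \<open>\<open>p N s\<close> is the probability that \<open>s\<close> is the set of occupied
  modes among the first \<open>N\<close>. Double counting the pairs \<open>J \<subseteq> s\<close>
  with \<open>card J = k\<close> turns the \<open>N choose k\<close> equal marginals into an average
  that depends on \<open>card s\<close> only.\<close>

lemma factorial_moment:
  assumes "k \<le> N"
  shows "(\<Sum>s\<in>Pow {..<N}. p N s * (real (card s choose k) / real (N choose k))) = m k"
proof -
  let ?J = "{J. J \<subseteq> {..<N} \<and> card J = k}"
  have fin: "finite ?J" by (rule finite_subset[of _ "Pow {..<N}"]) auto
  have "real (N choose k) * m k = (\<Sum>J\<in>?J. m k)"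
    using n_subsets[of "{..<N}" k] by simp
  also have "\<dots> = (\<Sum>J\<in>?J. \<Sum>s\<in>Pow {..<N}. p N s * (if J \<subseteq> s then 1 else 0))"
    by (intro sum.cong) (auto simp: marginal)
  also have "\<dots> = (\<Sum>s\<in>Pow {..<N}. \<Sum>J\<in>?J. p N s * (if J \<subseteq> s then 1 else 0))"
    by (rule sum.swap)
  also have "\<dots> = (\<Sum>s\<in>Pow {..<N}. p N s * real (card s choose k))"
  proof (rule sum.cong)
    fix s assume s: "s \<in> Pow {..<N}"
    then have "finite s" by (auto intro: finite_subset)
    have "(\<Sum>J\<in>?J. if J \<subseteq> s then 1 else 0) = real (card {J \<in> ?J. J \<subseteq> s})"
      using fin by (simp add: sum.inter_filter[symmetric])
    also have "{J \<in> ?J. J \<subseteq> s} = {J. J \<subseteq> s \<and> card J = k}"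
      using s by auto
    also have "real (card \<dots>) = real (card s choose k)"
      using \<open>finite s\<close> by (simp add: n_subsets)
    finally show "(\<Sum>J\<in>?J. p N s * (if J \<subseteq> s then 1 else 0)) = p N s * real (card s choose k)"
      by (simp flip: sum_distrib_left)
  qed simp
  finally have "real (N choose k) * m k = (\<Sum>s\<in>Pow {..<N}. p N s * real (card s choose k))" .
  moreover have "real (N choose k) > 0" using assms by simp
  ultimately show ?thesis
    by (simp add: field_simps flip: sum_divide_distrib)
qed

lemma moment_approx:
  assumes "k < N"
  shows "\<bar>(\<Sum>s\<in>Pow {..<N}. p N s * (real (card s) / real N) ^ k) - m k\<bar> \<le> real k * (real k / real (N - k))"
proof -
  have "(\<Sum>s\<in>Pow {..<N}. p N s * (real (card s) / real N) ^ k) - m k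
      = (\<Sum>s\<in>Pow {..<N}. p N s * ((real (card s) / real N) ^ k - real (card s choose k) / real (N choose k)))"
    using factorial_moment[of k N] assms by (simp add: right_diff_distrib sum_subtractf)
  also have "\<bar>\<dots>\<bar> \<le> (\<Sum>s\<in>Pow {..<N}. p N s * (real k * (real k / real (N - k))))"
  proof (intro order_trans[OF sum_abs] sum_mono)
    fix s assume "s \<in> Pow {..<N}"
    then have "card s \<le> N"
      using card_mono[of "{..<N}" s] by auto
    then have "\<bar>(real (card s) / real N) ^ k - real (card s choose k) / real (N choose k)\<bar> \<le> real k * (real k / real (N - k))"
      using binomial_ratio_approx[of "card s" N k] assms by (simp add: abs_minus_commute)
    then show "\<bar>p N s * ((real (card s) / real N) ^ k - real (card s choose k) / real (N choose k))\<bar>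
        \<le> p N s * (real k * (real k / real (N - k)))"
      using nonneg by (simp only: abs_mult abs_of_nonneg mult_left_mono)
  qed
  also have "\<dots> = real k * (real k / real (N - k))"
    using total_weight by (simp only: sum_distrib_right[symmetric] mult_1)
  finally show ?thesis .
qed

text \<open>The law of the fraction of occupied modes among the first \<open>n + 1\<close>; the
  shift avoids division by 0. It lives on the whole line, where tightness yields weakly convergent
  subsequences.\<close>

definition empirical :: "nat \<Rightarrow> real measure" where
  "empirical n = distr (point_measure (Pow {..<Suc n}) (\<lambda>s. ennreal (p (Suc n) s))) borel
     (\<lambda>s. real (card s) / real (Suc n))"

lemma empirical_integral:
  fixes f :: "real \<Rightarrow> real"
  assumes "f \<in> borel_measurable borel"
  shows "(\<integral>x. f x \<partial>empirical n) = (\<Sum>s\<in>Pow {..<Suc n}. p (Suc n) s * f (real (card s) / real (Suc n)))"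
proof -
  have "(\<integral>x. f x \<partial>empirical n)
      = (\<integral>s. f (real (card s) / real (Suc n)) \<partial>point_measure (Pow {..<Suc n}) (\<lambda>s. ennreal (p (Suc n) s)))"
    unfolding empirical_def by (rule integral_distr) (use assms in auto)
  also have "\<dots> = (\<Sum>s\<in>Pow {..<Suc n}. p (Suc n) s * f (real (card s) / real (Suc n)))"
    using nonneg by (subst lebesgue_integral_point_measure_finite) auto
  finally show ?thesis .
qed

lemma empirical_distribution: "real_distribution (empirical n)"
proof -
  have "emeasure (empirical n) (space (empirical n)) = (\<Sum>s\<in>Pow {..<Suc n}. ennreal (p (Suc n) s))"
    unfolding empirical_def
    by (simp add: emeasure_distr space_point_measure emeasure_point_measure_finite del: lessThan_Suc)
  also have "\<dots> = 1"
    using nonneg total_weight[of "Suc n"] by (simp add: sum_ennreal del: lessThan_Suc)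
  finally have "prob_space (empirical n)" by (rule prob_spaceI)
  then show ?thesis
    by (simp add: real_distribution_def real_distribution_axioms_def empirical_def)
qed

lemma card_ratio: "s \<in> Pow {..<Suc n} \<Longrightarrow> real (card s) / real (Suc n) \<in> {0..1}"
  using card_mono[of "{..<Suc n}" s] by (auto simp del: lessThan_Suc)

lemma empirical_tight: "tight empirical"
  unfolding tight_def
proof (intro conjI allI impI)
  fix e :: real assume "e > 0"
  \<comment> \<open>Tightness asks for intervals open on the left; the end point -1 keeps 0
    inside.\<close>
  have "measure (empirical n) {-1<..1} = 1" for n
  proof -
    interpret real_distribution "empirical n" by (rule empirical_distribution)
    have "measure (empirical n) {-1<..1} = (\<integral>x. indicator {-1<..1} x \<partial>empirical n)"
      by simp
    also have "\<dots> = (\<Sum>s\<in>Pow {..<Suc n}. p (Suc n) s * indicator {-1<..1} (real (card s) / real (Suc n)))"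
      by (rule empirical_integral) simp
    also have "\<dots> = (\<Sum>s\<in>Pow {..<Suc n}. p (Suc n) s)"
    proof (rule sum.cong)
      fix s assume "s \<in> Pow {..<Suc n}"
      from card_ratio[OF this] have "real (card s) / real (Suc n) \<in> {-1<..1}"
        unfolding atLeastAtMost_iff greaterThanAtMost_iff by linarith
      then show "p (Suc n) s * indicator {-1<..1} (real (card s) / real (Suc n)) = p (Suc n) s"
        by (simp only: indicator_simps mult_1_right)
    qed simp
    finally show ?thesis by (simp only: total_weight)
  qed
  then show "\<exists>a b. a < b \<and> (\<forall>n. 1 - e < measure (empirical n) {a<..b})"
    using \<open>e > 0\<close> by (intro exI[of _ "-1"] exI[of _ 1]) simp
qed (rule empirical_distribution)

text \<open>Weak convergence tests against bounded continuous functions on the line. Clamping makes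
  the powers bounded and leaves them unchanged at the possible fractions. The offset by
  \<open>k\<close> makes the number of modes exceed \<open>k\<close>, as
  \<open>moment_approx\<close> requires.\<close>

lemma clamped_moment_limit:
  "(\<lambda>n. \<integral>x. (max 0 (min 1 x)) ^ k \<partial>empirical n) \<longlonglongrightarrow> m k"
proof (rule LIMSEQ_offset[of _ k], rule LIM_zero_cancel, rule tendsto_rabs_zero_cancel)
  have "(\<lambda>n. \<bar>(\<integral>x. (max 0 (min 1 x)) ^ k \<partial>empirical (n + k)) - m k\<bar>) \<longlonglongrightarrow> 0"
  proof (rule tendsto_sandwich[of "\<lambda>_. 0"])
    show "\<forall>\<^sub>F n in sequentially. \<bar>(\<integral>x. (max 0 (min 1 x)) ^ k \<partial>empirical (n + k)) - m k\<bar>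
        \<le> real k * (real k / real (Suc n))"
    proof (intro always_eventually allI)
      fix n
      have "(\<integral>x. (max 0 (min 1 x)) ^ k \<partial>empirical (n + k))
          = (\<Sum>s\<in>Pow {..<Suc (n + k)}. p (Suc (n + k)) s * (max 0 (min 1 (real (card s) / real (Suc (n + k))))) ^ k)"
        by (rule empirical_integral) measurable
      also have "\<dots> = (\<Sum>s\<in>Pow {..<Suc (n + k)}. p (Suc (n + k)) s * (real (card s) / real (Suc (n + k))) ^ k)"
      proof (rule sum.cong)
        fix s assume "s \<in> Pow {..<Suc (n + k)}"
        from card_ratio[OF this]
        have "max 0 (min 1 (real (card s) / real (Suc (n + k)))) = real (card s) / real (Suc (n + k))"
          by (simp only: atLeastAtMost_iff max_def min_def) simp
        then show "p (Suc (n + k)) s * (max 0 (min 1 (real (card s) / real (Suc (n + k))))) ^ k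
            = p (Suc (n + k)) s * (real (card s) / real (Suc (n + k))) ^ k"
          by (simp only:)
      qed simp
      finally show "\<bar>(\<integral>x. (max 0 (min 1 x)) ^ k \<partial>empirical (n + k)) - m k\<bar> \<le> real k * (real k / real (Suc n))"
        using moment_approx[of k "Suc (n + k)"] by (simp only:) simp
    qed
    have "(\<lambda>n. real k * real k * inverse (real (Suc n))) \<longlonglongrightarrow> real k * real k * 0"
      by (intro tendsto_intros LIMSEQ_inverse_real_of_nat)
    then show "(\<lambda>n. real k * (real k / real (Suc n))) \<longlonglongrightarrow> 0"
      by (simp add: divide_inverse mult.assoc)
  qed simp_all
  then show "(\<lambda>n. \<bar>(\<integral>x. (max 0 (min 1 x)) ^ k \<partial>empirical (n + k)) - m k\<bar>) \<longlonglongrightarrow> 0" .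
qed

lemma hausdorff_moments:
  obtains M where "M \<in> interval_probs 0 1" "\<And>k. (\<integral>x. x ^ k \<partial>M) = m k"
proof -
  obtain r M where r: "strict_mono (r :: nat \<Rightarrow> nat)" and M: "real_distribution M"
      and conv: "weak_conv_m (empirical \<circ> id \<circ> r) M"
    using tight_imp_convergent_subsubsequence[OF empirical_tight, of id] by (auto simp: strict_mono_id)
  interpret M: real_distribution M by fact
  let ?c = "\<lambda>x::real. max 0 (min 1 x)"
  have lim: "(\<lambda>n. \<integral>x. f x \<partial>empirical (r n)) \<longlonglongrightarrow> (\<integral>x. f x \<partial>M)"
    if "\<And>x. isCont f x" "\<And>x. norm (f x) \<le> B" for f :: "real \<Rightarrow> real" and B
    using weak_conv_imp_integral_bdd_continuous_conv[OF _ M conv that] empirical_distribution by simp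
  have clamp: "(\<integral>x. ?c x ^ k \<partial>M) = m k" for k
  proof (rule LIMSEQ_unique)
    show "(\<lambda>n. \<integral>x. ?c x ^ k \<partial>empirical (r n)) \<longlonglongrightarrow> (\<integral>x. ?c x ^ k \<partial>M)"
      by (rule lim[of _ 1]) (auto intro!: continuous_intros power_le_one simp: norm_power)
    show "(\<lambda>n. \<integral>x. ?c x ^ k \<partial>empirical (r n)) \<longlonglongrightarrow> m k"
      using LIMSEQ_subseq_LIMSEQ[OF clamped_moment_limit r, of k] by (simp add: comp_def)
  qed
  \<comment> \<open>The bounded continuous function \<open>?h\<close> vanishes exactly on
    \<open>[0, 1]\<close>. Its integral is 0 for every empirical law, hence in the limit, so
    \<open>M\<close> is carried by the interval.\<close>
  have "AE x in M. x \<in> {0..1}"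
  proof -
    let ?h = "\<lambda>x. min 1 \<bar>x - ?c x\<bar>"
    have h: "?h \<in> borel_measurable borel" by measurable
    have "(\<integral>x. ?h x \<partial>empirical n) = 0" for n
    proof -
      have "?h x = 0" if "x \<in> {0..1}" for x
        using that by auto
      then have "(\<Sum>s\<in>Pow {..<Suc n}. p (Suc n) s * ?h (real (card s) / real (Suc n))) = 0"
        using card_ratio by (intro sum.neutral ballI) (metis mult_zero_right)
      then show ?thesis by (simp only: empirical_integral[OF h])
    qed
    moreover have "(\<lambda>n. \<integral>x. ?h x \<partial>empirical (r n)) \<longlonglongrightarrow> (\<integral>x. ?h x \<partial>M)"
      by (rule lim[of _ 1]) (auto intro!: continuous_intros)
    ultimately have "(\<integral>x. ?h x \<partial>M) = 0"
      by (simp add: LIMSEQ_const_iff)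
    moreover have "integrable M ?h"
      by (rule M.integrable_const_bound[of _ 1]) (use h in auto)
    ultimately have "AE x in M. ?h x = 0"
      by (subst (asm) integral_nonneg_eq_0_iff_AE) auto
    then show ?thesis
      by (rule AE_mp) (auto intro!: AE_I2 simp: min_def max_def split: if_splits)
  qed
  note ae = this
  define L where "L = restrict_space M {0..1}"
  have "prob_space L"
    unfolding L_def
  proof (rule prob_space_restrict_space)
    show "emeasure M {0..1} = 1"
      using ae M.prob_eq_1[of "{0..1}"] by (simp add: M.emeasure_eq_measure)
  qed simp
  then have "L \<in> interval_probs 0 1"
    by (simp add: interval_probs_def L_def sets_restrict_space)
  moreover have "(\<integral>x. x ^ k \<partial>L) = m k" for k
  proof -
    have "(\<integral>x. x ^ k \<partial>L) = (\<integral>x. indicator {0..1} x *\<^sub>R x ^ k \<partial>M)"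
      unfolding L_def by (rule integral_restrict_space) simp
    also have "\<dots> = (\<integral>x. ?c x ^ k \<partial>M)"
      using ae by (intro integral_cong_AE) auto
    finally show ?thesis by (simp add: clamp)
  qed
  ultimately show ?thesis by (rule that)
qed

end

section \<open>Barycentres of product states\<close>

lemma integral_lincomb_complex:
  fixes f :: "real \<Rightarrow> complex"
  assumes MNL: "M \<in> unit_measures" "N \<in> unit_measures" "L \<in> unit_measures" and st: "s \<ge> 0" "t \<ge> 0"
    and eq: "\<And>A. A \<in> unit_borel \<Longrightarrow> measure L A = s * measure M A + t * measure N A"
    and f: "continuous_on {0..1} f"
  shows "(\<integral>x. f x \<partial>L) = s *\<^sub>R (\<integral>x. f x \<partial>M) + t *\<^sub>R (\<integral>x. f x \<partial>N)"
proof -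
  have Re: "(\<integral>x. Re (f x) \<partial>L) = s * (\<integral>x. Re (f x) \<partial>M) + t * (\<integral>x. Re (f x) \<partial>N)"
    by (intro integral_lincomb[OF MNL st eq] continuous_intros f)
  have Im: "(\<integral>x. Im (f x) \<partial>L) = s * (\<integral>x. Im (f x) \<partial>M) + t * (\<integral>x. Im (f x) \<partial>N)"
    by (intro integral_lincomb[OF MNL st eq] continuous_intros f)
  have "integrable K f" if "K \<in> unit_measures" for K
    by (rule unit_measures_integrable[OF that f])
  then have "integrable M f" "integrable N f" "integrable L f"
    using MNL by auto
  then show ?thesis
    using Re Im by (simp add: complex_eq_iff)
qed

lemma unit_borel_subset: "A \<in> unit_borel \<Longrightarrow> A \<subseteq> {0..1}"
  using sets.sets_into_space[of A "restrict_space borel {0..1::real}"] by (simp add: space_restrict_space)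

lemma interval_probs_iff: "M \<in> interval_probs 0 1 \<longleftrightarrow> M \<in> unit_measures \<and> measure M {0..1} = 1"
proof
  assume M: "M \<in> interval_probs 0 1"
  then have "M \<in> unit_measures" by (rule interval_probs_unit_measures)
  moreover have "measure M (space M) = 1"
    using M by (simp add: interval_probs_def prob_space.prob_space)
  ultimately show "M \<in> unit_measures \<and> measure M {0..1} = 1"
    by (simp add: unit_measures_space)
next
  assume M: "M \<in> unit_measures \<and> measure M {0..1} = 1"
  then have "emeasure M (space M) = 1"
    by (simp add: unit_measures_space unit_measures_emeasure)
  then show "M \<in> interval_probs 0 1"
    using M by (auto simp: interval_probs_def unit_measures_sets intro: prob_spaceI)
qed

lemma unit_measures_lincomb:
  assumes MN: "M \<in> unit_measures" "N \<in> unit_measures" and st: "s \<ge> 0" "t \<ge> 0"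
  obtains L where "L \<in> unit_measures"
    "\<And>A. A \<in> unit_borel \<Longrightarrow> measure L A = s * measure M A + t * measure N A"
proof -
  obtain M' where M': "M' \<in> unit_measures" "\<And>A. A \<in> unit_borel \<Longrightarrow> measure M' A = s * measure M A"
    using unit_measures_scale[OF MN(1) st(1)] by blast
  obtain N' where N': "N' \<in> unit_measures" "\<And>A. A \<in> unit_borel \<Longrightarrow> measure N' A = t * measure N A"
    using unit_measures_scale[OF MN(2) st(2)] by blast
  obtain L where "L \<in> unit_measures" "\<And>A. A \<in> unit_borel \<Longrightarrow> measure L A = measure M' A + measure N' A"
    using unit_measures_add[OF M'(1) N'(1)] by blast
  then show ?thesis using M'(2) N'(2) by (intro that[of L]) auto
qed

lemma unit_measures_split:
  assumes "M \<in> unit_measures" "A \<in> unit_borel" "Y \<in> unit_borel"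
  shows "measure M A = measure M (A \<inter> Y) + measure M (A \<inter> ({0..1} - Y))"
proof -
  have "A \<inter> Y \<in> sets M" "A \<inter> ({0..1} - Y) \<in> sets M"
    using assms unit_interval_borel by (auto simp: unit_measures_sets)
  then have "measure M (A \<inter> Y \<union> A \<inter> ({0..1} - Y)) = measure M (A \<inter> Y) + measure M (A \<inter> ({0..1} - Y))"
    using finite_measure.finite_measure_Union[OF unit_measures_finite[OF assms(1)]] by blast
  moreover have "A \<inter> Y \<union> A \<inter> ({0..1} - Y) = A"
    using unit_borel_subset[OF assms(2)] by auto
  ultimately show ?thesis by simp
qed

lemma unit_measures_hahn:
  assumes MN: "M \<in> unit_measures" "N \<in> unit_measures"
  obtains Y where "Y \<in> unit_borel"
    "\<And>A. A \<in> unit_borel \<Longrightarrow> measure N (A \<inter> Y) \<le> measure M (A \<inter> Y)"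
    "\<And>A. A \<in> unit_borel \<Longrightarrow> measure M (A \<inter> ({0..1} - Y)) \<le> measure N (A \<inter> ({0..1} - Y))"
proof -
  have "sets N = sets M" using MN by (simp add: unit_measures_sets)
  from finite_unsigned_Hahn_decomposition[OF unit_measures_finite[OF MN(1)] unit_measures_finite[OF MN(2)] this]
  obtain Y where Y: "Y \<in> unit_borel" "\<And>X. X \<in> unit_borel \<Longrightarrow> X \<subseteq> Y \<Longrightarrow> emeasure N X \<le> emeasure M X"
    "\<And>X. X \<in> unit_borel \<Longrightarrow> X \<inter> Y = {} \<Longrightarrow> emeasure M X \<le> emeasure N X"
    using MN by (auto simp: unit_measures_sets)
  show ?thesis
  proof (rule that[OF Y(1)])
    fix A assume A: "A \<in> unit_borel"
    show "measure N (A \<inter> Y) \<le> measure M (A \<inter> Y)"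
      using Y(2)[of "A \<inter> Y"] A Y(1) MN by (simp add: unit_measures_emeasure sets.Int)
    have "A \<inter> ({0..1} - Y) \<in> unit_borel"
      using A Y(1) unit_interval_borel by (intro sets.Int sets.Diff)
    then show "measure M (A \<inter> ({0..1} - Y)) \<le> measure N (A \<inter> ({0..1} - Y))"
      using Y(3)[of "A \<inter> ({0..1} - Y)"] MN by (auto simp: unit_measures_emeasure)
  qed
qed

text \<open>The nonnegative function \<open>(x - c) ^ 2\<close> has integral 0, so \<open>x\<close>
  is almost everywhere the constant \<open>c\<close>.\<close>

lemma zero_variance_moments:
  assumes M: "M \<in> interval_probs 0 1" and var: "(\<integral>x. x ^ 2 \<partial>M) = (\<integral>x. x \<partial>M) ^ 2"
  shows "(\<integral>x. x ^ k \<partial>M) = (\<integral>x. x \<partial>M) ^ k"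
proof -
  have U: "M \<in> unit_measures" using M by (rule interval_probs_unit_measures)
  interpret prob_space M using M by (simp add: interval_probs_def)
  define c where "c = (\<integral>x. x \<partial>M)"
  have int: "integrable M f" if "continuous_on {0..1} f" for f :: "real \<Rightarrow> real"
    by (rule unit_measures_integrable[OF U that])
  have "(\<integral>x. (x - c) ^ 2 \<partial>M) = (\<integral>x. x ^ 2 - 2 * c * x + c ^ 2 \<partial>M)"
    by (simp add: power2_diff algebra_simps)
  also have "\<dots> = (\<integral>x. x ^ 2 \<partial>M) - 2 * c * c + c ^ 2"
    using int[of "\<lambda>x. x ^ 2"] int[of "\<lambda>x. x"] by (simp add: continuous_intros prob_space c_def)
  also have "\<dots> = 0"
    using var by (simp add: c_def power2_eq_square)
  finally have "(\<integral>x. (x - c) ^ 2 \<partial>M) = 0" .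
  then have "AE x in M. (x - c) ^ 2 = 0"
    by (subst (asm) integral_nonneg_eq_0_iff_AE) (auto intro!: int continuous_intros)
  then have ae: "AE x in M. x = c" by simp
  have "(\<integral>x. x ^ k \<partial>M) = (\<integral>x. c ^ k \<partial>M)"
    using ae by (intro integral_cong_AE unit_measures_measurable[OF U]) (auto intro!: continuous_intros)
  then show ?thesis by (simp add: prob_space c_def)
qed

lemma variance_nonneg:
  assumes M: "M \<in> interval_probs 0 1"
  shows "(\<integral>x. x \<partial>M) ^ 2 \<le> (\<integral>x. x ^ 2 \<partial>M)"
proof -
  have U: "M \<in> unit_measures" using M by (rule interval_probs_unit_measures)
  interpret prob_space M using M by (simp add: interval_probs_def)
  define c where "c = (\<integral>x. x \<partial>M)"
  have int: "integrable M f" if "continuous_on {0..1} f" for f :: "real \<Rightarrow> real"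
    by (rule unit_measures_integrable[OF U that])
  have "0 \<le> (\<integral>x. (x - c) ^ 2 \<partial>M)" by simp
  also have "(\<integral>x. (x - c) ^ 2 \<partial>M) = (\<integral>x. x ^ 2 - 2 * c * x + c ^ 2 \<partial>M)"
    by (simp add: power2_diff algebra_simps)
  also have "\<dots> = (\<integral>x. x ^ 2 \<partial>M) - 2 * c * c + c ^ 2"
    using int[of "\<lambda>x. x ^ 2"] int[of "\<lambda>x. x"] by (simp add: continuous_intros prob_space c_def)
  finally show ?thesis by (simp add: c_def power2_eq_square)
qed

context car_algebra
begin

definition barycentre :: "real measure \<Rightarrow> 'a \<Rightarrow> complex" where
  "barycentre M x = (\<integral>\<mu>. product_state \<mu> x \<partial>M)"

lemma barycentre_lincomb:
  assumes "M \<in> unit_measures" "N \<in> unit_measures" "L \<in> unit_measures" "s \<ge> 0" "t \<ge> 0"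
    and "\<And>A. A \<in> unit_borel \<Longrightarrow> measure L A = s * measure M A + t * measure N A"
  shows "barycentre L = s *\<^sub>R barycentre M + t *\<^sub>R barycentre N"
  using integral_lincomb_complex[OF assms continuous_product_state]
  by (simp add: barycentre_def fun_eq_iff)

text \<open>The conditions in \<open>has_moments\<close> single out no mode, so an injective
  relabelling preserves them. With uniqueness this gives the invariance of barycentres without
  evaluating the action on general elements.\<close>

lemma has_moments_automorphism:
  assumes "has_moments m \<phi>" and g: "g \<in> finitary_perms"
  shows "has_moments m (\<phi> \<circ> car_action a g)"
proof -
  note \<alpha> = car_action_automorphism[OF g] car_action_generator[OF g]
  have inj: "inj g" using g by (auto simp: finitary_perms_def bij_is_inj)
  show ?thesis
    unfolding has_moments_def comp_def
  proof (intro conjI allI impI)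
    show "\<phi> (car_action a g (y * x * z)) = 0"
      if *: "finite S \<and> j \<notin> S \<and> x \<in> letters j \<and> y \<in> modes S \<and> z \<in> modes S" for S j x y z
    proof -
      have "car_action a g y \<in> modes (g ` S)" "car_action a g z \<in> modes (g ` S)"
        using * by (auto intro: automorphism_modes[OF \<alpha>])
      moreover have "car_action a g x \<in> letters (g j)"
        using * by (intro automorphism_letters[OF \<alpha>]) auto
      moreover have "g j \<notin> g ` S" "finite (g ` S)"
        using * inj by (auto simp: inj_image_mem_iff)
      ultimately have "\<phi> (car_action a g y * car_action a g x * car_action a g z) = 0"
        using assms(1) unfolding has_moments_def by metis
      then show ?thesis
        using \<alpha>(1) by (simp add: cstar_automorphism_def)
    qed
    show "\<phi> (car_action a g (diag js)) = m (length js)" if "distinct js" for js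
    proof -
      have "distinct (map g js)"
        using that inj by (simp add: distinct_map inj_on_subset[OF inj])
      then show ?thesis
        using assms(1) unfolding has_moments_def automorphism_diag[OF \<alpha>] by (metis length_map)
    qed
  qed (use assms(1) \<alpha>(1) in \<open>auto simp: has_moments_def cstar_automorphism_def\<close>)
qed

lemma dual_automorphism:
  assumes \<phi>: "\<phi> \<in> cstar_dual" and \<alpha>: "cstar_automorphism \<alpha>"
  shows "\<phi> \<circ> \<alpha> \<in> cstar_dual"
  using assms by (auto simp: cstar_dual_def cstar_automorphism_def) metis

context
  fixes M :: "real measure"
  assumes M: "M \<in> unit_measures"
begin

lemma product_state_integrable: "integrable M (\<lambda>\<mu>. product_state \<mu> x)"
  by (rule unit_measures_integrable[OF M continuous_product_state])

lemma unit_integral_cong: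
  "(\<And>\<mu>. \<mu> \<in> {0..1} \<Longrightarrow> f \<mu> = h \<mu>) \<Longrightarrow> (\<integral>\<mu>. f \<mu> \<partial>M) = (\<integral>\<mu>. h \<mu> \<partial>M)"
  for f h :: "real \<Rightarrow> complex"
  by (intro Bochner_Integration.integral_cong) (simp_all add: unit_measures_space[OF M])

lemma barycentre_add: "barycentre M (x + y) = barycentre M x + barycentre M y"
proof -
  have "barycentre M (x + y) = (\<integral>\<mu>. product_state \<mu> x + product_state \<mu> y \<partial>M)"
    unfolding barycentre_def
    by (rule unit_integral_cong) (use product_state_dual in \<open>auto simp: cstar_dual_def\<close>)
  then show ?thesis
    by (simp add: barycentre_def product_state_integrable)
qed

lemma barycentre_scaleC: "barycentre M (c *\<^sub>C x) = c * barycentre M x"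
proof -
  have "barycentre M (c *\<^sub>C x) = (\<integral>\<mu>. c * product_state \<mu> x \<partial>M)"
    unfolding barycentre_def
    by (rule unit_integral_cong) (use product_state_dual in \<open>auto simp: cstar_dual_def\<close>)
  then show ?thesis
    by (simp add: barycentre_def)
qed

lemma norm_barycentre_le: "cmod (barycentre M x) \<le> norm x * measure M {0..1}"
  unfolding barycentre_def
  by (rule unit_measures_integral_bound[OF M continuous_product_state norm_product_state_le])

lemma barycentre_dual: "barycentre M \<in> cstar_dual"
proof -
  have "\<exists>K. \<forall>x. cmod (barycentre M x) \<le> K * norm x"
    using norm_barycentre_le by (intro exI[of _ "measure M {0..1}"]) (simp add: mult.commute)
  then show ?thesis
    by (simp add: cstar_dual_def barycentre_add barycentre_scaleC)
qed

lemma barycentre_has_moments: "has_moments (\<lambda>k. complex_of_real (\<integral>x. x ^ k \<partial>M)) (barycentre M)"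
  unfolding has_moments_def
proof (intro conjI allI impI)
  show "barycentre M (y * x * z) = 0"
    if *: "finite S \<and> j \<notin> S \<and> x \<in> letters j \<and> y \<in> modes S \<and> z \<in> modes S" for S j x y z
  proof -
    have "product_state \<mu> (y * x * z) = 0" if "\<mu> \<in> {0..1}" for \<mu>
      using product_state_has_moments[OF that] * unfolding has_moments_def by metis
    then have "barycentre M (y * x * z) = (\<integral>\<mu>. 0 \<partial>M)"
      unfolding barycentre_def by (rule unit_integral_cong)
    then show ?thesis by simp
  qed
  show "barycentre M (diag js) = complex_of_real (\<integral>x. x ^ length js \<partial>M)" if js: "distinct js" for js
  proof -
    have "product_state \<mu> (diag js) = complex_of_real (\<mu> ^ length js)" if "\<mu> \<in> {0..1}" for \<mu>
      using product_state_has_moments[OF that] js unfolding has_moments_def by simp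
    then have "barycentre M (diag js) = (\<integral>\<mu>. complex_of_real (\<mu> ^ length js) \<partial>M)"
      unfolding barycentre_def by (rule unit_integral_cong)
    then show ?thesis by (simp only: integral_complex_of_real)
  qed
qed (simp_all add: barycentre_add barycentre_scaleC)

lemma barycentre_diag: "distinct js \<Longrightarrow> barycentre M (diag js) = complex_of_real (\<integral>x. x ^ length js \<partial>M)"
  using barycentre_has_moments by (simp add: has_moments_def)

lemma barycentre_positive: "barycentre M (star x * x) \<in> \<real> \<and> 0 \<le> Re (barycentre M (star x * x))"
proof -
  have pos: "product_state \<mu> (star x * x) \<in> \<real>" "0 \<le> Re (product_state \<mu> (star x * x))"
    if "\<mu> \<in> {0..1}" for \<mu>
    using product_state_states[OF that] by (auto simp: states_def)
  have "barycentre M (star x * x) = (\<integral>\<mu>. complex_of_real (Re (product_state \<mu> (star x * x))) \<partial>M)"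
    unfolding barycentre_def by (rule unit_integral_cong) (simp add: pos)
  then have "barycentre M (star x * x) = complex_of_real (\<integral>\<mu>. Re (product_state \<mu> (star x * x)) \<partial>M)"
    by (simp only: integral_complex_of_real)
  moreover have "0 \<le> (\<integral>\<mu>. Re (product_state \<mu> (star x * x)) \<partial>M)"
    by (rule Bochner_Integration.integral_nonneg_AE) (auto intro!: AE_I2 simp: unit_measures_space[OF M] pos)
  ultimately show ?thesis by simp
qed

lemma barycentre_invariant: "g \<in> finitary_perms \<Longrightarrow> barycentre M \<circ> car_action a g = barycentre M"
  by (intro functional_eq_if_same_moments[OF _ _ _ barycentre_has_moments] dual_automorphism
      car_action_automorphism barycentre_dual has_moments_automorphism barycentre_has_moments)

end

section \<open>Correspondence between mixing measures and symmetric states\<close>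

lemma barycentre_inj:
  assumes "M \<in> unit_measures" "N \<in> unit_measures" "barycentre M = barycentre N"
  shows "M = N"
proof (rule unit_measures_eq_if_same_moments[OF assms(1,2)])
  show "(\<integral>x. x ^ k \<partial>M) = (\<integral>x. x ^ k \<partial>N)" for k
    using barycentre_diag[OF assms(1), of "[0..<k]"] barycentre_diag[OF assms(2), of "[0..<k]"] assms(3)
    by simp
qed

lemma barycentre_symmetric_state:
  assumes "M \<in> interval_probs 0 1"
  shows "barycentre M \<in> symmetric_states a"
proof -
  have M: "M \<in> unit_measures" "measure M {0..1} = 1"
    using assms by (simp_all add: interval_probs_iff)
  have "barycentre M 1 = 1"
    using barycentre_diag[OF M(1), of "[]"] M by (simp add: unit_measures_space)
  then show ?thesis
    unfolding symmetric_states_def states_def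
    using barycentre_dual[OF M(1)] barycentre_positive[OF M(1)] barycentre_invariant[OF M(1)] by blast
qed

lemma config_sum: "(\<Sum>s\<in>Pow {..<N}. config s N) = 1"
proof (induction N)
  case (Suc N)
  have inj: "inj_on (insert N) (Pow {..<N})"
    by (auto simp: inj_on_def dest: insert_ident[THEN iffD1, rotated 2])
  have "(\<Sum>s\<in>Pow {..<Suc N}. config s (Suc N))
      = (\<Sum>s\<in>Pow {..<N}. config s (Suc N)) + (\<Sum>s\<in>insert N ` Pow {..<N}. config s (Suc N))"
    unfolding lessThan_Suc Pow_insert by (rule sum.union_disjoint) auto
  also have "(\<Sum>s\<in>insert N ` Pow {..<N}. config s (Suc N)) = (\<Sum>s\<in>Pow {..<N}. config (insert N s) (Suc N))"
    by (simp only: sum.reindex[OF inj] comp_def)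
  also have "\<dots> = (\<Sum>s\<in>Pow {..<N}. config s N * num N)"
  proof -
    have "config (insert N s) N = config s N" for s
      by (rule config_restrict) auto
    then show ?thesis by (simp add: site_def)
  qed
  also have "(\<Sum>s\<in>Pow {..<N}. config s (Suc N)) = (\<Sum>s\<in>Pow {..<N}. config s N * (1 - num N))"
    by (intro sum.cong) (auto simp: site_def)
  also have "\<dots> + (\<Sum>s\<in>Pow {..<N}. config s N * num N) = (\<Sum>s\<in>Pow {..<N}. config s N) * (1 - num N + num N)"
    by (simp only: sum_distrib_right distrib_left)
  finally show ?case by (simp add: Suc.IH)
qed simp

text \<open>The values \<open>p N s\<close> at the occupation projections are nonnegative, because a
  projection has the form \<open>star x * x\<close>. Inserting \<open>config_sum\<close> writes
  \<open>\<phi> (diag js)\<close> as the probability that all modes of \<open>js\<close> are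
  occupied, and by symmetry this depends on the number of modes only. So
  \<open>hausdorff_moments\<close> supplies a measure, and equality of moments identifies the
  functionals.\<close>

lemma symmetric_state_barycentre:
  assumes \<phi>: "\<phi> \<in> symmetric_states a"
  obtains M where "M \<in> interval_probs 0 1" "\<phi> = barycentre M"
proof -
  have dual: "\<phi> \<in> cstar_dual" and pos: "\<And>x. \<phi> (star x * x) \<in> \<real>" "\<And>x. 0 \<le> Re (\<phi> (star x * x))"
      and one: "\<phi> 1 = 1"
    using \<phi> by (auto simp: symmetric_states_def states_def)
  interpret \<phi>: bounded_linear \<phi> by (rule dual_bounded_linear[OF dual])
  define p where "p N s = Re (\<phi> (config s N))" for N s
  define m where "m k = Re (\<phi> (diag [0..<k]))" for k
  have config: "\<phi> (config s N) = complex_of_real (p N s)" "0 \<le> p N s" for N s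
    using pos[of "config s N"] by (simp_all add: p_def star_config config_idem)
  have diag: "\<phi> (diag js) = complex_of_real (\<Sum>s\<in>Pow {..<N}. p N s * (if set js \<subseteq> s then 1 else 0))"
    if "set js \<subseteq> {..<N}" for N js
  proof -
    have "diag js = (\<Sum>s\<in>Pow {..<N}. config s N) * diag js"
      by (simp only: config_sum mult_1)
    also have "\<dots> = (\<Sum>s\<in>Pow {..<N}. if set js \<subseteq> s then config s N else 0)"
      by (simp only: sum_distrib_right config_diag[OF that])
    finally have "\<phi> (diag js) = (\<Sum>s\<in>Pow {..<N}. \<phi> (if set js \<subseteq> s then config s N else 0))"
      by (simp only: \<phi>.sum)
    also have "\<dots> = (\<Sum>s\<in>Pow {..<N}. complex_of_real (p N s * (if set js \<subseteq> s then 1 else 0)))"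
      by (intro sum.cong) (auto simp: config \<phi>.zero)
    finally show ?thesis by simp
  qed
  have marginal: "(\<Sum>s\<in>Pow {..<N}. p N s * (if J \<subseteq> s then 1 else 0)) = m (card J)"
    if J: "J \<subseteq> {..<N}" for N J
  proof -
    define js where "js = sorted_list_of_set J"
    have "finite J" using J finite_subset by blast
    then have js: "set js = J" "distinct js" "length js = card J"
      by (simp_all add: js_def)
    have "\<phi> (diag [0..<card J]) = \<phi> (diag js)"
      using symmetric_state_diag[OF \<phi> js(2)] js(3) by simp
    then show ?thesis
      unfolding m_def using diag[of js N] J js by simp
  qed
  have "m 0 = 1" by (simp add: m_def one)
  with config(2) marginal obtain M where M: "M \<in> interval_probs 0 1" "\<And>k. (\<integral>x. x ^ k \<partial>M) = m k"
    using hausdorff_moments[of p m] by blast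
  then have U: "M \<in> unit_measures" by (simp add: interval_probs_iff)
  have "\<phi> (diag [0..<k]) = complex_of_real (\<integral>x. x ^ k \<partial>M)" for k
  proof -
    have "set [0..<k] \<subseteq> {..<k}" by auto
    from diag[OF this] show ?thesis
      by (simp only: M(2) m_def Re_complex_of_real)
  qed
  then have "has_moments (\<lambda>k. complex_of_real (\<integral>x. x ^ k \<partial>M)) \<phi>"
    using symmetric_state_has_moments[OF \<phi>] by simp
  then have "\<phi> = barycentre M"
    by (intro functional_eq_if_same_moments[OF dual barycentre_dual[OF U] _ barycentre_has_moments[OF U]])
  with M(1) show ?thesis by (rule that)
qed

lemma symmetric_states_eq: "symmetric_states a = barycentre ` interval_probs 0 1"
  using symmetric_state_barycentre barycentre_symmetric_state by (metis (no_types) image_iff subsetI subset_antisym image_subsetI)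

end

section \<open>The simplex of symmetric states\<close>

context car_algebra
begin

lemma convex_symmetric_states: "convex (symmetric_states a)"
  unfolding convex_def
proof (intro ballI allI impI)
  fix \<phi> \<psi> and u v :: real
  assume "\<phi> \<in> symmetric_states a" "\<psi> \<in> symmetric_states a" and uv: "0 \<le> u" "0 \<le> v" "u + v = 1"
  then obtain M N where M: "M \<in> interval_probs 0 1" "\<phi> = barycentre M"
      and N: "N \<in> interval_probs 0 1" "\<psi> = barycentre N"
    by (meson symmetric_state_barycentre)
  then have MN: "M \<in> unit_measures" "N \<in> unit_measures" "measure M {0..1} = 1" "measure N {0..1} = 1"
    by (simp_all add: interval_probs_iff)
  obtain L where L: "L \<in> unit_measures"
      "\<And>A. A \<in> unit_borel \<Longrightarrow> measure L A = u * measure M A + v * measure N A"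
    using unit_measures_lincomb[OF MN(1,2) uv(1,2)] by blast
  have "measure L {0..1} = 1"
    using L(2)[OF unit_interval_borel] MN uv by simp
  then have "barycentre L \<in> symmetric_states a"
    using L(1) by (intro barycentre_symmetric_state) (simp add: interval_probs_iff)
  then show "u *\<^sub>R \<phi> + v *\<^sub>R \<psi> \<in> symmetric_states a"
    unfolding M(2) N(2) using barycentre_lincomb[OF MN(1,2) L(1) uv(1,2) L(2)] by simp
qed

subsection \<open>Compactness\<close>

lemma closed_symmetric_states_and_bounded:
  "symmetric_states a \<subseteq> {\<phi>. \<forall>x. \<phi> x \<in> cball 0 (norm x)}" "closed (symmetric_states a)"
proof -
  show bound: "symmetric_states a \<subseteq> {\<phi>. \<forall>x. \<phi> x \<in> cball 0 (norm x)}"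
  proof
    fix \<phi> assume "\<phi> \<in> symmetric_states a"
    then obtain M where M: "M \<in> interval_probs 0 1" "\<phi> = barycentre M"
      by (rule symmetric_state_barycentre)
    then show "\<phi> \<in> {\<phi>. \<forall>x. \<phi> x \<in> cball 0 (norm x)}"
      using norm_barycentre_le[of M] by (simp add: interval_probs_iff)
  qed
  \<comment> \<open>Membership in the dual asks for some constant, which is not a closed condition.
    With the explicit bound \<open>norm x\<close>, inherited from barycentres, the set becomes an
    intersection of conditions that are closed in the product topology.\<close>
  have "symmetric_states a = {\<phi>. (\<forall>x. \<phi> x \<in> cball 0 (norm x)) \<and>
      (\<forall>x y. \<phi> (x + y) = \<phi> x + \<phi> y) \<and> (\<forall>c x. \<phi> (c *\<^sub>C x) = c * \<phi> x) \<and>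
      (\<forall>x. \<phi> (star x * x) \<in> \<real>\<^sub>\<ge>\<^sub>0) \<and> \<phi> 1 = 1 \<and>
      (\<forall>g x. g \<in> finitary_perms \<longrightarrow> \<phi> (car_action a g x) = \<phi> x)}" (is "_ = ?R")
  proof
    show "symmetric_states a \<subseteq> ?R"
    proof
      fix \<phi> assume \<phi>: "\<phi> \<in> symmetric_states a"
      then have "\<phi> (car_action a g x) = \<phi> x" if "g \<in> finitary_perms" for g x
        using that unfolding symmetric_states_def by (metis (mono_tags, lifting) comp_apply mem_Collect_eq)
      then show "\<phi> \<in> ?R"
        using \<phi> bound by (auto simp: symmetric_states_def states_def cstar_dual_def complex_nonneg_Reals_iff complex_is_Real_iff)
    qed
    show "?R \<subseteq> symmetric_states a"
    proof
      fix \<phi> assume \<phi>: "\<phi> \<in> ?R"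
      then have "\<exists>K. \<forall>x. cmod (\<phi> x) \<le> K * norm x"
        by (intro exI[of _ 1]) simp
      then show "\<phi> \<in> symmetric_states a"
        using \<phi> by (auto simp: symmetric_states_def states_def cstar_dual_def complex_nonneg_Reals_iff complex_is_Real_iff fun_eq_iff)
    qed
  qed
  also have "closed ?R"
  proof (intro closed_Collect_conj closed_Collect_all closed_Collect_imp closed_Collect_eq continuous_intros)
    have cont: "continuous_on UNIV (\<lambda>\<phi> :: 'a \<Rightarrow> complex. \<phi> x)" for x :: 'a
      by (rule continuous_on_product_coordinates)
    show "closed {\<phi> :: 'a \<Rightarrow> complex. \<phi> x \<in> cball 0 (norm x)}" for x :: 'a
      using closed_vimage[OF closed_cball[of 0 "norm x"] cont[of x]] unfolding vimage_def .
    show "closed {\<phi> :: 'a \<Rightarrow> complex. \<phi> (star x * x) \<in> \<real>\<^sub>\<ge>\<^sub>0}" for x :: 'a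
      using closed_vimage[OF closed_nonneg_Reals_complex cont[of "star x * x"]] unfolding vimage_def .
  qed (simp_all)
  finally show "closed (symmetric_states a)" .
qed

lemma weak_star_eq: "weak_star = top_of_set cstar_dual"
  by (simp add: weak_star_def euclidean_product_topology)

lemma symmetric_states_dual: "symmetric_states a \<subseteq> cstar_dual"
  by (auto simp: symmetric_states_def states_def)

lemma weak_star_symmetric_states: "subtopology weak_star (symmetric_states a) = top_of_set (symmetric_states a)"
  using symmetric_states_dual by (simp add: weak_star_eq subtopology_subtopology Int_absorb1)

text \<open>Banach-Alaoglu in coordinates: the product of the discs of radius \<open>norm x\<close>
  is compact by Tychonoff, and the symmetric states are a closed subset of it.\<close>

lemma compactin_symmetric_states: "compactin weak_star (symmetric_states a)"
proof -
  have "compactin (product_topology (\<lambda>_::'a. euclidean) UNIV) (PiE UNIV (\<lambda>x. cball (0::complex) (norm x)))"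
    by (simp add: compactin_PiE compactin_euclidean_iff)
  then have "compact (PiE UNIV (\<lambda>x::'a. cball (0::complex) (norm x)))"
    by (simp add: euclidean_product_topology)
  moreover have "PiE UNIV (\<lambda>x::'a. cball (0::complex) (norm x)) = {\<phi>. \<forall>x. \<phi> x \<in> cball 0 (norm x)}"
    by (auto simp: PiE_def Pi_def)
  ultimately have "compact (symmetric_states a)"
    using closed_symmetric_states_and_bounded by (metis closed_Int_compact inf.absorb1)
  then show ?thesis
    using symmetric_states_dual by (simp add: weak_star_eq compactin_subtopology)
qed

subsection \<open>The cone over the symmetric states\<close>

text \<open>The height in the cone is the total mass, so finite measures parametrise the cone as
  probability measures parametrise its base.\<close>

definition cone_point :: "real measure \<Rightarrow> real \<times> ('a \<Rightarrow> complex)" where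
  "cone_point M = (measure M {0..1}, barycentre M)"

lemma cone_point_lincomb:
  assumes "M \<in> unit_measures" "N \<in> unit_measures" "L \<in> unit_measures" "s \<ge> 0" "t \<ge> 0"
    and "\<And>A. A \<in> unit_borel \<Longrightarrow> measure L A = s * measure M A + t * measure N A"
  shows "cone_point L = s *\<^sub>R cone_point M + t *\<^sub>R cone_point N"
  using barycentre_lincomb[OF assms] assms(6)[OF unit_interval_borel]
  by (simp add: cone_point_def)

lemma cone_point_add:
  assumes "M \<in> unit_measures" "N \<in> unit_measures" "L \<in> unit_measures"
    and "\<And>A. A \<in> unit_borel \<Longrightarrow> measure L A = measure M A + measure N A"
  shows "cone_point L = cone_point M + cone_point N"
  using cone_point_lincomb[OF assms(1-3), of 1 1] assms(4) by simp

lemma symmetric_cone: "cone hull ({1::real} \<times> symmetric_states a) = cone_point ` unit_measures"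
proof
  show "cone hull ({1::real} \<times> symmetric_states a) \<subseteq> cone_point ` unit_measures"
  proof
    fix p assume "p \<in> cone hull ({1::real} \<times> symmetric_states a)"
    then obtain c \<phi> where c: "c \<ge> 0" "\<phi> \<in> symmetric_states a" "p = c *\<^sub>R (1, \<phi>)"
      unfolding cone_hull_expl by auto
    then obtain M where M: "M \<in> interval_probs 0 1" "\<phi> = barycentre M"
      by (meson symmetric_state_barycentre)
    then have U: "M \<in> unit_measures" "measure M {0..1} = 1" by (simp_all add: interval_probs_iff)
    obtain L where L: "L \<in> unit_measures" "\<And>A. A \<in> unit_borel \<Longrightarrow> measure L A = c * measure M A"
      using unit_measures_scale[OF U(1) c(1)] by blast
    have "cone_point L = c *\<^sub>R cone_point M + 0 *\<^sub>R cone_point M"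
      using L c by (intro cone_point_lincomb U) auto
    also have "\<dots> = p" using c M U by (simp add: cone_point_def)
    finally show "p \<in> cone_point ` unit_measures" using L(1) by blast
  qed
next
  show "cone_point ` unit_measures \<subseteq> cone hull ({1::real} \<times> symmetric_states a)"
  proof (rule image_subsetI)
    fix M :: "real measure" assume M: "M \<in> unit_measures"
    define c where "c = measure M {0..1}"
    have c: "c \<ge> 0" by (simp add: c_def)
    show "cone_point M \<in> cone hull ({1::real} \<times> symmetric_states a)"
    proof (cases "c = 0")
      case True
      then have "barycentre M = 0"
        using norm_barycentre_le[OF M] by (auto simp: c_def fun_eq_iff)
      then have "cone_point M = 0"
        using True by (simp add: cone_point_def c_def zero_prod_def)
      \<comment> \<open>The zero vector lies in the cone hull only if the base is nonempty; the
        point mass at 0 provides an element.\<close>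
      moreover have "return (restrict_space borel {0..1}) 0 \<in> interval_probs 0 1"
        by (auto simp: interval_probs_def intro!: prob_space_return simp: space_restrict_space)
      then have "symmetric_states a \<noteq> {}"
        using barycentre_symmetric_state by blast
      ultimately show ?thesis by (simp add: cone_hull_contains_0[symmetric])
    next
      case False
      obtain L where L: "L \<in> unit_measures" "\<And>A. A \<in> unit_borel \<Longrightarrow> measure L A = 1 / c * measure M A"
        using unit_measures_scale[OF M, of "1 / c"] c by auto
      have "measure L {0..1} = 1"
        using L(2)[OF unit_interval_borel] False by (simp add: c_def)
      then have "barycentre L \<in> symmetric_states a"
        using L(1) by (intro barycentre_symmetric_state) (simp add: interval_probs_iff)
      then have "c *\<^sub>R (1, barycentre L) \<in> cone hull ({1::real} \<times> symmetric_states a)"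
        using c by (intro mem_cone_hull) auto
      moreover have "cone_point M = c *\<^sub>R cone_point L + 0 *\<^sub>R cone_point L"
        using L(2) False c by (intro cone_point_lincomb[OF L(1) L(1) M]) auto
      moreover have "cone_point L = (1, barycentre L)"
        by (simp add: cone_point_def \<open>measure L {0..1} = 1\<close>)
      ultimately show ?thesis by simp
    qed
  qed
qed

text \<open>Injectivity of the barycentre turns the order of the cone into the setwise order of
  finite measures, where lattice operations can be constructed.\<close>

lemma cone_order:
  assumes MN: "M \<in> unit_measures" "N \<in> unit_measures"
  shows "cone_point N - cone_point M \<in> cone_point ` unit_measures
    \<longleftrightarrow> (\<forall>A\<in>unit_borel. measure M A \<le> measure N A)"
proof
  assume "cone_point N - cone_point M \<in> cone_point ` unit_measures"
  then obtain D where D: "D \<in> unit_measures" "cone_point N - cone_point M = cone_point D" by blast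
  obtain L where L: "L \<in> unit_measures" "\<And>A. A \<in> unit_borel \<Longrightarrow> measure L A = measure M A + measure D A"
    using unit_measures_add[OF MN(1) D(1)] by blast
  have "cone_point L = cone_point N"
    using cone_point_add[OF MN(1) D(1) L] D(2) by (simp add: algebra_simps)
  then have "L = N"
    using barycentre_inj[OF L(1) MN(2)] by (simp add: cone_point_def)
  then show "\<forall>A\<in>unit_borel. measure M A \<le> measure N A"
    using L(2) by auto
next
  assume le: "\<forall>A\<in>unit_borel. measure M A \<le> measure N A"
  obtain D where D: "D \<in> unit_measures" "\<And>A. A \<in> unit_borel \<Longrightarrow> measure N A = measure M A + measure D A"
    using unit_measures_diff[OF MN] le by blast
  have "cone_point N = cone_point M + cone_point D"
    by (rule cone_point_add[OF MN(1) D(1) MN(2) D(2)])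
  then show "cone_point N - cone_point M \<in> cone_point ` unit_measures"
    using D(1) by simp
qed

text \<open>\<open>M\<close> dominates \<open>N\<close> on a Hahn set \<open>Y\<close> and is
  dominated off it. So the supremum \<open>S\<close> is \<open>M\<close> on \<open>Y\<close> and
  \<open>N\<close> elsewhere, and the infimum \<open>I\<close> is the reverse; any other bound is
  compared with them on the two pieces separately.\<close>

lemma lattice_symmetric_cone: "lattice_cone (cone_point ` unit_measures)"
  unfolding lattice_cone_def
proof (intro ballI)
  fix p q assume "p \<in> cone_point ` unit_measures" "q \<in> cone_point ` unit_measures"
  then obtain M N where p: "p = cone_point M" and q: "q = cone_point N"
    and MN: "M \<in> unit_measures" "N \<in> unit_measures" by blast
  obtain Y where Y: "Y \<in> unit_borel"
    "\<And>A. A \<in> unit_borel \<Longrightarrow> measure N (A \<inter> Y) \<le> measure M (A \<inter> Y)"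
    "\<And>A. A \<in> unit_borel \<Longrightarrow> measure M (A \<inter> ({0..1} - Y)) \<le> measure N (A \<inter> ({0..1} - Y))"
    using unit_measures_hahn[OF MN] by blast
  have Z: "{0..1} - Y \<in> unit_borel"
    using Y(1) unit_interval_borel by (rule sets.Diff[rotated])
  note split = unit_measures_split[OF _ _ Y(1)]
  obtain S where S: "S \<in> unit_measures"
    "\<And>A. A \<in> unit_borel \<Longrightarrow> measure S A = measure M (A \<inter> Y) + measure N (A \<inter> ({0..1} - Y))"
    using unit_measures_construct[OF MN Y(1) Z] by blast
  obtain I where I: "I \<in> unit_measures"
    "\<And>A. A \<in> unit_borel \<Longrightarrow> measure I A = measure N (A \<inter> Y) + measure M (A \<inter> ({0..1} - Y))"
    using unit_measures_construct[OF MN(2,1) Y(1) Z] by blast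
  let ?C = "cone_point ` unit_measures"
  have "\<exists>s\<in>?C. s - p \<in> ?C \<and> s - q \<in> ?C \<and> (\<forall>u\<in>?C. u - p \<in> ?C \<and> u - q \<in> ?C \<longrightarrow> u - s \<in> ?C)"
  proof (intro bexI[of _ "cone_point S"] conjI ballI impI)
    show "cone_point S - p \<in> ?C"
      unfolding p cone_order[OF MN(1) S(1)] using split[OF MN(1)] S(2) Y(3) by simp
    show "cone_point S - q \<in> ?C"
      unfolding q cone_order[OF MN(2) S(1)] using split[OF MN(2)] S(2) Y(2) by simp
    fix u assume "u \<in> ?C" and u: "u - p \<in> ?C \<and> u - q \<in> ?C"
    then obtain K where K: "u = cone_point K" "K \<in> unit_measures" by blast
    have le: "measure M A \<le> measure K A" "measure N A \<le> measure K A" if "A \<in> unit_borel" for A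
      using u that unfolding K(1) p q cone_order[OF MN(1) K(2)] cone_order[OF MN(2) K(2)] by auto
    show "u - cone_point S \<in> ?C"
      unfolding K(1) cone_order[OF S(1) K(2)]
    proof
      fix A assume A: "A \<in> unit_borel"
      have "measure S A \<le> measure K (A \<inter> Y) + measure K (A \<inter> ({0..1} - Y))"
        unfolding S(2)[OF A] using A Y(1) Z by (intro add_mono le sets.Int)
      then show "measure S A \<le> measure K A" using split[OF K(2) A] by simp
    qed
  qed (use S(1) in blast)
  moreover have "\<exists>i\<in>?C. p - i \<in> ?C \<and> q - i \<in> ?C \<and> (\<forall>u\<in>?C. p - u \<in> ?C \<and> q - u \<in> ?C \<longrightarrow> i - u \<in> ?C)"
  proof (intro bexI[of _ "cone_point I"] conjI ballI impI)
    show "p - cone_point I \<in> ?C"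
      unfolding p cone_order[OF I(1) MN(1)] using split[OF MN(1)] I(2) Y(2) by simp
    show "q - cone_point I \<in> ?C"
      unfolding q cone_order[OF I(1) MN(2)] using split[OF MN(2)] I(2) Y(3) by simp
    fix u assume "u \<in> ?C" and u: "p - u \<in> ?C \<and> q - u \<in> ?C"
    then obtain K where K: "u = cone_point K" "K \<in> unit_measures" by blast
    have le: "measure K A \<le> measure M A" "measure K A \<le> measure N A" if "A \<in> unit_borel" for A
      using u that unfolding K(1) p q cone_order[OF K(2) MN(1)] cone_order[OF K(2) MN(2)] by auto
    show "cone_point I - u \<in> ?C"
      unfolding K(1) cone_order[OF K(2) I(1)]
    proof
      fix A assume A: "A \<in> unit_borel"
      have "measure K (A \<inter> Y) + measure K (A \<inter> ({0..1} - Y)) \<le> measure I A"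
        unfolding I(2)[OF A] using A Y(1) Z by (intro add_mono le sets.Int)
      then show "measure K A \<le> measure I A" using split[OF K(2) A] by simp
    qed
  qed (use I(1) in blast)
  ultimately show "(\<exists>s\<in>?C. s - p \<in> ?C \<and> s - q \<in> ?C \<and> (\<forall>u\<in>?C. u - p \<in> ?C \<and> u - q \<in> ?C \<longrightarrow> u - s \<in> ?C)) \<and>
      (\<exists>i\<in>?C. p - i \<in> ?C \<and> q - i \<in> ?C \<and> (\<forall>u\<in>?C. p - u \<in> ?C \<and> q - u \<in> ?C \<longrightarrow> i - u \<in> ?C))"
    by blast
qed

lemma choquet_simplex_symmetric_states: "choquet_simplex weak_star (symmetric_states a)"
  unfolding choquet_simplex_def symmetric_cone
  using compactin_symmetric_states convex_symmetric_states lattice_symmetric_cone by blast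

subsection \<open>Extreme points\<close>

text \<open>A symmetric state is extreme iff the occupation numbers have variance zero in its mixing
  measure; this is the closed condition below.\<close>

lemma extreme_symmetric_states:
  "{\<phi>. \<phi> extreme_point_of symmetric_states a}
    = {\<phi> \<in> symmetric_states a. \<phi> (diag [0, 1]) = \<phi> (diag [0]) ^ 2}"
proof (intro Collect_cong iffI conjI)
  fix \<phi> assume "\<phi> extreme_point_of symmetric_states a"
  then have \<phi>: "\<phi> \<in> symmetric_states a"
    and ext: "\<And>\<psi> \<xi>. \<psi> \<in> symmetric_states a \<Longrightarrow> \<xi> \<in> symmetric_states a \<Longrightarrow> \<phi> \<notin> open_segment \<psi> \<xi>"
    by (auto simp: extreme_point_of_def)
  then show "\<phi> \<in> symmetric_states a" by simp
  obtain M where M: "M \<in> interval_probs 0 1" "\<phi> = barycentre M"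
    using symmetric_state_barycentre[OF \<phi>] .
  then have U: "M \<in> unit_measures" by (simp add: interval_probs_iff)
  interpret prob_space M using M(1) by (simp add: interval_probs_def)
  define c where "c = (\<integral>x. x \<partial>M)"
  \<comment> \<open>The part of the interval below the mean. If its mass lay strictly between 0 and
    1, conditioning on it and on its complement would split the state; mass 1 contradicts the mean.
    So it is null, and \<open>x \<ge> c\<close> with mean \<open>c\<close> forces
    \<open>x = c\<close> almost everywhere.\<close>
  define B where "B = {0..1} \<inter> {..<c}"
  have B: "B \<in> unit_borel" "{0..1} - B \<in> unit_borel"
    by (auto simp: B_def sets_restrict_space)
  have int: "integrable M (\<lambda>x. x - c)" "integrable M (\<lambda>x. c - x)" "integrable M (\<lambda>x. x)"
    by (intro unit_measures_integrable[OF U] continuous_intros)+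
  have mean: "(\<integral>x. x - c \<partial>M) = 0" "(\<integral>x. c - x \<partial>M) = 0"
    using int(3) by (simp_all add: prob_space c_def)
  have "measure M B = 0"
  proof (rule ccontr)
    assume pos: "measure M B \<noteq> 0"
    define t where "t = measure M B"
    have t: "t > 0" using pos by (simp add: t_def zero_less_measure_iff)
    have total: "t + measure M ({0..1} - B) = 1"
      using unit_measures_split[OF U unit_interval_borel B(1)] M(1) unit_borel_subset[OF B(1)]
      by (simp add: t_def interval_probs_iff Int_absorb1 Int_absorb2 Diff_subset)
    show False
    proof (cases "t = 1")
      case True
      then have "AE x in M. x \<in> B"
        using prob_eq_1[of B] B U by (simp add: t_def unit_measures_sets)
      then have lt: "AE x in M. x < c"
        by (rule AE_mp) (auto simp: B_def)
      then have "AE x in M. c - x = 0"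
        using mean(2) int(2) by (subst (asm) integral_nonneg_eq_0_iff_AE) auto
      with lt have "AE x in M. False"
        by eventually_elim simp
      then show False by (simp add: AE_False)
    next
      case False
      then have s: "1 - t > 0" using total measure_nonneg[of M "{0..1} - B"] by linarith
      obtain P where P: "P \<in> unit_measures"
        "\<And>A. A \<in> unit_borel \<Longrightarrow> measure P A = measure M (A \<inter> B) + measure M (A \<inter> {})"
        using unit_measures_construct[OF U U B(1) sets.empty_sets] by blast
      obtain Q where Q: "Q \<in> unit_measures"
        "\<And>A. A \<in> unit_borel \<Longrightarrow> measure Q A = measure M (A \<inter> ({0..1} - B)) + measure M (A \<inter> {})"
        using unit_measures_construct[OF U U B(2) sets.empty_sets] by blast
      obtain P' where P': "P' \<in> unit_measures" "\<And>A. A \<in> unit_borel \<Longrightarrow> measure P' A = 1 / t * measure P A"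
        using unit_measures_scale[OF P(1), of "1 / t"] t by auto
      obtain Q' where Q': "Q' \<in> unit_measures" "\<And>A. A \<in> unit_borel \<Longrightarrow> measure Q' A = 1 / (1 - t) * measure Q A"
        using unit_measures_scale[OF Q(1), of "1 / (1 - t)"] s by auto
      have "measure P' {0..1} = 1" "measure Q' {0..1} = 1"
        using t s total unit_borel_subset[OF B(1)]
        by (simp_all add: P' Q' P Q unit_interval_borel Int_absorb1 Diff_subset flip: t_def)
      then have "barycentre P' \<in> symmetric_states a" "barycentre Q' \<in> symmetric_states a"
        using P'(1) Q'(1) by (auto intro!: barycentre_symmetric_state simp: interval_probs_iff)
      moreover have "barycentre P' \<noteq> barycentre Q'"
      proof
        assume "barycentre P' = barycentre Q'"
        then have "P' = Q'" by (rule barycentre_inj[OF P'(1) Q'(1)])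
        moreover have "measure P' B = 1" "measure Q' B = 0"
          using t by (simp_all add: P' Q' P Q B flip: t_def)
        ultimately show False by simp
      qed
      moreover have "\<phi> = (1 - (1 - t)) *\<^sub>R barycentre P' + (1 - t) *\<^sub>R barycentre Q'"
        unfolding M(2)
      proof (rule barycentre_lincomb[OF P'(1) Q'(1) U])
        show "measure M A = (1 - (1 - t)) * measure P' A + (1 - t) * measure Q' A" if "A \<in> unit_borel" for A
          using unit_measures_split[OF U that B(1)] that t s by (simp add: P' Q' P Q)
      qed (use t s in auto)
      ultimately have "\<phi> \<in> open_segment (barycentre P') (barycentre Q')"
        unfolding in_segment using t s by (intro conjI exI[of _ "1 - t"]) auto
      with ext \<open>barycentre P' \<in> _\<close> \<open>barycentre Q' \<in> _\<close> show False by blast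
    qed
  qed
  then have "AE x in M. x \<notin> B"
    using B(1) U prob_eq_0[of B] by (simp add: unit_measures_sets)
  then have ge: "AE x in M. x \<ge> c"
    by (rule AE_mp) (auto intro!: AE_I2 simp: B_def unit_measures_space[OF U])
  then have "AE x in M. x - c = 0"
    using mean(1) int(1) by (subst (asm) integral_nonneg_eq_0_iff_AE) auto
  then have "(\<integral>x. x ^ 2 \<partial>M) = (\<integral>x. c ^ 2 \<partial>M)"
    by (intro integral_cong_AE unit_measures_measurable[OF U]) (auto intro!: continuous_intros)
  then have "(\<integral>x. x ^ 2 \<partial>M) = c ^ 2" by (simp add: prob_space)
  then show "\<phi> (diag [0, 1]) = \<phi> (diag [0]) ^ 2"
    using barycentre_diag[OF U, of "[0, 1]"] barycentre_diag[OF U, of "[0]"]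
    by (simp add: M(2) c_def numeral_2_eq_2[symmetric])
next
  fix \<phi> assume *: "\<phi> \<in> symmetric_states a \<and> \<phi> (diag [0, 1]) = \<phi> (diag [0]) ^ 2"
  show "\<phi> extreme_point_of symmetric_states a"
    unfolding extreme_point_of_def
  proof (intro conjI ballI notI)
    show "\<phi> \<in> symmetric_states a" using * by simp
    fix \<psi> \<xi> assume "\<psi> \<in> symmetric_states a" "\<xi> \<in> symmetric_states a" and seg: "\<phi> \<in> open_segment \<psi> \<xi>"
    then obtain P Q where P: "P \<in> interval_probs 0 1" "\<psi> = barycentre P"
        and Q: "Q \<in> interval_probs 0 1" "\<xi> = barycentre Q"
      by (meson symmetric_state_barycentre)
    then have U: "P \<in> unit_measures" "Q \<in> unit_measures" by (simp_all add: interval_probs_iff)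
    from seg obtain u where u: "0 < u" "u < 1" "\<phi> = (1 - u) *\<^sub>R \<psi> + u *\<^sub>R \<xi>" and neq: "\<psi> \<noteq> \<xi>"
      by (auto simp: in_segment)
    define p1 p2 q1 q2 where "p1 = (\<integral>x. x \<partial>P)" "p2 = (\<integral>x. x ^ 2 \<partial>P)" "q1 = (\<integral>x. x \<partial>Q)" "q2 = (\<integral>x. x ^ 2 \<partial>Q)"
    have "\<phi> (diag [0, 1]) = complex_of_real ((1 - u) * p2 + u * q2)"
      using barycentre_diag[OF U(1), of "[0, 1]"] barycentre_diag[OF U(2), of "[0, 1]"]
      by (simp add: u(3) P(2) Q(2) p1_p2_q1_q2_def scaleR_conv_of_real numeral_2_eq_2[symmetric])
    moreover have "\<phi> (diag [0]) = complex_of_real ((1 - u) * p1 + u * q1)"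
      using barycentre_diag[OF U(1), of "[0]"] barycentre_diag[OF U(2), of "[0]"]
      by (simp add: u(3) P(2) Q(2) p1_p2_q1_q2_def scaleR_conv_of_real)
    ultimately have "complex_of_real ((1 - u) * p2 + u * q2) = complex_of_real (((1 - u) * p1 + u * q1) ^ 2)"
      using * by (simp only: of_real_power)
    then have eq: "(1 - u) * p2 + u * q2 = ((1 - u) * p1 + u * q1) ^ 2"
      by (simp only: of_real_eq_iff)
    have ge: "p2 \<ge> p1 ^ 2" "q2 \<ge> q1 ^ 2"
      using variance_nonneg[OF P(1)] variance_nonneg[OF Q(1)] by (simp_all add: p1_p2_q1_q2_def)
    \<comment> \<open>Law of total variance: the variance of the mixture, which is 0, is the average
      of the two variances plus the variance between the means. All three terms are nonnegative and
      hence vanish, which leaves two measures without variance and with equal means.\<close>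
    have "(1 - u) * (p2 - p1 ^ 2) + u * (q2 - q1 ^ 2) + (1 - u) * u * (p1 - q1) ^ 2 = 0"
      using eq by (simp add: power2_eq_square algebra_simps)
    moreover have "0 \<le> (1 - u) * (p2 - p1 ^ 2)" "0 \<le> u * (q2 - q1 ^ 2)" "0 \<le> (1 - u) * u * (p1 - q1) ^ 2"
      using u ge by simp_all
    ultimately have "(1 - u) * (p2 - p1 ^ 2) = 0" "u * (q2 - q1 ^ 2) = 0" "(1 - u) * u * (p1 - q1) ^ 2 = 0"
      by linarith+
    then have "p2 = p1 ^ 2" "q2 = q1 ^ 2" "p1 = q1"
      using u by auto
    then have "(\<integral>x. x ^ k \<partial>P) = (\<integral>x. x ^ k \<partial>Q)" for k
      using zero_variance_moments[OF P(1), of k] zero_variance_moments[OF Q(1), of k]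
      by (simp add: p1_p2_q1_q2_def)
    then have "P = Q" by (rule unit_measures_eq_if_same_moments[OF U])
    with neq P(2) Q(2) show False by simp
  qed
qed

lemma closedin_extreme_symmetric_states:
  "closedin weak_star {\<phi>. \<phi> extreme_point_of symmetric_states a}"
proof -
  have "closed {\<phi> :: 'a \<Rightarrow> complex. \<phi> (diag [0, 1]) = \<phi> (diag [0]) ^ 2}"
    by (intro closed_Collect_eq continuous_on_power continuous_on_product_coordinates)
  then have "closed (symmetric_states a \<inter> {\<phi>. \<phi> (diag [0, 1]) = \<phi> (diag [0]) ^ 2})"
    using closed_symmetric_states_and_bounded(2) by (rule closed_Int[rotated])
  moreover have "symmetric_states a \<inter> {\<phi>. \<phi> (diag [0, 1]) = \<phi> (diag [0]) ^ 2}
      = {\<phi> \<in> symmetric_states a. \<phi> (diag [0, 1]) = \<phi> (diag [0]) ^ 2}" by auto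
  ultimately show ?thesis
    unfolding extreme_symmetric_states weak_star_eq
    using symmetric_states_dual by (intro closed_subset) auto
qed

subsection \<open>The affine homeomorphism\<close>

lemma topspace_interval_probs: "topspace (interval_probs_topology 0 1) = interval_probs 0 1"
proof -
  \<comment> \<open>The whole space is itself a generator, from the constant function 0 and
    \<open>U = UNIV\<close>.\<close>
  have "interval_probs 0 1 \<in> {{M \<in> interval_probs 0 1. (\<integral>x. f x \<partial>M) \<in> U} | f U.
        continuous_on {0..1} (f :: real \<Rightarrow> real) \<and> open U}"
    by (intro CollectI exI[of _ "\<lambda>_. 0"] exI[of _ UNIV]) auto
  then show ?thesis
    unfolding interval_probs_topology_def topology_generated_by_topspace by auto
qed

lemma continuous_map_integral:
  fixes f :: "real \<Rightarrow> real"
  assumes "continuous_on {0..1} f"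
  shows "continuous_map (interval_probs_topology 0 1) euclidean (\<lambda>M. \<integral>x. f x \<partial>M)"
  unfolding continuous_map_def topspace_interval_probs
proof (intro conjI allI impI)
  fix U :: "real set" assume "openin euclidean U"
  then have "{M \<in> interval_probs 0 1. (\<integral>x. f x \<partial>M) \<in> U} \<in> {{M \<in> interval_probs 0 1. (\<integral>x. f x \<partial>M) \<in> U} | f U.
        continuous_on {0..1} (f :: real \<Rightarrow> real) \<and> open U}"
    using assms by auto
  then show "openin (interval_probs_topology 0 1) {M \<in> interval_probs 0 1. (\<integral>x. f x \<partial>M) \<in> U}"
    unfolding interval_probs_topology_def by (rule topology_generated_by_Basis)
qed simp

text \<open>The topology is generated by real test functions, so each coordinate is split into real
  and imaginary part; \<open>continuous_product_state\<close> makes both parts admissible.\<close>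

lemma continuous_map_barycentre:
  "continuous_map (interval_probs_topology 0 1) (top_of_set (symmetric_states a)) barycentre"
proof -
  let ?X = "interval_probs_topology 0 1"
  have "continuous_map ?X euclidean (\<lambda>M. barycentre M x)" for x
  proof -
    have Re: "continuous_map ?X euclidean (\<lambda>M. \<integral>\<mu>. Re (product_state \<mu> x) \<partial>M)"
      and Im: "continuous_map ?X euclidean (\<lambda>M. \<integral>\<mu>. Im (product_state \<mu> x) \<partial>M)"
      by (intro continuous_map_integral continuous_intros continuous_product_state)+
    have "continuous_map ?X euclidean ((\<lambda>(u, v). Complex u v) \<circ>
        (\<lambda>M. (\<integral>\<mu>. Re (product_state \<mu> x) \<partial>M, \<integral>\<mu>. Im (product_state \<mu> x) \<partial>M)))"
    proof (rule continuous_map_compose)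
      show "continuous_map ?X (prod_topology euclidean euclidean)
          (\<lambda>M. (\<integral>\<mu>. Re (product_state \<mu> x) \<partial>M, \<integral>\<mu>. Im (product_state \<mu> x) \<partial>M))"
        using Re Im by (intro continuous_map_pairedI)
      have "continuous_on UNIV (\<lambda>(u, v). Complex u v)"
        unfolding Complex_eq case_prod_unfold by (intro continuous_intros)
      then show "continuous_map (prod_topology euclidean euclidean) euclidean (\<lambda>(u, v). Complex u v)"
        by simp
    qed
    moreover have "((\<lambda>(u, v). Complex u v) \<circ>
        (\<lambda>M. (\<integral>\<mu>. Re (product_state \<mu> x) \<partial>M, \<integral>\<mu>. Im (product_state \<mu> x) \<partial>M))) M = barycentre M x"
      if "M \<in> topspace ?X" for M
    proof -
      have "integrable M (\<lambda>\<mu>. product_state \<mu> x)"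
        using that by (intro product_state_integrable) (simp add: topspace_interval_probs interval_probs_iff)
      then show ?thesis
        by (simp add: barycentre_def complex_eq_iff)
    qed
    ultimately show ?thesis
      by (rule continuous_map_eq)
  qed
  then have "continuous_map ?X euclidean barycentre"
    by (simp add: continuous_map_componentwise_UNIV flip: euclidean_product_topology)
  then show ?thesis
    by (rule continuous_map_into_subtopology)
       (auto simp: topspace_interval_probs barycentre_symmetric_state)
qed

definition mixing_measure :: "('a \<Rightarrow> complex) \<Rightarrow> real measure" where
  "mixing_measure = the_inv_into (interval_probs 0 1) barycentre"

lemma inj_on_barycentre: "inj_on barycentre (interval_probs 0 1)"
  by (intro inj_onI barycentre_inj) (simp_all add: interval_probs_iff)

lemma mixing_measure_barycentre: "M \<in> interval_probs 0 1 \<Longrightarrow> mixing_measure (barycentre M) = M"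
  unfolding mixing_measure_def by (rule the_inv_into_f_f[OF inj_on_barycentre])

lemma
  assumes "\<phi> \<in> symmetric_states a"
  shows mixing_measure_interval_probs: "mixing_measure \<phi> \<in> interval_probs 0 1"
    and barycentre_mixing_measure: "barycentre (mixing_measure \<phi>) = \<phi>"
  using assms mixing_measure_barycentre by (auto simp: symmetric_states_eq)

text \<open>For a polynomial the integral is a finite combination of the coordinates
  \<open>\<phi> (diag [0..<i])\<close>, hence continuous in \<phi>. Weierstrass approximation of
  \<open>f\<close> is uniform over all states because the mixing measures have mass 1. This is what
  makes the inverse map continuous.\<close>

lemma continuous_on_mixing_integral:
  fixes f :: "real \<Rightarrow> real"
  assumes f: "continuous_on {0..1} f"
  shows "continuous_on (symmetric_states a) (\<lambda>\<phi>. \<integral>x. f x \<partial>mixing_measure \<phi>)"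
proof -
  have "\<exists>g. real_polynomial_function g \<and> (\<forall>x\<in>{0..1}. \<bar>f x - g x\<bar> < 1 / real (Suc n))" for n
  proof -
    obtain g where "real_polynomial_function g" "\<And>x. x \<in> {0..1} \<Longrightarrow> \<bar>f x - g x\<bar> < 1 / real (Suc n)"
      by (rule Stone_Weierstrass_real_polynomial_function[OF compact_Icc f, of "1 / real (Suc n)"]) auto
    then show ?thesis by blast
  qed
  then obtain g where g: "\<And>n. real_polynomial_function (g n)"
      "\<And>n x. x \<in> {0..1} \<Longrightarrow> \<bar>f x - g n x\<bar> < 1 / real (Suc n)"
    by metis
  have gc: "continuous_on {0..1} (g n)" for n
    using g(1)[of n] by (auto simp: real_polynomial_function_iff_sum intro!: continuous_intros)
  show ?thesis
  proof (rule uniform_limit_theorem)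
    show "\<forall>\<^sub>F n in sequentially. continuous_on (symmetric_states a) (\<lambda>\<phi>. \<integral>x. g n x \<partial>mixing_measure \<phi>)"
    proof (intro always_eventually allI)
      fix n
      obtain c K where c: "g n = (\<lambda>x. \<Sum>i\<le>K. c i * x ^ i)"
        using g(1)[of n] real_polynomial_function_iff_sum by auto
      have "(\<integral>x. g n x \<partial>mixing_measure \<phi>) = (\<Sum>i\<le>K. c i * Re (\<phi> (diag [0..<i])))"
        if \<phi>: "\<phi> \<in> symmetric_states a" for \<phi>
      proof -
        have U: "mixing_measure \<phi> \<in> unit_measures"
          using mixing_measure_interval_probs[OF \<phi>] by (simp add: interval_probs_iff)
        have "integrable (mixing_measure \<phi>) (\<lambda>x. c i * x ^ i)" for i
          by (intro unit_measures_integrable[OF U] continuous_intros)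
        moreover have "Re (\<phi> (diag [0..<i])) = (\<integral>x. x ^ i \<partial>mixing_measure \<phi>)" for i
          using barycentre_diag[OF U, of "[0..<i]"] by (simp add: barycentre_mixing_measure[OF \<phi>])
        ultimately show ?thesis
          unfolding c by (subst Bochner_Integration.integral_sum) auto
      qed
      moreover have "continuous_on (symmetric_states a) (\<lambda>\<phi>. \<Sum>i\<le>K. c i * Re (\<phi> (diag [0..<i])))"
        by (intro continuous_intros continuous_on_subset[OF continuous_on_product_coordinates]) auto
      ultimately show "continuous_on (symmetric_states a) (\<lambda>\<phi>. \<integral>x. g n x \<partial>mixing_measure \<phi>)"
        by (simp cong: continuous_on_cong)
    qed
    show "uniform_limit (symmetric_states a) (\<lambda>n \<phi>. \<integral>x. g n x \<partial>mixing_measure \<phi>)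
        (\<lambda>\<phi>. \<integral>x. f x \<partial>mixing_measure \<phi>) sequentially"
    proof (rule uniform_limitI)
      fix e :: real assume "e > 0"
      then have "\<forall>\<^sub>F n in sequentially. 1 / real (Suc n) < e"
        using LIMSEQ_inverse_real_of_nat[THEN order_tendstoD(2)] by (simp add: inverse_eq_divide)
      then show "\<forall>\<^sub>F n in sequentially. \<forall>\<phi>\<in>symmetric_states a.
          dist (\<integral>x. g n x \<partial>mixing_measure \<phi>) (\<integral>x. f x \<partial>mixing_measure \<phi>) < e"
      proof eventually_elim
        case (elim n)
        show ?case
        proof
          fix \<phi> assume \<phi>: "\<phi> \<in> symmetric_states a"
          have U: "mixing_measure \<phi> \<in> unit_measures" "measure (mixing_measure \<phi>) {0..1} = 1"
            using mixing_measure_interval_probs[OF \<phi>] by (simp_all add: interval_probs_iff)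
          have "(\<integral>x. f x \<partial>mixing_measure \<phi>) - (\<integral>x. g n x \<partial>mixing_measure \<phi>) = (\<integral>x. f x - g n x \<partial>mixing_measure \<phi>)"
            by (intro Bochner_Integration.integral_diff[symmetric] unit_measures_integrable U f gc)
          moreover have "norm (\<integral>x. f x - g n x \<partial>mixing_measure \<phi>) \<le> 1 / real (Suc n) * measure (mixing_measure \<phi>) {0..1}"
          proof (rule unit_measures_integral_bound[OF U(1)])
            show "norm (f x - g n x) \<le> 1 / real (Suc n)" if "x \<in> {0..1}" for x
              using g(2)[OF that, of n] by (simp only: real_norm_def less_imp_le)
          qed (intro continuous_on_diff f gc)
          ultimately show "dist (\<integral>x. g n x \<partial>mixing_measure \<phi>) (\<integral>x. f x \<partial>mixing_measure \<phi>) < e"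
            using elim unfolding U(2) by (simp add: dist_norm norm_minus_commute)
        qed
      qed
    qed
  qed simp
qed

lemma continuous_map_mixing_measure:
  "continuous_map (top_of_set (symmetric_states a)) (interval_probs_topology 0 1) mixing_measure"
  unfolding interval_probs_topology_def continuous_on_generated_topo_iff
proof (intro conjI allI impI)
  fix V assume "V \<in> {{M \<in> interval_probs 0 1. (\<integral>x. f x \<partial>M) \<in> U} | f U.
      continuous_on {0..1} (f :: real \<Rightarrow> real) \<and> open U}"
  then obtain f :: "real \<Rightarrow> real" and U where f: "continuous_on {0..1} f" "open U"
    and V: "V = {M \<in> interval_probs 0 1. (\<integral>x. f x \<partial>M) \<in> U}" by blast
  have "mixing_measure -` V \<inter> topspace (top_of_set (symmetric_states a))
      = symmetric_states a \<inter> (\<lambda>\<phi>. \<integral>x. f x \<partial>mixing_measure \<phi>) -` U"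
    using mixing_measure_interval_probs by (auto simp: V)
  then show "openin (top_of_set (symmetric_states a)) (mixing_measure -` V \<inter> topspace (top_of_set (symmetric_states a)))"
    using continuous_openin_preimage_gen[OF continuous_on_mixing_integral[OF f(1)] f(2)] by simp
next
  show "mixing_measure ` topspace (top_of_set (symmetric_states a)) \<subseteq> \<Union> {{M \<in> interval_probs 0 1. (\<integral>x. f x \<partial>M) \<in> U} | f U.
      continuous_on {0..1} (f :: real \<Rightarrow> real) \<and> open U}"
    using mixing_measure_interval_probs topspace_interval_probs
    unfolding interval_probs_topology_def topology_generated_by_topspace by auto
qed

lemma homeomorphic_map_barycentre:
  "homeomorphic_map (interval_probs_topology 0 1) (subtopology weak_star (symmetric_states a)) barycentre"
  unfolding homeomorphic_map_maps homeomorphic_maps_def weak_star_symmetric_states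
  using continuous_map_barycentre continuous_map_mixing_measure
  by (intro exI[of _ mixing_measure])
     (auto simp: topspace_interval_probs mixing_measure_barycentre barycentre_mixing_measure)

lemma affine_barycentre: "affine_on_interval_probs 0 1 barycentre"
  unfolding affine_on_interval_probs_def
  by (intro ballI impI barycentre_lincomb) (auto simp: interval_probs_iff)

end

theorem proposition5p6:
  fixes a :: "nat \<Rightarrow> 'a::cstar_algebra"
  assumes "car_algebra a"
  shows "choquet_simplex weak_star (symmetric_states a) \<and>
    closedin weak_star {\<phi>. \<phi> extreme_point_of symmetric_states a} \<and>
    (\<exists>l u F. l < u \<and>
       homeomorphic_map (interval_probs_topology l u)
         (subtopology weak_star (symmetric_states a)) F \<and>
       affine_on_interval_probs l u F)"
proof -
  interpret car_algebra a by (rule assms)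
  have "\<exists>l u F. l < u \<and>
       homeomorphic_map (interval_probs_topology l u)
         (subtopology weak_star (symmetric_states a)) F \<and>
       affine_on_interval_probs l u F"
    using homeomorphic_map_barycentre affine_barycentre
    by (intro exI[of _ 0] exI[of _ 1] exI[of _ barycentre]) simp
  then show ?thesis
    using choquet_simplex_symmetric_states closedin_extreme_symmetric_states by blast
qed

end
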